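(* Assume $\bar\Lambda\neq 0$ and put $\varepsilon_0:=(\bar\Lambda/\Lambda)^{1/2}\in(0,1]$. Then for any fixed $\varepsilon\in(0,\varepsilon_0)$, $$n^{Y_d}(\varepsilon)\sim d\cdot q(\varepsilon),\quad d\to\infty,$$ where $$q(\varepsilon):=\bar\Lambda\int_0^{1-(\varepsilon/\varepsilon_0)^2}\exp\{F^{-1}(y)\}\,dy,\quad \varepsilon\in(0,\varepsilon_0).$$
   Context: $\mathbb N$ is the set of positive integers. $X_j(t)$, $t\in[0,1]$, $j\in\mathbb N$, are random processes on a common probability space, jointly measurable with sample paths in $L_2([0,1])$. All $X_j$ have zero mean and the same continuous covariance function $\mathcal K(t,s)=\mathbb E\,X_j(t)X_j(s)$, $t,s\in[0,1]$, and they are uncorrelated: $\mathbb E\,X_j(t)X_k(s)=0$ for $j\ne k$ and all $t,s$. For $d\in\mathbb N$ define $$Y_d(t):=\sum_{j=1}^d X_j(t_j),\quad t=(t_1,\dots,t_d)\in[0,1]^d,$$ and $I_j:=\int_0^1 X_j(s)\,ds$. Constants: $\Lambda:=\int_0^1\mathcal K(s,s)\,ds$, $\bar\lambda_0:=\int_0^1\int_0^1\mathcal K(t,s)\,dt\,ds$, $\bar\Lambda:=\Lambda-\bar\lambda_0$. Let $(\bar\lambda_k)_{k\in\mathbb N}$ be the non-increasing sequence of eigenvalues (counted with multiplicity, padded by zeros if the operator has finite rank) of the covariance operator on $L_2([0,1])$ of the process $X_j(t)-I_j$, $t\in[0,1]$ (it does not depend on $j$); one has $\bar\Lambda=\sum_{k}\bar\lambda_k$.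 Define the distribution function $$F(x):=\frac1{\bar\Lambda}\sum_{k=1}^\infty\bar\lambda_k\,\mathbf 1(\bar\lambda_k\geqslant e^{-x}),\quad x\in\mathbb R,$$ and its generalized inverse $F^{-1}(y):=\inf\{x\in\mathbb R: F(x)\geqslant y\}$, $y\in(0,1)$. $\langle\cdot,\cdot\rangle_{2,d}$ and $\|\cdot\|_{2,d}$ are the scalar product and norm of $L_2([0,1]^d)$. For a zero-mean random field $V_d$ with sample paths in $L_2([0,1]^d)$ put $e^{V_d}(0):=(\mathbb E\|V_d\|_{2,d}^2)^{1/2}$ and, for $n\in\mathbb N$, $$e^{V_d}(n):=\inf\Bigl\{\Bigl(\mathbb E\Bigl\|V_d-\sum_{m=1}^n\langle V_d,\psi_m\rangle_{2,d}\,\psi_m\Bigr\|_{2,d}^2\Bigr)^{1/2}:\ \psi_1,\dots,\psi_n\in L_2([0,1]^d)\Bigr\}.$$ The average case approximation complexity is $$n^{V_d}(\varepsilon):=\min\{n\in\mathbb N:\ e^{V_d}(n)\leqslant\varepsilon\, e^{V_d}(0)\},\quad \varepsilon\in(0,1).$$ The relation $a_d\sim b_d$ means $a_d/b_d\to1$ as $d\to\infty$. *)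

theory Defs
  imports "HOL-Probability.Probability"
begin

abbreviation unit_leb :: "real measure" where
  "unit_leb \<equiv> restrict_space lborel {0..1}"

text \<open>The cube \<open>[0,1]\<^sup>d\<close>; its points are functions on the coordinates \<open>0, \<dots>, d - 1\<close>.\<close>

abbreviation cube_leb :: "nat \<Rightarrow> (nat \<Rightarrow> real) measure" where
  "cube_leb d \<equiv> (\<Pi>\<^sub>M i\<in>{..<d}. unit_leb)"

text \<open>\<open>L\<^sub>2\<close> is represented by functions rather than by classes of functions; equality in \<open>L\<^sub>2\<close> is
  therefore written as almost everywhere equality below.\<close>

definition L2_space :: "'b measure \<Rightarrow> ('b \<Rightarrow> real) set" where
  "L2_space N = {f \<in> borel_measurable N. integrable N (\<lambda>x. (f x)\<^sup>2)}"

definition L2_scalar :: "'b measure \<Rightarrow> ('b \<Rightarrow> real) \<Rightarrow> ('b \<Rightarrow> real) \<Rightarrow> real" where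
  "L2_scalar N f g = (LINT x|N. f x * g x)"

definition L2_nrm :: "'b measure \<Rightarrow> ('b \<Rightarrow> real) \<Rightarrow> real" where
  "L2_nrm N f = sqrt (L2_scalar N f f)"

text \<open>\<open>f 0, \<dots>, f (n - 1)\<close> is a basis of the linear subspace \<open>E\<close> of \<open>L\<^sub>2\<close>.\<close>

definition L2_basis :: "'b measure \<Rightarrow> ('b \<Rightarrow> real) set \<Rightarrow> nat \<Rightarrow> (nat \<Rightarrow> 'b \<Rightarrow> real) \<Rightarrow> bool" where
  "L2_basis N E n f \<longleftrightarrow>
     (\<forall>i<n. f i \<in> E) \<and>
     (\<forall>c. (AE x in N. (\<Sum>i<n. c i * f i x) = 0) \<longrightarrow> (\<forall>i<n. c i = 0)) \<and>
     (\<forall>g\<in>E. \<exists>c. AE x in N. g x = (\<Sum>i<n. c i * f i x))"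

definition L2_has_dim :: "'b measure \<Rightarrow> ('b \<Rightarrow> real) set \<Rightarrow> nat \<Rightarrow> bool" where
  "L2_has_dim N E n \<longleftrightarrow> (\<exists>f. L2_basis N E n f)"

text \<open>The eigenspace, for \<open>\<mu>\<close>, of the integral operator with kernel \<open>C\<close> on \<open>L\<^sub>2([0,1])\<close>.\<close>

definition eigenspace :: "(real \<Rightarrow> real \<Rightarrow> real) \<Rightarrow> real \<Rightarrow> (real \<Rightarrow> real) set" where
  "eigenspace C \<mu> =
     {f \<in> L2_space unit_leb. AE t in unit_leb. (LINT s|unit_leb. C t s * f s) = \<mu> * f t}"

text \<open>For a covariance kernel \<open>C\<close>: \<open>lam\<close> is the non-increasing sequence of eigenvalues of its
  (compact, nonnegative) integral operator, every \<open>\<mu> > 0\<close> being listed as often as the dimension of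
  its eigenspace (so not at all if it is not an eigenvalue). If there are only finitely many
  positive eigenvalues, the remaining entries are forced to be zero.\<close>

definition eigenvalue_sequence :: "(real \<Rightarrow> real \<Rightarrow> real) \<Rightarrow> (nat \<Rightarrow> real) \<Rightarrow> bool" where
  "eigenvalue_sequence C lam \<longleftrightarrow>
     decseq lam \<and> (\<forall>k. 0 \<le> lam k) \<and>
     (\<forall>\<mu>>0. finite {k. lam k = \<mu>} \<and>
        L2_has_dim unit_leb (eigenspace C \<mu>) (card {k. lam k = \<mu>}))"

definition path_mean :: "(real \<Rightarrow> 'a \<Rightarrow> real) \<Rightarrow> 'a \<Rightarrow> real" where
  "path_mean Z \<omega> = (LINT s|unit_leb. Z s \<omega>)"

text \<open>The covariance function of \<open>Z(t) - \<integral> Z(s) ds\<close> for a zero-mean process \<open>Z\<close>.\<close>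

definition centred_cov :: "'a measure \<Rightarrow> (real \<Rightarrow> 'a \<Rightarrow> real) \<Rightarrow> real \<Rightarrow> real \<Rightarrow> real" where
  "centred_cov M Z t s =
     (LINT \<omega>|M. (Z t \<omega> - path_mean Z \<omega>) * (Z s \<omega> - path_mean Z \<omega>))"

definition additive_field ::
    "(nat \<Rightarrow> real \<Rightarrow> 'a \<Rightarrow> real) \<Rightarrow> nat \<Rightarrow> (nat \<Rightarrow> real) \<Rightarrow> 'a \<Rightarrow> real" where
  "additive_field X d t \<omega> = (\<Sum>j<d. X j (t j) \<omega>)"

definition trace_const :: "(real \<Rightarrow> real \<Rightarrow> real) \<Rightarrow> real" where
  "trace_const K = (LINT s|unit_leb. K s s)"

definition mean_const :: "(real \<Rightarrow> real \<Rightarrow> real) \<Rightarrow> real" where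
  "mean_const K = (LINT t|unit_leb. LINT s|unit_leb. K t s)"

definition centred_trace :: "(real \<Rightarrow> real \<Rightarrow> real) \<Rightarrow> real" where
  "centred_trace K = trace_const K - mean_const K"

definition spectral_cdf :: "real \<Rightarrow> (nat \<Rightarrow> real) \<Rightarrow> real \<Rightarrow> real" where
  "spectral_cdf L lam x = 1 / L * (\<Sum>k. lam k * (if lam k \<ge> exp (- x) then 1 else 0))"

definition generalized_inverse :: "(real \<Rightarrow> real) \<Rightarrow> real \<Rightarrow> real" where
  "generalized_inverse G y = Inf {x. G x \<ge> y}"

text \<open>The average case error for a random field \<open>V\<close> with paths in \<open>L\<^sub>2(N)\<close> and
  \<open>E \<parallel>V\<parallel>\<^sup>2 < \<infinity>\<close>; all integrals below are then finite. The functions \<open>\<psi> 0, \<dots>, \<psi> (n - 1)\<close> need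
  not be orthonormal.\<close>

definition avg_error :: "'a measure \<Rightarrow> 'b measure \<Rightarrow> ('b \<Rightarrow> 'a \<Rightarrow> real) \<Rightarrow> nat \<Rightarrow> real" where
  "avg_error M N V n =
     (if n = 0 then sqrt (LINT \<omega>|M. (L2_nrm N (\<lambda>t. V t \<omega>))\<^sup>2)
      else Inf {sqrt (LINT \<omega>|M.
                  (L2_nrm N (\<lambda>t. V t \<omega> - (\<Sum>m<n. L2_scalar N (\<lambda>u. V u \<omega>) (\<psi> m) * \<psi> m t)))\<^sup>2)
                | \<psi>. \<forall>m<n. \<psi> m \<in> L2_space N})"

definition avg_complexity :: "'a measure \<Rightarrow> 'b measure \<Rightarrow> ('b \<Rightarrow> 'a \<Rightarrow> real) \<Rightarrow> real \<Rightarrow> nat" where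
  "avg_complexity M N V \<epsilon> =
     (LEAST n. 1 \<le> n \<and> avg_error M N V n \<le> \<epsilon> * avg_error M N V 0)"

definition eps0 :: "(real \<Rightarrow> real \<Rightarrow> real) \<Rightarrow> real" where
  "eps0 K = sqrt (centred_trace K / trace_const K)"

definition q_const :: "(real \<Rightarrow> real \<Rightarrow> real) \<Rightarrow> (nat \<Rightarrow> real) \<Rightarrow> real \<Rightarrow> real" where
  "q_const K lam \<epsilon> = centred_trace K *
     (LINT y:{0<..<1 - (\<epsilon> / eps0 K)\<^sup>2}|lborel.
        exp (generalized_inverse (spectral_cdf (centred_trace K) lam) y))"

end

theory Submission
  imports Defs "HOL-Complex_Analysis.Great_Picard"
begin

text \<open>Up to a perturbation of bounded rank, \<open>Y\<^sub>d\<close> has \<open>d\<close> copies of the centred eigenvalues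
  \<open>lam 0 \<ge> lam 1 \<ge> \<dots>\<close> and one further eigenvalue belonging roughly to the constant functions. In
  general the constants are not an exact eigenspace; but adding the constant function to an
  approximating family costs only one more function, and on functions of mean zero the covariance
  form of \<open>Y\<^sub>d\<close> is the sum over the coordinates of the centred form \<open>Q\<close> at the one-dimensional
  marginals.

  By the variational characterisation of the eigenvalues,
  \<open>Q f \<le> (\<Sum>k<m. (lam k - lam m) * \<langle>f, \<phi> k\<rangle>\<^sup>2) + lam m * \<parallel>f\<parallel>\<^sup>2\<close>, so \<open>n\<close> functions leave an error of at least
  \<open>d * L - d * (\<Sum>k<m. lam k - lam m) - n * lam m\<close>, where \<open>L\<close> is the centred trace. With
  \<open>(\<Sum>k<m. lam k) < L * y \<le> (\<Sum>k\<le>m. lam k)\<close> and \<open>y = 1 - (\<epsilon> / \<epsilon>\<^sub>0)\<^sup>2\<close> this gives \<open>n \<ge> d * u\<close> for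
  \<open>u = m + (L * y - (\<Sum>k<m. lam k)) / lam m\<close>, and \<open>u\<close> is the quantile integral. Conversely,
  the constant together with \<open>\<lceil>d * u\<rceil>\<close> eigenfunctions of single coordinates suffices. That such an \<open>m\<close>
  exists is the trace formula for \<open>Q\<close>, obtained by testing the inequality above on normalised
  indicators of short intervals.\<close>

section \<open>Square integrable functions\<close>

text \<open>The lower bound is a Lagrangian relaxation: a sum of n numbers is at most the sum of
  their excesses over a threshold t plus n * t. With t = \<open>lam m\<close> the sorted spectrum of
  the field never has to be computed, and nothing is lost while n lies between d * m and d * (m +
  1), which is where the answer falls. The complexity is thus located within 2 of d * u.

  Only half of the trace formula enters: the partial sums of \<open>lam\<close> come arbitrarily
  close to the trace. This avoids Mercer's expansion. The main obstacle is that \<open>lam\<close>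
  is given only by dimensions of eigenspaces, so a positive maximum of the form must first be shown
  to be an eigenvalue; this is where compactness enters. A second one is that the competing
  functions need be neither orthonormal nor independent, so errors are bounded below by comparing
  orthogonal complements. The condition \<epsilon> < \<epsilon>0 makes y, hence u, positive;
  \<epsilon> > 0 makes y < 1, which leaves room for the approximate trace formula.\<close>

lemma L2_space_measurable: "f \<in> L2_space N \<Longrightarrow> f \<in> borel_measurable N"
  by (simp add: L2_space_def)

lemma L2_space_integrable_sq: "f \<in> L2_space N \<Longrightarrow> integrable N (\<lambda>x. (f x)\<^sup>2)"
  by (simp add: L2_space_def)

lemma L2_space_integrable_mult:
  assumes "f \<in> L2_space N" "g \<in> L2_space N"
  shows "integrable N (\<lambda>x. f x * g x)"
proof (rule Bochner_Integration.integrable_bound)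
  show "integrable N (\<lambda>x. (f x)\<^sup>2 + (g x)\<^sup>2)"
    using assms by (intro Bochner_Integration.integrable_add L2_space_integrable_sq)
  show "(\<lambda>x. f x * g x) \<in> borel_measurable N"
    using assms by (intro borel_measurable_times L2_space_measurable)
  have "\<bar>a * b\<bar> \<le> a\<^sup>2 + b\<^sup>2" for a b :: real
  proof -
    have "2 * \<bar>a * b\<bar> \<le> a\<^sup>2 + b\<^sup>2"
      using sum_squares_bound[of "\<bar>a\<bar>" "\<bar>b\<bar>"] by (simp add: abs_mult mult.assoc)
    then show ?thesis using abs_ge_zero[of "a * b"] by linarith
  qed
  then show "AE x in N. norm (f x * g x) \<le> norm ((f x)\<^sup>2 + (g x)\<^sup>2)"
    by simp
qed

lemma L2_space_cong:
  assumes "\<And>x. x \<in> space N \<Longrightarrow> f x = g x"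
  shows "f \<in> L2_space N \<longleftrightarrow> g \<in> L2_space N"
proof -
  have "f \<in> borel_measurable N \<longleftrightarrow> g \<in> borel_measurable N"
    using assms by (rule measurable_cong)
  moreover have "integrable N (\<lambda>x. (f x)\<^sup>2) \<longleftrightarrow> integrable N (\<lambda>x. (g x)\<^sup>2)"
    using assms by (intro Bochner_Integration.integrable_cong) auto
  ultimately show ?thesis by (simp add: L2_space_def)
qed

lemma L2_space_cmult: "f \<in> L2_space N \<Longrightarrow> (\<lambda>x. c * f x) \<in> L2_space N"
  by (auto simp: L2_space_def power_mult_distrib)

lemma L2_space_add:
  assumes "f \<in> L2_space N" "g \<in> L2_space N"
  shows "(\<lambda>x. f x + g x) \<in> L2_space N"
proof -
  have "integrable N (\<lambda>x. (f x)\<^sup>2 + (g x)\<^sup>2 + 2 * (f x * g x))"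
    using assms by (intro Bochner_Integration.integrable_add integrable_mult_right
        L2_space_integrable_sq L2_space_integrable_mult)
  also have "(\<lambda>x. (f x)\<^sup>2 + (g x)\<^sup>2 + 2 * (f x * g x)) = (\<lambda>x. (f x + g x)\<^sup>2)"
    by (auto simp: power2_sum algebra_simps)
  finally show ?thesis
    using assms by (auto simp: L2_space_def)
qed

lemma L2_space_diff:
  assumes "f \<in> L2_space N" "g \<in> L2_space N"
  shows "(\<lambda>x. f x - g x) \<in> L2_space N"
  using L2_space_add[OF assms(1) L2_space_cmult[OF assms(2), of "-1"]] by simp

lemma L2_space_zero: "(\<lambda>x. 0) \<in> L2_space N"
  by (simp add: L2_space_def)

lemma L2_space_sum:
  assumes "\<And>i. i \<in> A \<Longrightarrow> f i \<in> L2_space N"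
  shows "(\<lambda>x. \<Sum>i\<in>A. f i x) \<in> L2_space N"
  using assms
  by (induction A rule: infinite_finite_induct) (auto intro: L2_space_zero L2_space_add)

lemmas L2_space_intros = L2_space_cmult L2_space_add L2_space_diff L2_space_zero L2_space_sum

lemma (in finite_measure) L2_space_bounded:
  assumes "f \<in> borel_measurable M" "\<And>x. x \<in> space M \<Longrightarrow> \<bar>f x\<bar> \<le> B"
  shows "f \<in> L2_space M"
proof -
  have "\<bar>f x\<bar>\<^sup>2 \<le> B\<^sup>2" if "x \<in> space M" for x
    using assms(2)[OF that] by (intro power_mono) auto
  then have "integrable M (\<lambda>x. (f x)\<^sup>2)"
    using assms(1) by (intro integrable_const_bound[of _ "B\<^sup>2"]) auto
  then show ?thesis using assms(1) by (simp add: L2_space_def)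
qed

lemma (in finite_measure) L2_space_const: "(\<lambda>x. c) \<in> L2_space M"
  by (rule L2_space_bounded) auto

lemma (in finite_measure) L2_space_integrable: "f \<in> L2_space M \<Longrightarrow> integrable M f"
  using L2_space_integrable_mult[OF _ L2_space_const[of 1]] by simp

lemma L2_scalar_commute: "L2_scalar N f g = L2_scalar N g f"
  by (simp add: L2_scalar_def mult.commute)

lemma L2_scalar_cong_AE:
  assumes "AE x in N. f x = f' x" and "f \<in> borel_measurable N" "f' \<in> borel_measurable N"
    and "g \<in> borel_measurable N"
  shows "L2_scalar N f g = L2_scalar N f' g"
  unfolding L2_scalar_def using assms by (intro integral_cong_AE) auto

lemma L2_scalar_cong:
  assumes "\<And>x. x \<in> space N \<Longrightarrow> f x = f' x" "\<And>x. x \<in> space N \<Longrightarrow> g x = g' x"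
  shows "L2_scalar N f g = L2_scalar N f' g'"
  unfolding L2_scalar_def using assms by (intro Bochner_Integration.integral_cong) auto

lemma L2_scalar_cmult_left: "L2_scalar N (\<lambda>x. c * f x) g = c * L2_scalar N f g"
  by (simp add: L2_scalar_def mult.assoc)

lemma L2_scalar_cmult_right: "L2_scalar N g (\<lambda>x. c * f x) = c * L2_scalar N g f"
  by (simp add: L2_scalar_commute[of N g] L2_scalar_cmult_left)

lemma L2_scalar_zero [simp]: "L2_scalar N (\<lambda>x. 0) g = 0" "L2_scalar N g (\<lambda>x. 0) = 0"
  by (simp_all add: L2_scalar_def)

lemma L2_scalar_add_left:
  assumes "f \<in> L2_space N" "f' \<in> L2_space N" "g \<in> L2_space N"
  shows "L2_scalar N (\<lambda>x. f x + f' x) g = L2_scalar N f g + L2_scalar N f' g"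
  using assms by (simp add: L2_scalar_def distrib_right L2_space_integrable_mult)

lemma L2_scalar_diff_left:
  assumes "f \<in> L2_space N" "f' \<in> L2_space N" "g \<in> L2_space N"
  shows "L2_scalar N (\<lambda>x. f x - f' x) g = L2_scalar N f g - L2_scalar N f' g"
  using assms by (simp add: L2_scalar_def left_diff_distrib L2_space_integrable_mult)

lemma L2_scalar_sum_left:
  assumes "\<And>i. i \<in> A \<Longrightarrow> f i \<in> L2_space N" "g \<in> L2_space N"
  shows "L2_scalar N (\<lambda>x. \<Sum>i\<in>A. f i x) g = (\<Sum>i\<in>A. L2_scalar N (f i) g)"
  using assms
  by (induction A rule: infinite_finite_induct) (auto simp: L2_scalar_add_left L2_space_sum)

lemma L2_scalar_add_right:
  assumes "f \<in> L2_space N" "f' \<in> L2_space N" "g \<in> L2_space N"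
  shows "L2_scalar N g (\<lambda>x. f x + f' x) = L2_scalar N g f + L2_scalar N g f'"
  using L2_scalar_add_left[OF assms] by (simp add: L2_scalar_commute)

lemma L2_scalar_diff_right:
  assumes "f \<in> L2_space N" "f' \<in> L2_space N" "g \<in> L2_space N"
  shows "L2_scalar N g (\<lambda>x. f x - f' x) = L2_scalar N g f - L2_scalar N g f'"
  using L2_scalar_diff_left[OF assms] by (simp add: L2_scalar_commute)

lemma L2_scalar_sum_right:
  assumes "\<And>i. i \<in> A \<Longrightarrow> f i \<in> L2_space N" "g \<in> L2_space N"
  shows "L2_scalar N g (\<lambda>x. \<Sum>i\<in>A. f i x) = (\<Sum>i\<in>A. L2_scalar N g (f i))"
  using L2_scalar_sum_left[OF assms] by (simp add: L2_scalar_commute)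

lemma L2_scalar_comb_right:
  assumes "\<And>i. i \<in> A \<Longrightarrow> f i \<in> L2_space N" "g \<in> L2_space N"
  shows "L2_scalar N g (\<lambda>x. \<Sum>i\<in>A. c i * f i x) = (\<Sum>i\<in>A. c i * L2_scalar N g (f i))"
  using assms by (subst L2_scalar_sum_right) (auto simp: L2_space_cmult L2_scalar_cmult_right)

lemma L2_scalar_comb_left:
  assumes "\<And>i. i \<in> A \<Longrightarrow> f i \<in> L2_space N" "g \<in> L2_space N"
  shows "L2_scalar N (\<lambda>x. \<Sum>i\<in>A. c i * f i x) g = (\<Sum>i\<in>A. c i * L2_scalar N (f i) g)"
  using L2_scalar_comb_right[OF assms] by (simp add: L2_scalar_commute)

lemmas L2_scalar_linear = L2_scalar_cmult_left L2_scalar_cmult_right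
  L2_scalar_add_left L2_scalar_add_right L2_scalar_diff_left L2_scalar_diff_right
  L2_scalar_sum_left L2_scalar_sum_right

lemma L2_scalar_self_nonneg: "0 \<le> L2_scalar N f f"
  unfolding L2_scalar_def by (intro Bochner_Integration.integral_nonneg) simp

lemma L2_nrm_sq: "(L2_nrm N f)\<^sup>2 = L2_scalar N f f"
  by (simp add: L2_nrm_def L2_scalar_self_nonneg)

text \<open>Stated for bare numbers because it serves two forms: the scalar product, and in
  \<open>extremal_eigenfunction\<close> the form \<open>P\<close>, whose nonnegativity is known only
  on a subspace.\<close>

lemma quadratic_nonneg_discriminant:
  fixes a b c :: real
  assumes "\<And>t. 0 \<le> a + 2 * t * b + t\<^sup>2 * c"
  shows "b\<^sup>2 \<le> a * c"
proof (cases "c = 0")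
  case True
  have "b = 0"
  proof (rule ccontr)
    assume "b \<noteq> 0"
    \<comment> \<open>At this t the affine function a + 2 * t * b takes the value -1.\<close>
    then show False
      using assms[of "- (a + 1) / (2 * b)"] True by (simp add: field_simps)
  qed
  then show ?thesis using True by simp
next
  case False
  have "0 \<le> c"
  proof (rule ccontr)
    assume "\<not> 0 \<le> c"
    then have c: "c < 0" by simp
    \<comment> \<open>Chosen so that t \<ge> 1 and t * (- c) \<ge> |a| + 2 |b| + 1; the quadratic
      term then outweighs the rest, and the value is at most -t.\<close>
    define t where "t = (\<bar>a\<bar> + 2 * \<bar>b\<bar> + 1) / (- c) + 1"
    have t1: "1 \<le> t" using c divide_nonneg_pos[of "\<bar>a\<bar> + 2 * \<bar>b\<bar> + 1" "- c"] by (simp add: t_def)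
    have "t * (- c) \<ge> \<bar>a\<bar> + 2 * \<bar>b\<bar> + 1"
      using c by (simp add: t_def field_simps)
    then have "t * (t * (- c)) \<ge> t * (\<bar>a\<bar> + 2 * \<bar>b\<bar> + 1)"
      using t1 by (intro mult_left_mono) auto
    moreover have "t * \<bar>a\<bar> \<ge> \<bar>a\<bar>" using mult_right_mono[OF t1, of "\<bar>a\<bar>"] by simp
    moreover have "t * b \<le> t * \<bar>b\<bar>" using t1 by (intro mult_left_mono) auto
    moreover have "t * (t * (- c)) = - (t\<^sup>2 * c)" "2 * t * b = 2 * (t * b)"
        "t * (\<bar>a\<bar> + 2 * \<bar>b\<bar> + 1) = t * \<bar>a\<bar> + 2 * (t * \<bar>b\<bar>) + t"
      by (simp_all add: power2_eq_square algebra_simps)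
    ultimately show False
      using assms[of t] t1 abs_ge_minus_self[of a] by linarith
  qed
  then have "0 < c" using False by simp
  \<comment> \<open>The quadratic is evaluated at its minimiser, where its value is a - b^2 /
    c.\<close>
  then show ?thesis
    using assms[of "- b / c"] by (simp add: field_simps power2_eq_square)
qed

lemma L2_Cauchy_Schwarz:
  assumes "f \<in> L2_space N" "g \<in> L2_space N"
  shows "(L2_scalar N f g)\<^sup>2 \<le> L2_scalar N f f * L2_scalar N g g"
proof (rule quadratic_nonneg_discriminant)
  fix t
  have "0 \<le> L2_scalar N (\<lambda>x. f x + t * g x) (\<lambda>x. f x + t * g x)"
    by (rule L2_scalar_self_nonneg)
  also have "\<dots> = L2_scalar N f f + 2 * t * L2_scalar N f g + t\<^sup>2 * L2_scalar N g g"
    using assms by (simp add: L2_scalar_linear L2_space_intros L2_scalar_commute[of N g f]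
        power2_eq_square algebra_simps)
  finally show "0 \<le> L2_scalar N f f + 2 * t * L2_scalar N f g + t\<^sup>2 * L2_scalar N g g" .
qed

lemma L2_scalar_null_left:
  assumes "f \<in> L2_space N" "g \<in> L2_space N" "L2_scalar N f f = 0"
  shows "L2_scalar N f g = 0"
  using L2_Cauchy_Schwarz[OF assms(1,2)] assms(3) by simp

lemma L2_scalar_self_eq_0_AE:
  assumes "f \<in> L2_space N" "L2_scalar N f f = 0"
  shows "AE x in N. f x = 0"
proof -
  have "AE x in N. (f x)\<^sup>2 = 0"
    using assms L2_space_integrable_sq[OF assms(1)]
    by (subst integral_nonneg_eq_0_iff_AE[symmetric]) (auto simp: L2_scalar_def power2_eq_square)
  then show ?thesis by simp
qed

section \<open>Orthonormal families, best approximation and Gram-Schmidt\<close>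

text \<open>The value \<open>0\<close> for \<open>\<langle>u i, u i\<rangle>\<close> is allowed, so that Gram-Schmidt needs no independence.\<close>

definition orthonormal_or_null :: "'b measure \<Rightarrow> ('i \<Rightarrow> 'b \<Rightarrow> real) \<Rightarrow> 'i set \<Rightarrow> bool" where
  "orthonormal_or_null N u A \<longleftrightarrow>
     (\<forall>i\<in>A. u i \<in> L2_space N \<and> L2_scalar N (u i) (u i) \<in> {0, 1}) \<and>
     (\<forall>i\<in>A. \<forall>j\<in>A. i \<noteq> j \<longrightarrow> L2_scalar N (u i) (u j) = 0)"

lemma orthonormal_or_null_L2: "orthonormal_or_null N u A \<Longrightarrow> i \<in> A \<Longrightarrow> u i \<in> L2_space N"
  by (simp add: orthonormal_or_null_def)

text \<open>Trivial for a unit vector; for a null one both sides vanish by Cauchy-Schwarz. The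
  projection formulas below thereby hold without a case distinction.\<close>

lemma orthonormal_or_null_scalar_absorb:
  assumes "orthonormal_or_null N u A" "i \<in> A" "f \<in> L2_space N"
  shows "L2_scalar N f (u i) * L2_scalar N (u i) (u i) = L2_scalar N f (u i)"
proof -
  have "L2_scalar N (u i) (u i) = 0 \<or> L2_scalar N (u i) (u i) = 1"
    using assms by (auto simp: orthonormal_or_null_def)
  then show ?thesis
    using L2_scalar_null_left[of "u i" N f] assms
    by (auto simp: orthonormal_or_null_def L2_scalar_commute)
qed

lemma orthonormal_or_null_scalar_comb:
  assumes u: "orthonormal_or_null N u A" and "finite A" "j \<in> A" "f \<in> L2_space N"
  shows "L2_scalar N (\<lambda>x. \<Sum>i\<in>A. L2_scalar N f (u i) * u i x) (u j) = L2_scalar N f (u j)"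
proof -
  have "L2_scalar N (\<lambda>x. \<Sum>i\<in>A. L2_scalar N f (u i) * u i x) (u j)
      = (\<Sum>i\<in>A. L2_scalar N f (u i) * L2_scalar N (u i) (u j))"
    using assms orthonormal_or_null_L2[OF u]
    by (simp add: L2_scalar_sum_left L2_scalar_cmult_left L2_space_cmult)
  also have "\<dots> = (\<Sum>i\<in>A. if i = j then L2_scalar N f (u j) else 0)"
    using u \<open>j \<in> A\<close> orthonormal_or_null_scalar_absorb[OF u \<open>j \<in> A\<close> \<open>f \<in> L2_space N\<close>]
    by (intro sum.cong) (auto simp: orthonormal_or_null_def)
  finally show ?thesis using assms by simp
qed

text \<open>The residual is orthogonal to the projection, so its scalar products with f and with
  itself agree (Pythagoras). Both values are recorded because \<open>approximation_error_ge\<close>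
  compares them.\<close>

lemma orthonormal_or_null_residual:
  assumes u: "orthonormal_or_null N u A" and "finite A" and f: "f \<in> L2_space N"
  defines "r \<equiv> (\<lambda>x. f x - (\<Sum>i\<in>A. L2_scalar N f (u i) * u i x))"
  shows "r \<in> L2_space N" "\<And>j. j \<in> A \<Longrightarrow> L2_scalar N r (u j) = 0"
    and "L2_scalar N r f = L2_scalar N f f - (\<Sum>i\<in>A. (L2_scalar N f (u i))\<^sup>2)"
    and "L2_scalar N r r = L2_scalar N f f - (\<Sum>i\<in>A. (L2_scalar N f (u i))\<^sup>2)"
proof -
  note uL = orthonormal_or_null_L2[OF u]
  have sL: "(\<lambda>x. \<Sum>i\<in>A. L2_scalar N f (u i) * u i x) \<in> L2_space N"
    using uL by (intro L2_space_sum L2_space_cmult)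
  show rL: "r \<in> L2_space N" unfolding r_def using f sL by (rule L2_space_diff)
  show orth: "L2_scalar N r (u j) = 0" if "j \<in> A" for j
    unfolding r_def using that uL f sL
    by (simp add: L2_scalar_diff_left orthonormal_or_null_scalar_comb[OF u \<open>finite A\<close>])
  show rf: "L2_scalar N r f = L2_scalar N f f - (\<Sum>i\<in>A. (L2_scalar N f (u i))\<^sup>2)"
  proof -
    have "L2_scalar N r f = L2_scalar N f f - (\<Sum>i\<in>A. L2_scalar N f (u i) * L2_scalar N (u i) f)"
      unfolding r_def using uL f sL
      by (simp add: L2_scalar_diff_left L2_scalar_comb_left)
    also have "(\<Sum>i\<in>A. L2_scalar N f (u i) * L2_scalar N (u i) f) = (\<Sum>i\<in>A. (L2_scalar N f (u i))\<^sup>2)"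
      by (intro sum.cong refl) (simp add: power2_eq_square L2_scalar_commute)
    finally show ?thesis .
  qed
  have "L2_scalar N r r = L2_scalar N r f - (\<Sum>i\<in>A. L2_scalar N f (u i) * L2_scalar N r (u i))"
    unfolding r_def using uL f sL rL[unfolded r_def]
    by (simp add: L2_scalar_diff_right[of f N "\<lambda>x. \<Sum>i\<in>A. L2_scalar N f (u i) * u i x"]
        L2_scalar_sum_right L2_scalar_cmult_right L2_space_cmult)
  then show "L2_scalar N r r = L2_scalar N f f - (\<Sum>i\<in>A. (L2_scalar N f (u i))\<^sup>2)"
    using orth rf by simp
qed

lemma Bessel_inequality:
  assumes "orthonormal_or_null N u A" "finite A" "f \<in> L2_space N"
  shows "(\<Sum>i\<in>A. (L2_scalar N f (u i))\<^sup>2) \<le> L2_scalar N f f"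
  using orthonormal_or_null_residual(4)[OF assms]
    L2_scalar_self_nonneg[of N "\<lambda>x. f x - (\<Sum>i\<in>A. L2_scalar N f (u i) * u i x)"] by simp

text \<open>The combinations are pointwise, not just almost everywhere, and their last coefficient is
  nonzero; linear independence modulo null functions is therefore inherited.\<close>

lemma Gram_Schmidt:
  fixes f :: "nat \<Rightarrow> 'b \<Rightarrow> real"
  assumes "\<And>i. i < n \<Longrightarrow> f i \<in> L2_space N"
  shows "\<exists>u. orthonormal_or_null N u {..<n} \<and>
    (\<forall>i<n. \<exists>b. b i \<noteq> 0 \<and> u i = (\<lambda>x. \<Sum>j\<le>i. b j * f j x))"
  using assms
proof (induction n)
  case 0
  then show ?case by (auto simp: orthonormal_or_null_def)
next
  case (Suc n)
  then obtain u where u: "orthonormal_or_null N u {..<n}"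
    and comb: "\<And>i. i < n \<Longrightarrow> \<exists>b. b i \<noteq> 0 \<and> u i = (\<lambda>x. \<Sum>j\<le>i. b j * f j x)"
    by auto
  define c where "c j = L2_scalar N (f n) (u j)" for j
  define w where "w = (\<lambda>x. f n x - (\<Sum>j<n. c j * u j x))"
  \<comment> \<open>A null remainder is left unscaled: the factor must be nonzero to keep the
    leading coefficient of the combination nonzero.\<close>
  define a where "a = (if L2_scalar N w w = 0 then 1 else 1 / sqrt (L2_scalar N w w))"
  have fn: "f n \<in> L2_space N" using Suc.prems by simp
  have w: "w \<in> L2_space N" and wu: "\<And>j. j < n \<Longrightarrow> L2_scalar N w (u j) = 0"
    using orthonormal_or_null_residual(1,2)[OF u finite_lessThan fn] by (auto simp: w_def c_def)
  have uw: "L2_scalar N (u j) w = 0" if "j < n" for j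
    using wu[OF that] by (simp add: L2_scalar_commute)
  have a: "a \<noteq> 0" using L2_scalar_self_nonneg[of N w] by (simp add: a_def)
  have aw: "a * (a * L2_scalar N w w) \<in> {0, 1}"
    using L2_scalar_self_nonneg[of N w] by (simp add: a_def)
  define u' where "u' = u(n := (\<lambda>x. a * w x))"
  have "orthonormal_or_null N u' {..<Suc n}"
    using u w wu uw aw unfolding orthonormal_or_null_def u'_def
    by (auto simp: less_Suc_eq L2_space_cmult L2_scalar_cmult_left L2_scalar_cmult_right)
  moreover have "\<exists>b. b i \<noteq> 0 \<and> u' i = (\<lambda>x. \<Sum>j\<le>i. b j * f j x)" if "i < Suc n" for i
  proof (cases "i = n")
    case False
    then show ?thesis using comb[of i] that by (simp add: u'_def)
  next
    case True
    obtain b where b: "\<And>i. i < n \<Longrightarrow> u i = (\<lambda>x. \<Sum>j\<le>i. b i j * f j x)"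
      using comb by metis
    \<comment> \<open>Inserting the expansions of the earlier \<open>u i\<close>, padded by zeros to
      full length, collects in \<open>d j\<close> the coefficient of \<open>f j\<close> in the
      projection.\<close>
    define d where "d j = (\<Sum>i<n. c i * (if j \<le> i then b i j else 0))" for j
    define b' where "b' j = (if j = n then a else - a * d j)" for j
    have "a * w x = (\<Sum>j\<le>n. b' j * f j x)" for x
    proof -
      have "u i x = (\<Sum>j<n. (if j \<le> i then b i j else 0) * f j x)" if "i < n" for i
      proof -
        have "(\<Sum>j<n. (if j \<le> i then b i j else 0) * f j x) = (\<Sum>j\<in>{..<n} \<inter> {..i}. b i j * f j x)"
          by (auto simp: sum.inter_restrict intro!: sum.cong)
        also have "{..<n} \<inter> {..i} = {..i}" using that by auto
        finally show ?thesis using b[OF that] by simp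
      qed
      then have "(\<Sum>i<n. c i * u i x)
          = (\<Sum>i<n. \<Sum>j<n. c i * ((if j \<le> i then b i j else 0) * f j x))"
        by (simp add: sum_distrib_left)
      also have "\<dots> = (\<Sum>j<n. d j * f j x)"
        by (subst sum.swap) (simp add: d_def sum_distrib_right mult.assoc)
      finally have "a * w x = a * f n x - a * (\<Sum>j<n. d j * f j x)"
        by (simp add: w_def algebra_simps)
      also have "a * (\<Sum>j<n. d j * f j x) = - (\<Sum>j<n. b' j * f j x)"
        by (simp add: b'_def sum_distrib_left sum_negf mult.assoc)
      also have "a * f n x - - (\<Sum>j<n. b' j * f j x) = (\<Sum>j\<le>n. b' j * f j x)"
        by (simp add: b'_def lessThan_Suc_atMost[symmetric])
      finally show ?thesis .
    qed
    moreover have "b' n \<noteq> 0" using a by (simp add: b'_def)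
    ultimately show ?thesis using True by (auto simp: u'_def)
  qed
  ultimately show ?case by auto
qed

text \<open>The nonzero leading coefficients allow forward substitution. Equality of orthogonal
  complements stands in for equality of spans, so that no span modulo null functions has to be
  defined.\<close>

lemma triangular_comb_orthogonal:
  fixes f :: "nat \<Rightarrow> 'b \<Rightarrow> real"
  assumes f: "\<And>i. i < n \<Longrightarrow> f i \<in> L2_space N" and h: "h \<in> L2_space N"
    and comb: "\<And>i. i < n \<Longrightarrow> \<exists>b. b i \<noteq> 0 \<and> u i = (\<lambda>x. \<Sum>j\<le>i. b j * f j x)"
  shows "(\<forall>i<n. L2_scalar N h (u i) = 0) \<longleftrightarrow> (\<forall>i<n. L2_scalar N h (f i) = 0)"
proof -
  have eq: "\<exists>b. b i \<noteq> 0 \<and> L2_scalar N h (u i)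
      = b i * L2_scalar N h (f i) + (\<Sum>j<i. b j * L2_scalar N h (f j))" if "i < n" for i
  proof -
    obtain b where b: "b i \<noteq> 0" "u i = (\<lambda>x. \<Sum>j\<le>i. b j * f j x)"
      using comb[OF \<open>i < n\<close>] by auto
    have "L2_scalar N h (u i) = (\<Sum>j\<le>i. b j * L2_scalar N h (f j))"
      unfolding b(2) using f \<open>i < n\<close> h
      by (intro L2_scalar_comb_right) auto
    also have "\<dots> = b i * L2_scalar N h (f i) + (\<Sum>j<i. b j * L2_scalar N h (f j))"
      by (simp add: lessThan_Suc_atMost[symmetric])
    finally show ?thesis using b(1) by blast
  qed
  show ?thesis
  proof (intro iffI allI impI)
    fix i assume u: "\<forall>i<n. L2_scalar N h (u i) = 0" and "i < n"
    then show "L2_scalar N h (f i) = 0"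
    proof (induction i rule: less_induct)
      case (less i)
      then show ?case using eq[of i] by auto
    qed
  next
    fix i assume "\<forall>i<n. L2_scalar N h (f i) = 0" and "i < n"
    then show "L2_scalar N h (u i) = 0" using eq[of i] by auto
  qed
qed

text \<open>The hypothesis \<open>span\<close> says dually that every \<open>\<psi> i\<close> lies
  in the span of the \<open>u i\<close>. The residual r of v is then orthogonal to all
  \<open>\<psi> i\<close>, so <r, e> = <r, v> = <r, r> for the error e, and |e - r|^2 \<ge> 0 gives
  the bound. The coefficients \<open>c\<close> are arbitrary, which covers families that are not
  orthonormal.\<close>

lemma approximation_error_ge:
  fixes \<psi> :: "nat \<Rightarrow> 'b \<Rightarrow> real"
  assumes u: "orthonormal_or_null N u A" "finite A" and v: "v \<in> L2_space N"
    and psi: "\<And>i. i < n \<Longrightarrow> \<psi> i \<in> L2_space N"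
    and span: "\<And>h i. h \<in> L2_space N \<Longrightarrow> (\<And>i. i \<in> A \<Longrightarrow> L2_scalar N h (u i) = 0) \<Longrightarrow> i < n
      \<Longrightarrow> L2_scalar N h (\<psi> i) = 0"
  shows "L2_scalar N v v - (\<Sum>i\<in>A. (L2_scalar N v (u i))\<^sup>2)
    \<le> L2_scalar N (\<lambda>x. v x - (\<Sum>i<n. c i * \<psi> i x)) (\<lambda>x. v x - (\<Sum>i<n. c i * \<psi> i x))"
proof -
  define r where "r = (\<lambda>x. v x - (\<Sum>i\<in>A. L2_scalar N v (u i) * u i x))"
  define e where "e = (\<lambda>x. v x - (\<Sum>i<n. c i * \<psi> i x))"
  note res = orthonormal_or_null_residual[OF u v, folded r_def]
  have sL: "(\<lambda>x. \<Sum>i<n. c i * \<psi> i x) \<in> L2_space N"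
    using psi by (intro L2_space_sum L2_space_cmult) auto
  have eL: "e \<in> L2_space N" unfolding e_def using v sL by (rule L2_space_diff)
  have "L2_scalar N r (\<lambda>x. \<Sum>i<n. c i * \<psi> i x) = (\<Sum>i<n. c i * L2_scalar N r (\<psi> i))"
    using psi res(1) by (intro L2_scalar_comb_right) auto
  also have "\<dots> = 0"
    using span[OF res(1) res(2)] by simp
  finally have "L2_scalar N r (\<lambda>x. \<Sum>i<n. c i * \<psi> i x) = 0" .
  then have re: "L2_scalar N r e = L2_scalar N r v"
    unfolding e_def using res(1) v sL by (simp add: L2_scalar_diff_right)
  have "0 \<le> L2_scalar N (\<lambda>x. e x - r x) (\<lambda>x. e x - r x)"
    by (rule L2_scalar_self_nonneg)
  also have "\<dots> = L2_scalar N e e - 2 * L2_scalar N r e + L2_scalar N r r"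
    using eL res(1) by (simp add: L2_scalar_linear L2_space_intros L2_scalar_commute[of N e r])
  finally show ?thesis using re res(3,4) by (simp add: e_def)
qed

section \<open>Square integrable kernels\<close>

lemma (in pair_sigma_finite) L2_space_tensor:
  assumes "f \<in> L2_space M1" "g \<in> L2_space M2"
  shows "(\<lambda>(x, y). f x * g y) \<in> L2_space (M1 \<Otimes>\<^sub>M M2)"
proof -
  note [measurable] = assms[THEN L2_space_measurable]
  have "integrable (M1 \<Otimes>\<^sub>M M2) (\<lambda>(x, y). (f x)\<^sup>2 * (g y)\<^sup>2)"
  proof (rule Fubini_integrable)
    show "integrable M1 (\<lambda>x. LINT y|M2. norm (case (x, y) of (x, y) \<Rightarrow> (f x)\<^sup>2 * (g y)\<^sup>2))"
      using L2_space_integrable_sq[OF assms(1)] by (simp add: abs_mult)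
    show "AE x in M1. integrable M2 (\<lambda>y. case (x, y) of (x, y) \<Rightarrow> (f x)\<^sup>2 * (g y)\<^sup>2)"
      using L2_space_integrable_sq[OF assms(2)] by simp
  qed measurable
  then show ?thesis
    by (simp add: L2_space_def power_mult_distrib split_beta')
qed

lemma (in pair_sigma_finite) L2_kernel_section:
  assumes "(\<lambda>(x, y). F x y) \<in> L2_space (M1 \<Otimes>\<^sub>M M2)"
  shows "AE y in M2. (\<lambda>x. F x y) \<in> L2_space M1"
    and "integrable M2 (\<lambda>y. LINT x|M1. (F x y)\<^sup>2)"
proof -
  note [measurable] = L2_space_measurable[OF assms]
  have "integrable (M1 \<Otimes>\<^sub>M M2) (\<lambda>(x, y). (F x y)\<^sup>2)"
    using L2_space_integrable_sq[OF assms] by (simp add: split_beta')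
  note int = AE_integrable_snd[OF this] integrable_snd[OF this]
  show "AE y in M2. (\<lambda>x. F x y) \<in> L2_space M1"
    using int(1) AE_space
  proof eventually_elim
    case (elim y)
    have "(\<lambda>x. F x y) \<in> borel_measurable M1"
      using elim(2) by measurable
    then show ?case using elim(1) by (simp add: L2_space_def)
  qed
  show "integrable M2 (\<lambda>y. LINT x|M1. (F x y)\<^sup>2)" by (rule int(2))
qed

text \<open>Cauchy-Schwarz in x for almost every y, the Hilbert-Schmidt bound. Three kernels will be
  inserted: the covariance, the process itself as a kernel on time and probability space, and a
  function on the cube with one coordinate overwritten.\<close>

lemma (in pair_sigma_finite) L2_kernel_integral:
  assumes F: "(\<lambda>(x, y). F x y) \<in> L2_space (M1 \<Otimes>\<^sub>M M2)" and f: "f \<in> L2_space M1"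
  shows "(\<lambda>y. LINT x|M1. F x y * f x) \<in> L2_space M2"
    and "(LINT y|M2. (LINT x|M1. F x y * f x)\<^sup>2)
      \<le> (LINT y|M2. LINT x|M1. (F x y)\<^sup>2) * L2_scalar M1 f f"
proof -
  note [measurable] = L2_space_measurable[OF F] L2_space_measurable[OF f]
  have meas: "(\<lambda>y. LINT x|M1. F x y * f x) \<in> borel_measurable M2"
    by (intro M1.borel_measurable_lebesgue_integral) measurable
  have bd: "AE y in M2. (LINT x|M1. F x y * f x)\<^sup>2 \<le> (LINT x|M1. (F x y)\<^sup>2) * L2_scalar M1 f f"
    using L2_kernel_section(1)[OF F]
    by eventually_elim (use L2_Cauchy_Schwarz f in \<open>force simp: L2_scalar_def power2_eq_square\<close>)
  have int: "integrable M2 (\<lambda>y. (LINT x|M1. (F x y)\<^sup>2) * L2_scalar M1 f f)"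
    using L2_kernel_section(2)[OF F] by simp
  have "integrable M2 (\<lambda>y. (LINT x|M1. F x y * f x)\<^sup>2)"
    by (rule Bochner_Integration.integrable_bound[OF int])
      (use meas bd in \<open>auto elim!: eventually_mono\<close>)
  then show "(\<lambda>y. LINT x|M1. F x y * f x) \<in> L2_space M2"
    using meas by (simp add: L2_space_def)
  have "(LINT y|M2. (LINT x|M1. F x y * f x)\<^sup>2)
      \<le> (LINT y|M2. (LINT x|M1. (F x y)\<^sup>2) * L2_scalar M1 f f)"
    by (rule integral_mono_AE) fact+
  then show "(LINT y|M2. (LINT x|M1. F x y * f x)\<^sup>2)
      \<le> (LINT y|M2. LINT x|M1. (F x y)\<^sup>2) * L2_scalar M1 f f"
    by simp
qed

text \<open>The integrand is a product of two square integrable functions on the product space,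
  hence integrable there.\<close>

lemma (in pair_sigma_finite) L2_kernel_Fubini:
  assumes F: "(\<lambda>(x, y). F x y) \<in> L2_space (M1 \<Otimes>\<^sub>M M2)"
    and f: "f \<in> L2_space M1" and g: "g \<in> L2_space M2"
  shows "(LINT y|M2. (LINT x|M1. F x y * f x) * g y) = (LINT x|M1. f x * (LINT y|M2. F x y * g y))"
proof -
  have "integrable (M1 \<Otimes>\<^sub>M M2) (\<lambda>p. (case p of (x, y) \<Rightarrow> F x y) * (case p of (x, y) \<Rightarrow> f x * g y))"
    by (rule L2_space_integrable_mult[OF F L2_space_tensor[OF f g]])
  then have "integrable (M1 \<Otimes>\<^sub>M M2) (\<lambda>(x, y). F x y * f x * g y)"
    by (simp add: split_beta' mult.assoc)
  then have "(LINT y|M2. (LINT x|M1. F x y * f x * g y)) = (LINT x|M1. (LINT y|M2. F x y * f x * g y))"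
    by (rule Fubini_integral)
  moreover have "(LINT y|M2. F x y * f x * g y) = f x * (LINT y|M2. F x y * g y)" for x
    by (subst integral_mult_right_zero[symmetric]) (simp add: ac_simps)
  ultimately show ?thesis by simp
qed

section \<open>Integral operators with continuous symmetric kernels\<close>

lemma space_unit_leb: "space unit_leb = {0..1}"
  by (simp add: space_restrict_space)

lemma prob_space_unit_leb: "prob_space unit_leb"
  by (rule prob_spaceI) (simp add: space_restrict_space emeasure_restrict_space)

interpretation unit: prob_space unit_leb
  by (rule prob_space_unit_leb)

interpretation unit_pair: pair_sigma_finite unit_leb unit_leb
  by standard

lemma continuous_on_measurable_unit_leb:
  fixes f :: "real \<Rightarrow> real"
  assumes "continuous_on {0..1} f"
  shows "f \<in> borel_measurable unit_leb"
  using borel_measurable_continuous_on_restrict[OF assms]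
  by (simp cong: measurable_cong_sets sets_restrict_space_cong)

lemma continuous_on_L2_unit_leb:
  fixes f :: "real \<Rightarrow> real"
  assumes "continuous_on {0..1} f"
  shows "f \<in> L2_space unit_leb"
proof -
  have "bounded (f ` {0..1})"
    using assms by (intro compact_imp_bounded compact_continuous_image) auto
  then obtain B where "\<forall>x\<in>{0..1}. \<bar>f x\<bar> \<le> B"
    by (auto simp: bounded_iff)
  then show ?thesis
    by (intro unit.L2_space_bounded[of f B] continuous_on_measurable_unit_leb[OF assms])
      (auto simp: space_unit_leb)
qed

text \<open>Only the unit square is constrained, since covariances are not controlled outside it.
  Both \<open>K\<close> and the centred covariance are instances.\<close>

locale continuous_kernel =
  fixes C :: "real \<Rightarrow> real \<Rightarrow> real"
  assumes cont: "continuous_on ({0..1} \<times> {0..1}) (\<lambda>(t, s). C t s)"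
    and sym: "t \<in> {0..1} \<Longrightarrow> s \<in> {0..1} \<Longrightarrow> C t s = C s t"
begin

definition kop :: "(real \<Rightarrow> real) \<Rightarrow> real \<Rightarrow> real" where
  "kop f t = (LINT s|unit_leb. C t s * f s)"

definition kform :: "(real \<Rightarrow> real) \<Rightarrow> real" where
  "kform f = L2_scalar unit_leb (kop f) f"

lemma kernel_bounded: "\<exists>B>0. \<forall>t\<in>{0..1}. \<forall>s\<in>{0..1}. \<bar>C t s\<bar> \<le> B"
proof -
  have "bounded ((\<lambda>(t, s). C t s) ` ({0..1} \<times> {0..1}))"
    using cont by (intro compact_imp_bounded compact_continuous_image compact_Times) auto
  then obtain B where "\<forall>y\<in>(\<lambda>(t, s). C t s) ` ({0..1} \<times> {0..1}). norm y \<le> B"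
    by (auto simp: bounded_iff)
  then show ?thesis
    by (intro exI[of _ "max B 1"]) (force simp: max.coboundedI1)
qed

lemma kernel_uniformly_continuous:
  assumes "0 < e"
  shows "\<exists>d>0. \<forall>t\<in>{0..1}. \<forall>s\<in>{0..1}. \<forall>t'\<in>{0..1}. \<forall>s'\<in>{0..1}.
    \<bar>t - t'\<bar> < d \<longrightarrow> \<bar>s - s'\<bar> < d \<longrightarrow> \<bar>C t s - C t' s'\<bar> < e"
proof -
  have "uniformly_continuous_on ({0..1} \<times> {0..1}) (\<lambda>(t, s). C t s)"
    using cont by (intro compact_uniformly_continuous compact_Times) auto
  then obtain d where d: "d > 0" "\<And>p q. p \<in> {0..1} \<times> {0..1} \<Longrightarrow> q \<in> {0..1} \<times> {0..1} \<Longrightarrow> dist q p < d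
      \<Longrightarrow> dist ((\<lambda>(t, s). C t s) q) ((\<lambda>(t, s). C t s) p) < e"
    using assms unfolding uniformly_continuous_on_def by metis
  have "\<bar>C t s - C t' s'\<bar> < e"
    if "t \<in> {0..1}" "s \<in> {0..1}" "t' \<in> {0..1}" "s' \<in> {0..1}"
      "\<bar>t - t'\<bar> < d / 2" "\<bar>s - s'\<bar> < d / 2" for t s t' s'
  proof -
    have "dist (t, s) (t', s') \<le> \<bar>t - t'\<bar> + \<bar>s - s'\<bar>"
      unfolding dist_prod_def fst_conv snd_conv dist_real_def by (rule order_trans[OF sqrt_sum_squares_le_sum_abs]) simp
    then have "dist (t, s) (t', s') < d" using that by linarith
    then show ?thesis using d(2)[of "(t', s')" "(t, s)"] that by (simp add: dist_real_def)
  qed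
  then show ?thesis using \<open>d > 0\<close> by (intro exI[of _ "d / 2"]) simp
qed

lemma kernel_section_L2: "t \<in> {0..1} \<Longrightarrow> C t \<in> L2_space unit_leb"
proof (rule continuous_on_L2_unit_leb)
  assume "t \<in> {0..1}"
  then have "continuous_on {0..1} ((\<lambda>(t, s). C t s) \<circ> (\<lambda>s. (t, s)))"
    by (intro continuous_on_compose continuous_intros continuous_on_subset[OF cont]) auto
  then show "continuous_on {0..1} (C t)" by (simp add: comp_def)
qed

text \<open>Continuity is known on the closed square only; the extension by zero is Borel on the
  plane and is pulled back along the inclusion, written \<open>id\<close>.\<close>

lemma kernel_measurable: "(\<lambda>(t, s). C t s) \<in> borel_measurable (unit_leb \<Otimes>\<^sub>M unit_leb)"
proof -
  have meas: "(\<lambda>p. indicator ({0..1} \<times> {0..1}) p *\<^sub>R (case p of (t, s) \<Rightarrow> C t s)) \<in> borel_measurable (borel :: (real \<times> real) measure)"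
    using cont by (intro borel_measurable_continuous_on_indicator) (auto intro!: borel_closed closed_Times)
  have "(\<lambda>p. indicator ({0..1} \<times> {0..1}) (id p) *\<^sub>R (case id p of (t, s) \<Rightarrow> C t s))
      \<in> borel_measurable (unit_leb \<Otimes>\<^sub>M unit_leb)"
  proof (rule measurable_compose[OF _ meas])
    have "fst \<in> borel_measurable (unit_leb \<Otimes>\<^sub>M unit_leb)" "snd \<in> borel_measurable (unit_leb \<Otimes>\<^sub>M unit_leb)"
      by (rule measurable_compose[OF measurable_fst] measurable_compose[OF measurable_snd],
          simp add: measurable_restrict_space1)+
    then have "(\<lambda>p. (fst p, snd p)) \<in> borel_measurable (unit_leb \<Otimes>\<^sub>M unit_leb)"
      by (rule borel_measurable_Pair)
    then show "id \<in> borel_measurable (unit_leb \<Otimes>\<^sub>M unit_leb)" by (simp add: id_def)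
  qed
  then show ?thesis
    by (rule measurable_cong[THEN iffD1, rotated])
      (auto simp: space_pair_measure space_unit_leb)
qed

lemma kernel_L2: "(\<lambda>(t, s). C t s) \<in> L2_space (unit_leb \<Otimes>\<^sub>M unit_leb)"
proof -
  interpret pair: prob_space "unit_leb \<Otimes>\<^sub>M unit_leb"
    by (intro prob_space_pair prob_space_unit_leb)
  obtain B where "\<forall>t\<in>{0..1}. \<forall>s\<in>{0..1}. \<bar>C t s\<bar> \<le> B"
    using kernel_bounded by auto
  then show ?thesis
    by (intro pair.L2_space_bounded[of _ B] kernel_measurable)
      (auto simp: space_pair_measure space_unit_leb)
qed

lemma kop_eq_scalar: "kop f t = L2_scalar unit_leb (C t) f"
  by (simp add: kop_def L2_scalar_def)

end

lemma unit_scalar_self_le: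
  assumes "h \<in> L2_space unit_leb" "\<And>s. s \<in> {0..1} \<Longrightarrow> \<bar>h s\<bar> \<le> e"
  shows "L2_scalar unit_leb h h \<le> e\<^sup>2"
proof -
  have "L2_scalar unit_leb h h \<le> (LINT s|unit_leb. e\<^sup>2)"
    unfolding L2_scalar_def
  proof (rule integral_mono)
    fix s assume "s \<in> space unit_leb"
    then have "\<bar>h s\<bar>\<^sup>2 \<le> e\<^sup>2" using assms(2)[of s] by (intro power_mono) (auto simp: space_unit_leb)
    then show "h s * h s \<le> e\<^sup>2" by (simp add: power2_eq_square)
  qed (auto intro: L2_space_integrable_mult assms)
  then show ?thesis using unit.prob_space by (simp add: space_unit_leb)
qed

lemma abs_unit_scalar_le:
  assumes "h \<in> L2_space unit_leb" "f \<in> L2_space unit_leb" "\<And>s. s \<in> {0..1} \<Longrightarrow> \<bar>h s\<bar> \<le> e" "0 \<le> e"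
  shows "\<bar>L2_scalar unit_leb h f\<bar> \<le> e * sqrt (L2_scalar unit_leb f f)"
proof -
  have "(L2_scalar unit_leb h f)\<^sup>2 \<le> e\<^sup>2 * L2_scalar unit_leb f f"
    using L2_Cauchy_Schwarz[OF assms(1,2)] L2_scalar_self_nonneg[of unit_leb f]
      unit_scalar_self_le[of h e] assms(1,3)
    by (meson mult_right_mono order_trans)
  then have "sqrt ((L2_scalar unit_leb h f)\<^sup>2) \<le> sqrt (e\<^sup>2 * L2_scalar unit_leb f f)"
    by (rule real_sqrt_le_mono)
  then show ?thesis using assms(4) by (simp add: real_sqrt_mult)
qed

section \<open>Mapping properties of the integral operator\<close>

context continuous_kernel
begin

text \<open>By uniform continuity nearby sections of the kernel are uniformly close, so one d serves
  the whole unit ball. This is compactness of the operator in the form that Arzela-Ascoli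
  requires.\<close>

lemma kop_equicontinuous:
  assumes "0 < e"
  shows "\<exists>d>0. \<forall>f\<in>L2_space unit_leb. L2_scalar unit_leb f f \<le> 1 \<longrightarrow>
    (\<forall>t\<in>{0..1}. \<forall>t'\<in>{0..1}. \<bar>t - t'\<bar> < d \<longrightarrow> \<bar>kop f t - kop f t'\<bar> \<le> e)"
proof -
  obtain d where d: "d > 0" "\<And>t t' s. t \<in> {0..1} \<Longrightarrow> t' \<in> {0..1} \<Longrightarrow> s \<in> {0..1} \<Longrightarrow> \<bar>t - t'\<bar> < d
      \<Longrightarrow> \<bar>C t s - C t' s\<bar> < e"
    using kernel_uniformly_continuous[OF assms] by (metis abs_zero cancel_comm_monoid_add_class.diff_cancel)
  have "\<bar>kop f t - kop f t'\<bar> \<le> e"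
    if f: "f \<in> L2_space unit_leb" "L2_scalar unit_leb f f \<le> 1"
      and t: "t \<in> {0..1}" "t' \<in> {0..1}" "\<bar>t - t'\<bar> < d" for f t t'
  proof -
    have "\<bar>L2_scalar unit_leb (\<lambda>s. C t s - C t' s) f\<bar> \<le> e * sqrt (L2_scalar unit_leb f f)"
      using d(2)[OF t(1,2) _ t(3)] assms
      by (intro abs_unit_scalar_le f L2_space_diff kernel_section_L2 t) (auto intro: less_imp_le)
    also have "\<dots> \<le> e" using f assms by simp
    finally show ?thesis
      using f t by (simp add: kop_eq_scalar L2_scalar_diff_left kernel_section_L2)
  qed
  then show ?thesis using d(1) by blast
qed

lemma kop_bounded:
  "\<exists>B>0. \<forall>f\<in>L2_space unit_leb. \<forall>t\<in>{0..1}. \<bar>kop f t\<bar> \<le> B * sqrt (L2_scalar unit_leb f f)"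
proof -
  obtain B where B: "B > 0" "\<forall>t\<in>{0..1}. \<forall>s\<in>{0..1}. \<bar>C t s\<bar> \<le> B"
    using kernel_bounded by auto
  then show ?thesis
    by (intro exI[of _ B]) (auto simp: kop_eq_scalar intro!: abs_unit_scalar_le kernel_section_L2)
qed

lemma kop_cmult: "kop (\<lambda>s. c * f s) t = c * kop f t"
  by (simp add: kop_eq_scalar L2_scalar_cmult_right)

lemma kop_add:
  "t \<in> {0..1} \<Longrightarrow> f \<in> L2_space unit_leb \<Longrightarrow> g \<in> L2_space unit_leb
    \<Longrightarrow> kop (\<lambda>s. f s + g s) t = kop f t + kop g t"
  by (simp add: kop_eq_scalar L2_scalar_add_right kernel_section_L2)

lemma kop_diff:
  "t \<in> {0..1} \<Longrightarrow> f \<in> L2_space unit_leb \<Longrightarrow> g \<in> L2_space unit_leb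
    \<Longrightarrow> kop (\<lambda>s. f s - g s) t = kop f t - kop g t"
  by (simp add: kop_eq_scalar L2_scalar_diff_right kernel_section_L2)

lemma kop_L2: "f \<in> L2_space unit_leb \<Longrightarrow> kop f \<in> L2_space unit_leb"
proof -
  assume f: "f \<in> L2_space unit_leb"
  \<comment> \<open>The kernel lemma integrates out the first variable; symmetry of \<open>C\<close>
    swaps the arguments back.\<close>
  have "(\<lambda>t. LINT s|unit_leb. C s t * f s) \<in> L2_space unit_leb"
    by (rule unit_pair.L2_kernel_integral(1)[OF kernel_L2 f])
  also have "?this \<longleftrightarrow> kop f \<in> L2_space unit_leb"
  proof -
    have eq: "(LINT s|unit_leb. C s t * f s) = kop f t" if "t \<in> space unit_leb" for t
      unfolding kop_def
    proof (rule Bochner_Integration.integral_cong[OF refl])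
      fix s assume "s \<in> space unit_leb"
      then show "C s t * f s = C t s * f s" using sym[of s t] that by (simp add: space_unit_leb)
    qed
    then show ?thesis by (rule L2_space_cong)
  qed
  finally show ?thesis .
qed

lemma kop_self_adjoint:
  assumes f: "f \<in> L2_space unit_leb" and g: "g \<in> L2_space unit_leb"
  shows "L2_scalar unit_leb (kop f) g = L2_scalar unit_leb f (kop g)"
proof -
  have "L2_scalar unit_leb f (kop g) = (LINT t|unit_leb. f t * (LINT s|unit_leb. C t s * g s))"
    by (simp add: L2_scalar_def kop_def)
  also have "\<dots> = (LINT s|unit_leb. (LINT t|unit_leb. C t s * f t) * g s)"
    by (rule unit_pair.L2_kernel_Fubini[OF kernel_L2 f g, symmetric])
  also have "\<dots> = (LINT s|unit_leb. kop f s * g s)"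
  proof (rule Bochner_Integration.integral_cong[OF refl])
    fix s assume "s \<in> space unit_leb"
    then have "(LINT t|unit_leb. C t s * f t) = kop f s"
      unfolding kop_def using sym
      by (intro Bochner_Integration.integral_cong) (auto simp: space_unit_leb)
    then show "(LINT t|unit_leb. C t s * f t) * g s = kop f s * g s" by simp
  qed
  finally show ?thesis by (simp add: L2_scalar_def)
qed

lemma kop_comb:
  assumes "t \<in> {0..1}" "\<And>i. i \<in> A \<Longrightarrow> f i \<in> L2_space unit_leb"
  shows "kop (\<lambda>s. \<Sum>i\<in>A. c i * f i s) t = (\<Sum>i\<in>A. c i * kop (f i) t)"
  using assms by (simp add: kop_eq_scalar L2_scalar_comb_right kernel_section_L2)

lemma abs_kform_le: "\<exists>B>0. \<forall>f\<in>L2_space unit_leb. \<bar>kform f\<bar> \<le> B * L2_scalar unit_leb f f"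
proof -
  obtain B where B: "B > 0"
    "\<And>f t. f \<in> L2_space unit_leb \<Longrightarrow> t \<in> {0..1} \<Longrightarrow> \<bar>kop f t\<bar> \<le> B * sqrt (L2_scalar unit_leb f f)"
    using kop_bounded by metis
  have "\<bar>kform f\<bar> \<le> B * L2_scalar unit_leb f f" if f: "f \<in> L2_space unit_leb" for f
  proof -
    have "\<bar>kform f\<bar> \<le> (B * sqrt (L2_scalar unit_leb f f)) * sqrt (L2_scalar unit_leb f f)"
      unfolding kform_def using B f
      by (intro abs_unit_scalar_le kop_L2) (auto simp: L2_scalar_self_nonneg)
    then show ?thesis by (simp add: L2_scalar_self_nonneg mult.assoc)
  qed
  then show ?thesis using B(1) by blast
qed

section \<open>Eigenspaces and the existence of eigenfunctions\<close>

lemma eigenspace_iff: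
  "f \<in> eigenspace C \<mu> \<longleftrightarrow> f \<in> L2_space unit_leb \<and> (AE t in unit_leb. kop f t = \<mu> * f t)"
  by (simp add: eigenspace_def kop_def)

lemma eigenspace_L2: "f \<in> eigenspace C \<mu> \<Longrightarrow> f \<in> L2_space unit_leb"
  by (simp add: eigenspace_iff)

lemma eigenspace_scalar:
  assumes "f \<in> eigenspace C \<mu>" "g \<in> L2_space unit_leb"
  shows "L2_scalar unit_leb (kop f) g = \<mu> * L2_scalar unit_leb f g"
proof -
  have "L2_scalar unit_leb (kop f) g = L2_scalar unit_leb (\<lambda>t. \<mu> * f t) g"
    using assms
    by (intro L2_scalar_cong_AE) (auto simp: eigenspace_iff intro: L2_space_measurable kop_L2 L2_space_cmult)
  then show ?thesis by (simp add: L2_scalar_cmult_left)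
qed

lemma eigenspace_comb:
  assumes "finite A" "\<And>i. i \<in> A \<Longrightarrow> f i \<in> eigenspace C \<mu>"
  shows "(\<lambda>x. \<Sum>i\<in>A. c i * f i x) \<in> eigenspace C \<mu>"
proof -
  have L2: "\<And>i. i \<in> A \<Longrightarrow> f i \<in> L2_space unit_leb" using assms(2) eigenspace_L2 by blast
  have "AE t in unit_leb. \<forall>i\<in>A. kop (f i) t = \<mu> * f i t"
    using assms by (intro AE_finite_allI) (auto simp: eigenspace_iff)
  then have "AE t in unit_leb. kop (\<lambda>x. \<Sum>i\<in>A. c i * f i x) t = \<mu> * (\<Sum>i\<in>A. c i * f i t)"
    using AE_space
  proof eventually_elim
    case (elim t)
    then have "kop (\<lambda>x. \<Sum>i\<in>A. c i * f i x) t = (\<Sum>i\<in>A. c i * kop (f i) t)"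
      using L2 by (intro kop_comb) (auto simp: space_unit_leb)
    then show ?case using elim by (simp add: sum_distrib_left mult.left_commute)
  qed
  moreover have "(\<lambda>x. \<Sum>i\<in>A. c i * f i x) \<in> L2_space unit_leb"
    using L2 by (intro L2_space_sum L2_space_cmult)
  ultimately show ?thesis by (simp add: eigenspace_iff)
qed

lemma eigenspace_orthogonal:
  assumes "f \<in> eigenspace C \<mu>" "g \<in> eigenspace C \<nu>" "\<mu> \<noteq> \<nu>"
  shows "L2_scalar unit_leb f g = 0"
proof -
  note L2 = assms(1,2)[THEN eigenspace_L2]
  have "\<mu> * L2_scalar unit_leb f g = \<nu> * L2_scalar unit_leb f g"
    using eigenspace_scalar[OF assms(1) L2(2)] eigenspace_scalar[OF assms(2) L2(1)]
      kop_self_adjoint[OF L2] by (simp add: L2_scalar_commute)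
  then show ?thesis using assms(3) by simp
qed

text \<open>The index set is a general \<open>A\<close>, so that \<open>{k. lam k = \<mu>}\<close>
  can label the basis directly in \<open>eigensystem_exists\<close>. The last clause expresses
  completeness within the eigenspace through orthogonality.\<close>

lemma eigenspace_orthonormal_basis:
  assumes dim: "L2_has_dim unit_leb (eigenspace C \<mu>) (card A)" and A: "finite A"
  shows "\<exists>v. (\<forall>k\<in>A. v k \<in> eigenspace C \<mu>) \<and>
    (\<forall>j\<in>A. \<forall>k\<in>A. L2_scalar unit_leb (v j) (v k) = (if j = k then 1 else 0)) \<and>
    (\<forall>g\<in>eigenspace C \<mu>. (\<forall>k\<in>A. L2_scalar unit_leb g (v k) = 0) \<longrightarrow> L2_scalar unit_leb g g = 0)"
proof -
  define n where "n = card A"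
  obtain f where basis: "L2_basis unit_leb (eigenspace C \<mu>) n f"
    using dim unfolding L2_has_dim_def n_def by blast
  have f: "f i \<in> eigenspace C \<mu>" if "i < n" for i
    using basis that unfolding L2_basis_def by blast
  have indep: "c i = 0" if "AE x in unit_leb. (\<Sum>i<n. c i * f i x) = 0" "i < n" for c i
    using basis that unfolding L2_basis_def by blast
  have span: "\<exists>c. AE x in unit_leb. g x = (\<Sum>i<n. c i * f i x)" if "g \<in> eigenspace C \<mu>" for g
    using basis that unfolding L2_basis_def by blast
  have fL: "\<And>i. i < n \<Longrightarrow> f i \<in> L2_space unit_leb" using f eigenspace_L2 by blast
  obtain u where u: "orthonormal_or_null unit_leb u {..<n}"
    and comb: "\<And>i. i < n \<Longrightarrow> \<exists>b. b i \<noteq> 0 \<and> u i = (\<lambda>x. \<Sum>j\<le>i. b j * f j x)"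
    using Gram_Schmidt[of n f unit_leb, OF fL] by blast
  have uE: "u i \<in> eigenspace C \<mu>" if "i < n" for i
  proof -
    obtain b where "u i = (\<lambda>x. \<Sum>j\<le>i. b j * f j x)" using comb[OF \<open>i < n\<close>] by auto
    then show ?thesis using f \<open>i < n\<close> by (auto intro!: eigenspace_comb)
  qed
  have u1: "L2_scalar unit_leb (u i) (u i) = 1" if "i < n" for i
  proof (rule ccontr)
    assume "L2_scalar unit_leb (u i) (u i) \<noteq> 1"
    then have "L2_scalar unit_leb (u i) (u i) = 0"
      using u \<open>i < n\<close> by (auto simp: orthonormal_or_null_def)
    then have null: "AE x in unit_leb. u i x = 0"
      using uE[OF \<open>i < n\<close>] by (intro L2_scalar_self_eq_0_AE eigenspace_L2)
    obtain b where b: "b i \<noteq> 0" "u i = (\<lambda>x. \<Sum>j\<le>i. b j * f j x)"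
      using comb[OF \<open>i < n\<close>] by auto
    \<comment> \<open>Padding by zeros turns a null \<open>u i\<close> into a vanishing combination
      of the whole basis in which the coefficient \<open>b i\<close> is nonzero.\<close>
    define c where "c j = (if j \<le> i then b j else 0)" for j
    have "(\<Sum>j<n. c j * f j x) = u i x" for x
    proof -
      have "(\<Sum>j<n. c j * f j x) = (\<Sum>j\<le>i. c j * f j x)"
        using \<open>i < n\<close> by (intro sum.mono_neutral_right) (auto simp: c_def)
      then show ?thesis by (simp add: b(2) c_def)
    qed
    then have "c i = 0" using indep[of c i] null \<open>i < n\<close> by simp
    then show False using b(1) by (simp add: c_def)
  qed
  have total: "L2_scalar unit_leb g g = 0"
    if g: "g \<in> eigenspace C \<mu>" "\<And>i. i < n \<Longrightarrow> L2_scalar unit_leb g (u i) = 0" for g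
  proof -
    \<comment> \<open>Orthogonality passes from \<open>u\<close> to \<open>f\<close>; as
      \<open>g\<close> is almost everywhere a combination of the \<open>f i\<close>, it is
      orthogonal to itself.\<close>
    have gf: "L2_scalar unit_leb g (f i) = 0" if "i < n" for i
      using triangular_comb_orthogonal[of n f unit_leb g u] fL comb g eigenspace_L2 that by blast
    obtain c where c: "AE x in unit_leb. g x = (\<Sum>i<n. c i * f i x)" using span[OF g(1)] by auto
    have "L2_scalar unit_leb g g = L2_scalar unit_leb (\<lambda>x. \<Sum>i<n. c i * f i x) g"
      using c fL eigenspace_L2[OF g(1)]
      by (intro L2_scalar_cong_AE) (auto intro!: L2_space_measurable L2_space_sum L2_space_cmult)
    also have "\<dots> = (\<Sum>i<n. c i * L2_scalar unit_leb (f i) g)"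
      using fL eigenspace_L2[OF g(1)] by (intro L2_scalar_comb_left) auto
    also have "\<dots> = 0" using gf by (simp add: L2_scalar_commute)
    finally show ?thesis .
  qed
  obtain h where h: "bij_betw h A {..<n}"
    using ex_bij_betw_finite_nat[OF A] by (auto simp: n_def lessThan_atLeast0)
  have hn: "h k < n" if "k \<in> A" for k using bij_betwE[OF h] that by auto
  show ?thesis
  proof (intro exI[of _ "\<lambda>k. u (h k)"] conjI ballI impI)
    fix k assume "k \<in> A" then show "u (h k) \<in> eigenspace C \<mu>" using uE hn by blast
  next
    fix j k assume "j \<in> A" "k \<in> A"
    moreover have "h j \<noteq> h k" if "j \<noteq> k"
      using bij_betw_imp_inj_on[OF h] \<open>j \<in> A\<close> \<open>k \<in> A\<close> that by (auto dest: inj_onD)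
    ultimately show "L2_scalar unit_leb (u (h j)) (u (h k)) = (if j = k then 1 else 0)"
      using u1 hn u by (auto simp: orthonormal_or_null_def)
  next
    fix g assume g: "g \<in> eigenspace C \<mu>" "\<forall>k\<in>A. L2_scalar unit_leb g (u (h k)) = 0"
    show "L2_scalar unit_leb g g = 0"
    proof (rule total[OF g(1)])
      fix i assume "i < n"
      then obtain k where "k \<in> A" "i = h k" using h by (auto simp: bij_betw_def)
      then show "L2_scalar unit_leb g (u i) = 0" using g(2) by auto
    qed
  qed
qed

text \<open>The images under the operator of a maximising sequence have a uniformly convergent
  subsequence by Arzela-Ascoli, and the form \<open>\<mu> \<langle>f, h\<rangle> - \<langle>kop f, h\<rangle>\<close>, which is nonnegative
  on the orthogonal complement, forces the limit to be an eigenfunction.\<close>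

lemma extremal_eigenfunction:
  assumes phi: "\<And>k. k \<in> A \<Longrightarrow> \<phi> k \<in> eigenspace C (l k)"
    and mu: "0 < \<mu>"
    and upper: "\<And>f. f \<in> L2_space unit_leb \<Longrightarrow> (\<And>k. k \<in> A \<Longrightarrow> L2_scalar unit_leb f (\<phi> k) = 0)
      \<Longrightarrow> kform f \<le> \<mu> * L2_scalar unit_leb f f"
    and approx: "\<And>e. 0 < e \<Longrightarrow> \<exists>f\<in>L2_space unit_leb. (\<forall>k\<in>A. L2_scalar unit_leb f (\<phi> k) = 0)
      \<and> L2_scalar unit_leb f f \<le> 1 \<and> \<mu> - e < kform f"
  shows "\<exists>g\<in>eigenspace C \<mu>. (\<forall>k\<in>A. L2_scalar unit_leb g (\<phi> k) = 0) \<and> L2_scalar unit_leb g g \<noteq> 0"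
proof -
  let ?ip = "L2_scalar unit_leb"
  define H where "H = {f \<in> L2_space unit_leb. \<forall>k\<in>A. ?ip f (\<phi> k) = 0}"
  note phiL = phi[THEN eigenspace_L2]
  have HL: "f \<in> L2_space unit_leb" if "f \<in> H" for f using that by (simp add: H_def)
  have Hkop: "kop f \<in> H" if "f \<in> H" for f
  proof -
    have "?ip (kop f) (\<phi> k) = 0" if "k \<in> A" for k
      using kop_self_adjoint[OF HL[OF \<open>f \<in> H\<close>] phiL[OF that]] eigenspace_scalar[OF phi[OF that] HL[OF \<open>f \<in> H\<close>]]
        that \<open>f \<in> H\<close> by (simp add: H_def L2_scalar_commute)
    then show ?thesis using that by (simp add: H_def kop_L2)
  qed
  have Hlin: "(\<lambda>x. a * f x + b * h x) \<in> H" if "f \<in> H" "h \<in> H" for f h a b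
    using that phiL by (simp add: H_def L2_scalar_linear L2_space_intros)
  obtain F where F: "\<And>n. F n \<in> H" "\<And>n. ?ip (F n) (F n) \<le> 1" "\<And>n. \<mu> - 1 / real (Suc n) < kform (F n)"
  proof -
    have "\<forall>n. \<exists>f. f \<in> H \<and> ?ip f f \<le> 1 \<and> \<mu> - 1 / real (Suc n) < kform f"
      using approx[of "1 / real (Suc _)"] by (fastforce simp: H_def)
    then show ?thesis using that by metis
  qed
  obtain B where B: "B > 0" "\<And>f. f \<in> L2_space unit_leb \<Longrightarrow> \<bar>kform f\<bar> \<le> B * ?ip f f"
    using abs_kform_le by metis
  obtain D where D: "D > 0" "\<And>f t. f \<in> L2_space unit_leb \<Longrightarrow> t \<in> {0..1} \<Longrightarrow> \<bar>kop f t\<bar> \<le> D * sqrt (?ip f f)"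
    using kop_bounded by metis
  \<comment> \<open>The residual of the approximate eigenvalue equation; it stays in the complement
    \<open>H\<close> because \<open>kop\<close> preserves \<open>H\<close>.\<close>
  define R where "R n = (\<lambda>s. \<mu> * F n s - kop (F n) s)" for n
  have RH: "R n \<in> H" for n
    using Hlin[OF F(1)[of n] Hkop[OF F(1)[of n]], of \<mu> "-1"] by (simp add: R_def)
  have Rsmall: "?ip (R n) (R n) \<le> (\<mu> + B) / real (Suc n)" for n
  proof -
    \<comment> \<open>Cauchy-Schwarz is applied to this form: P(F, R) = <R, R>, while P(F, F) \<le>
      1 / (n + 1) and P(R, R) \<le> (\<mu> + B) <R, R>. Dividing by <R, R> gives the claim.\<close>
    define P where "P f h = \<mu> * ?ip f h - ?ip (kop f) h" for f h
    have "(P (F n) (R n))\<^sup>2 \<le> P (F n) (F n) * P (R n) (R n)"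
    proof (rule quadratic_nonneg_discriminant)
      fix t
      let ?h = "\<lambda>x. 1 * F n x + t * R n x"
      have hH: "?h \<in> H" by (rule Hlin[OF F(1) RH])
      note L = HL[OF F(1)[of n]] HL[OF RH[of n]]
      have k: "kform ?h = ?ip (\<lambda>x. kop (F n) x + t * kop (R n) x) ?h"
        unfolding kform_def using L
        by (intro L2_scalar_cong) (auto simp: space_unit_leb kop_add kop_cmult L2_space_cmult)
      have "?ip (kop (R n)) (F n) = ?ip (kop (F n)) (R n)"
        using kop_self_adjoint[OF L] by (simp add: L2_scalar_commute)
      then have "kform ?h = ?ip (kop (F n)) (F n) + 2 * t * ?ip (kop (F n)) (R n) + t\<^sup>2 * ?ip (kop (R n)) (R n)"
        unfolding k using L by (simp add: L2_scalar_linear L2_space_intros kop_L2 power2_eq_square algebra_simps)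
      moreover have "?ip ?h ?h = ?ip (F n) (F n) + 2 * t * ?ip (F n) (R n) + t\<^sup>2 * ?ip (R n) (R n)"
        using L by (simp add: L2_scalar_linear L2_space_intros L2_scalar_commute[of _ "R n" "F n"]
            power2_eq_square algebra_simps)
      moreover have "kform ?h \<le> \<mu> * ?ip ?h ?h"
        using hH by (intro upper) (auto simp: H_def)
      ultimately show "0 \<le> P (F n) (F n) + 2 * t * P (F n) (R n) + t\<^sup>2 * P (R n) (R n)"
        by (simp add: P_def algebra_simps)
    qed
    moreover have "P (F n) (R n) = ?ip (R n) (R n)"
    proof -
      have "?ip (R n) (R n) = ?ip (\<lambda>s. \<mu> * F n s - kop (F n) s) (R n)" by (simp add: R_def)
      also have "\<dots> = P (F n) (R n)"
        using HL[OF F(1)[of n]] HL[OF RH[of n]]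
        by (simp add: P_def L2_scalar_diff_left L2_scalar_cmult_left L2_space_cmult kop_L2)
      finally show ?thesis by simp
    qed
    moreover have "P (F n) (F n) \<le> 1 / real (Suc n)"
    proof -
      have "\<mu> * ?ip (F n) (F n) \<le> \<mu> * 1" using F(2)[of n] mu by (intro mult_left_mono) auto
      then show ?thesis using F(3)[of n] by (simp add: P_def kform_def)
    qed
    moreover have "0 \<le> P (F n) (F n)"
      using upper[OF HL[OF F(1)[of n]]] F(1)[of n] by (simp add: P_def kform_def H_def)
    moreover have "P (R n) (R n) \<le> (\<mu> + B) * ?ip (R n) (R n)"
      using B(2)[OF HL[OF RH[of n]]] by (simp add: P_def kform_def algebra_simps)
    moreover have "0 \<le> P (R n) (R n)"
      using upper[OF HL[OF RH[of n]]] RH[of n] by (simp add: P_def kform_def H_def)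
    ultimately have "(?ip (R n) (R n))\<^sup>2 \<le> (1 / real (Suc n)) * ((\<mu> + B) * ?ip (R n) (R n))"
      by (smt (verit) mult_mono)
    then have "?ip (R n) (R n) * ?ip (R n) (R n) \<le> ((\<mu> + B) / real (Suc n)) * ?ip (R n) (R n)"
      by (simp add: power2_eq_square)
    moreover have "0 \<le> (\<mu> + B) / real (Suc n)" using mu B(1) by simp
    ultimately show ?thesis
      using L2_scalar_self_nonneg[of unit_leb "R n"]
      by (cases "?ip (R n) (R n) = 0") (auto intro: mult_right_le_imp_le)
  qed
  \<comment> \<open>\<open>kop (F n)\<close> is defined by an integral at every point, so
    boundedness and equicontinuity hold everywhere on the interval and not just up to null
    sets.\<close>
  obtain g r where g: "continuous_on {0..1} g" and r: "strict_mono (r :: nat \<Rightarrow> nat)"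
    and unif: "\<And>e. 0 < e \<Longrightarrow> \<exists>N. \<forall>n t. n \<ge> N \<and> t \<in> {0..1} \<longrightarrow> norm (kop (F (r n)) t - g t) < e"
  proof (rule Arzela_Ascoli[of "{0..1::real}" "\<lambda>n. kop (F n)" D])
    fix n and t :: real assume t: "t \<in> {0..1}"
    have "\<bar>kop (F n) t\<bar> \<le> D * sqrt (?ip (F n) (F n))" using D(2) HL F(1) t by blast
    also have "\<dots> \<le> D * 1" using F(2)[of n] D(1) by (intro mult_left_mono) auto
    finally show "norm (kop (F n) t) \<le> D" by simp
  next
    fix t e :: real assume "t \<in> {0..1}" "0 < e"
    then obtain d where d: "d > 0" "\<And>f t'. f \<in> L2_space unit_leb \<Longrightarrow> ?ip f f \<le> 1 \<Longrightarrow> t' \<in> {0..1}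
        \<Longrightarrow> \<bar>t - t'\<bar> < d \<Longrightarrow> \<bar>kop f t - kop f t'\<bar> \<le> e / 2"
      using kop_equicontinuous[of "e / 2"] by (metis half_gt_zero)
    have "norm (kop (F n) t - kop (F n) t') < e" if "t' \<in> {0..1}" "norm (t - t') < d" for n t'
      using d(2)[OF HL[OF F(1)[of n]] F(2)[of n] that(1)] that(2) \<open>0 < e\<close> by simp
    then show "\<exists>d>0. \<forall>n t'. t' \<in> {0..1} \<and> norm (t - t') < d \<longrightarrow> norm (kop (F n) t - kop (F n) t') < e"
      using d(1) by blast
  qed auto
  have gL: "g \<in> L2_space unit_leb" by (rule continuous_on_L2_unit_leb[OF g])
  have near: "\<exists>n. (\<forall>t\<in>{0..1}. \<bar>kop (F n) t - g t\<bar> \<le> e) \<and> sqrt (?ip (R n) (R n)) \<le> e \<and> 1 / real (Suc n) \<le> e"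
    if "0 < e" for e
  proof -
    obtain N1 where N1: "\<And>n t. n \<ge> N1 \<Longrightarrow> t \<in> {0..1} \<Longrightarrow> norm (kop (F (r n)) t - g t) < e"
      using unif[OF \<open>0 < e\<close>] by blast
    \<comment> \<open>Large enough that both (\<mu> + B) / (n + 1) \<le> e^2 and 1 / (n + 1) \<le>
      e.\<close>
    obtain N2 where N2: "real N2 > (\<mu> + B) / e\<^sup>2 + 1 / e" using reals_Archimedean2 by blast
    define n where "n = r (max N1 N2)"
    have "N2 \<le> n" using seq_suble[OF r, of "max N1 N2"] by (simp add: n_def)
    then have big: "(\<mu> + B) / e\<^sup>2 + 1 / e \<le> real (Suc n)" using N2 by simp
    have pos: "0 \<le> (\<mu> + B) / e\<^sup>2" "0 \<le> 1 / e" using mu B(1) \<open>0 < e\<close> by simp_all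
    have "1 / e \<le> real (Suc n)" "(\<mu> + B) / e\<^sup>2 \<le> real (Suc n)" using big pos by linarith+
    then have b: "1 / real (Suc n) \<le> e" "(\<mu> + B) / real (Suc n) \<le> e\<^sup>2"
      using \<open>0 < e\<close> by (simp_all add: field_simps)
    have "?ip (R n) (R n) \<le> e\<^sup>2" using Rsmall[of n] b(2) by linarith
    then have "sqrt (?ip (R n) (R n)) \<le> e" using \<open>0 < e\<close> by (simp add: real_le_lsqrt L2_scalar_self_nonneg)
    moreover have "\<bar>kop (F n) t - g t\<bar> \<le> e" if "t \<in> {0..1}" for t
      using N1[of "max N1 N2" t] that by (simp add: n_def)
    ultimately show ?thesis using b(1) by blast
  qed
  have zero: "x = 0" if "\<And>e. 0 < e \<Longrightarrow> \<bar>x\<bar> \<le> c * e" "0 \<le> c" for x c :: real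
  proof (rule ccontr)
    assume "x \<noteq> 0"
    then have "\<bar>x\<bar> \<le> c * (\<bar>x\<bar> / (2 * (c + 1)))" using that by (intro that(1)) auto
    also have "\<dots> \<le> \<bar>x\<bar> / 2" using that(2) by (simp add: field_simps)
    finally show False using \<open>x \<noteq> 0\<close> by simp
  qed
  have diffL: "(\<lambda>t. kop (F n) t - g t) \<in> L2_space unit_leb" for n
    by (intro L2_space_diff kop_L2 HL F gL)
  \<comment> \<open>The path from \<open>kop g\<close> to \<open>\<mu> * g\<close> leads over
    \<open>kop (kop (F n))\<close> and \<open>\<mu> * kop (F n)\<close>: the outer differences are
    small by uniform convergence, the middle one is \<open>kop (R n)\<close>. Taking g as a limit of
    the images, not of the \<open>F n\<close> themselves, avoids weak limits.\<close>
  have eigen: "kop g t = \<mu> * g t" if t: "t \<in> {0..1}" for t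
  proof -
    have "\<bar>kop g t - \<mu> * g t\<bar> \<le> (2 * D + \<mu>) * e" if "0 < e" for e
    proof -
      obtain n where n: "\<And>t. t \<in> {0..1} \<Longrightarrow> \<bar>kop (F n) t - g t\<bar> \<le> e" "sqrt (?ip (R n) (R n)) \<le> e"
        using near[OF \<open>0 < e\<close>] by blast
      have FL: "F n \<in> L2_space unit_leb" by (rule HL[OF F(1)])
      have "\<bar>kop (\<lambda>t. kop (F n) t - g t) t\<bar> \<le> D * sqrt (?ip (\<lambda>t. kop (F n) t - g t) (\<lambda>t. kop (F n) t - g t))"
        by (rule D(2)[OF diffL t])
      also have "\<dots> \<le> D * e"
      proof -
        have "?ip (\<lambda>t. kop (F n) t - g t) (\<lambda>t. kop (F n) t - g t) \<le> e\<^sup>2"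
          using n(1) by (intro unit_scalar_self_le diffL) auto
        then show ?thesis using D(1) \<open>0 < e\<close> by (intro mult_left_mono real_le_lsqrt) auto
      qed
      finally have 1: "\<bar>kop (kop (F n)) t - kop g t\<bar> \<le> D * e"
        using t FL gL by (simp add: kop_diff kop_L2)
      have "\<bar>kop (R n) t\<bar> \<le> D * sqrt (?ip (R n) (R n))" by (rule D(2)[OF HL[OF RH] t])
      also have "\<dots> \<le> D * e" using n(2) D(1) by (intro mult_left_mono) auto
      finally have 2: "\<bar>\<mu> * kop (F n) t - kop (kop (F n)) t\<bar> \<le> D * e"
        using t FL by (simp add: R_def kop_diff kop_L2 L2_space_cmult kop_cmult)
      have 3: "\<bar>\<mu> * kop (F n) t - \<mu> * g t\<bar> \<le> \<mu> * e"
        using n(1)[OF t] mu by (simp add: right_diff_distrib[symmetric] abs_mult)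
      have "\<bar>kop g t - \<mu> * g t\<bar> \<le> D * e + D * e + \<mu> * e" using 1 2 3 by linarith
      then show ?thesis by (simp add: algebra_simps)
    qed
    then have "kop g t - \<mu> * g t = 0" using D(1) mu by (intro zero[of _ "2 * D + \<mu>"]) auto
    then show ?thesis by simp
  qed
  have "AE t in unit_leb. kop g t = \<mu> * g t"
    using AE_space by eventually_elim (use eigen in \<open>auto simp: space_unit_leb\<close>)
  then have "g \<in> eigenspace C \<mu>" using gL by (simp add: eigenspace_iff)
  moreover have "?ip g (\<phi> k) = 0" if k: "k \<in> A" for k
  proof (rule zero)
    show "0 \<le> sqrt (?ip (\<phi> k) (\<phi> k))" by (simp add: L2_scalar_self_nonneg)
    fix e :: real assume "0 < e"
    then obtain n where n: "\<And>t. t \<in> {0..1} \<Longrightarrow> \<bar>kop (F n) t - g t\<bar> \<le> e" using near by blast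
    have "\<bar>?ip (\<lambda>t. kop (F n) t - g t) (\<phi> k)\<bar> \<le> e * sqrt (?ip (\<phi> k) (\<phi> k))"
      using n \<open>0 < e\<close> by (intro abs_unit_scalar_le diffL phiL k) auto
    then show "\<bar>?ip g (\<phi> k)\<bar> \<le> sqrt (?ip (\<phi> k) (\<phi> k)) * e"
      using Hkop[OF F(1)[of n]] k gL HL[OF F(1)[of n]] phiL[OF k]
      by (simp add: H_def L2_scalar_diff_left kop_L2 mult.commute)
  qed
  \<comment> \<open>If g were null, then \<open>kop (F n)\<close> would be uniformly within \<mu> /
    3 of a null function, forcing \<open>kform (F n)\<close> below \<mu> / 3, whereas it exceeds
    \<mu> - \<mu> / 3.\<close>
  moreover have "?ip g g \<noteq> 0"
  proof
    assume g0: "?ip g g = 0"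
    obtain n where n: "\<And>t. t \<in> {0..1} \<Longrightarrow> \<bar>kop (F n) t - g t\<bar> \<le> \<mu> / 3" "1 / real (Suc n) \<le> \<mu> / 3"
      using near[of "\<mu> / 3"] mu by (meson divide_pos_pos zero_less_numeral)
    note FL = HL[OF F(1)[of n]]
    have "\<bar>?ip (\<lambda>t. kop (F n) t - g t) (F n)\<bar> \<le> (\<mu> / 3) * sqrt (?ip (F n) (F n))"
      using n mu by (intro abs_unit_scalar_le diffL FL) auto
    also have "\<dots> \<le> (\<mu> / 3) * 1" using F(2)[of n] mu by (intro mult_left_mono) auto
    finally have "\<bar>kform (F n)\<bar> \<le> \<mu> / 3"
      using L2_scalar_null_left[OF gL FL g0] gL FL
      by (simp add: kform_def L2_scalar_diff_left kop_L2)
    then show False using F(3)[of n] n(2) mu by linarith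
  qed
  ultimately show ?thesis by blast
qed

end

section \<open>The eigenvalue sequence\<close>

text \<open>Left-open cells are disjoint, and two points of one cell are strictly closer than 1 / N.
  The only point of the unit interval that they miss is 0, a null set.\<close>

definition unit_cell :: "nat \<Rightarrow> nat \<Rightarrow> real set" where
  "unit_cell N j = {real j / real N<..real (Suc j) / real N}"

lemma unit_cell_subset:
  assumes "j < N"
  shows "unit_cell N j \<subseteq> {0..1}"
proof
  fix x assume "x \<in> unit_cell N j"
  then have x: "real j / N < x" "x \<le> real (Suc j) / N" by (auto simp: unit_cell_def)
  have "0 \<le> real j / N" by simp
  moreover have "real (Suc j) / N \<le> 1" using assms by (simp add: divide_le_eq)
  ultimately show "x \<in> {0..1}" using x by (intro atLeastAtMost_iff[THEN iffD2]) linarith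
qed

lemma unit_cell_sets: "j < N \<Longrightarrow> unit_cell N j \<in> sets unit_leb"
  using unit_cell_subset[of j N] by (auto simp: sets_restrict_space unit_cell_def)

lemma measure_unit_cell:
  assumes "j < N"
  shows "measure unit_leb (unit_cell N j) = 1 / real N"
proof -
  have "measure unit_leb (unit_cell N j) = measure lborel (unit_cell N j)"
    using unit_cell_subset[OF assms] by (intro measure_restrict_space) auto
  then show ?thesis using assms by (simp add: unit_cell_def field_simps)
qed

lemma unit_cell_indicator_L2: "j < N \<Longrightarrow> (indicator (unit_cell N j) :: real \<Rightarrow> real) \<in> L2_space unit_leb"
  using unit_cell_sets by (intro unit.L2_space_bounded[of _ 1]) auto

lemma unit_cell_disjoint:
  assumes "i \<noteq> j"
  shows "unit_cell N i \<inter> unit_cell N j = {}"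
proof -
  have *: "unit_cell N i \<inter> unit_cell N j = {}" if "i < j" for i j
  proof -
    have "real (Suc i) / N \<le> real j / N" using that by (intro divide_right_mono) auto
    then show ?thesis by (auto simp: unit_cell_def)
  qed
  show ?thesis using *[of i j] *[of j i] assms by (cases "i < j") auto
qed

lemma unit_cell_cover:
  assumes t: "t \<in> {0..1}" "t \<noteq> 0" and N: "0 < N"
  shows "(\<Sum>j<N. indicator (unit_cell N j) t) = (1::real)"
proof -
  \<comment> \<open>t lies in the cell whose right end is the ceiling of t * N, divided by N; the
    index of that cell is one less.\<close>
  define j where "j = nat (\<lceil>t * N\<rceil> - 1)"
  have tN: "0 < t * N" "t * N \<le> N" using t N by (auto simp: mult_le_cancel_right1)
  then have c: "1 \<le> \<lceil>t * N\<rceil>" "\<lceil>t * N\<rceil> \<le> int N" by linarith+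
  have rj: "real j = real_of_int \<lceil>t * N\<rceil> - 1" using c(1) by (simp add: j_def)
  have "j < N" using c N by (simp add: j_def nat_less_iff)
  moreover have "t \<in> unit_cell N j"
    using rj N unfolding unit_cell_def greaterThanAtMost_iff by (simp add: field_simps; linarith)
  ultimately have j: "j < N" "t \<in> unit_cell N j" .
  have "t \<notin> unit_cell N i" if "i \<noteq> j" for i
    using unit_cell_disjoint[OF that] j(2) by auto
  then have "(\<Sum>i<N. indicator (unit_cell N i) t) = (\<Sum>i<N. if i = j then 1 else (0::real))"
    using j(2) by (intro sum.cong) auto
  then show ?thesis using j(1) by simp
qed

lemma (in continuous_kernel) kernel_diag_L2: "(\<lambda>t. C t t) \<in> L2_space unit_leb"
proof (rule continuous_on_L2_unit_leb)
  have "continuous_on {0..1} ((\<lambda>(t, s). C t s) \<circ> (\<lambda>t. (t, t)))"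
    by (intro continuous_on_compose continuous_intros continuous_on_subset[OF cont]) auto
  then show "continuous_on {0..1} (\<lambda>t. C t t)" by (simp add: comp_def)
qed

text \<open>\<open>\<phi> k\<close> is only required to be a unit vector where \<open>lam k > 0\<close>: the zeros of \<open>lam\<close> are mere
  padding, and \<open>\<phi> k\<close> is then the zero function.\<close>

locale eigensystem = continuous_kernel C for C +
  fixes lam :: "nat \<Rightarrow> real" and \<phi> :: "nat \<Rightarrow> real \<Rightarrow> real"
  assumes lam_dec: "decseq lam" and lam_nonneg: "0 \<le> lam k"
    and phi_eigenspace: "\<phi> k \<in> eigenspace C (lam k)"
    and phi_orthonormal:
      "L2_scalar unit_leb (\<phi> j) (\<phi> k) = (if j = k \<and> 0 < lam k then 1 else 0)"
    and phi_total: "\<lbrakk>0 < \<mu>; g \<in> eigenspace C \<mu>; \<And>k. lam k = \<mu> \<Longrightarrow> L2_scalar unit_leb g (\<phi> k) = 0\<rbrakk>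
      \<Longrightarrow> L2_scalar unit_leb g g = 0"

lemma (in continuous_kernel) eigensystem_exists:
  assumes ev: "eigenvalue_sequence C lam"
  shows "\<exists>\<phi>. eigensystem C lam \<phi>"
proof -
  have fin: "finite {k. lam k = \<mu>}" and dim: "L2_has_dim unit_leb (eigenspace C \<mu>) (card {k. lam k = \<mu>})"
    if "0 < \<mu>" for \<mu>
    using ev that by (auto simp: eigenvalue_sequence_def)
  define P where "P \<mu> v \<longleftrightarrow> (\<forall>k\<in>{k. lam k = \<mu>}. v k \<in> eigenspace C \<mu>) \<and>
    (\<forall>j\<in>{k. lam k = \<mu>}. \<forall>k\<in>{k. lam k = \<mu>}. L2_scalar unit_leb (v j) (v k) = (if j = k then 1 else 0)) \<and>
    (\<forall>g\<in>eigenspace C \<mu>. (\<forall>k\<in>{k. lam k = \<mu>}. L2_scalar unit_leb g (v k) = 0) \<longrightarrow> L2_scalar unit_leb g g = 0)"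
    for \<mu> v
  \<comment> \<open>The choice is made per eigenvalue, not per index, so that all
    \<open>\<phi> k\<close> with equal \<open>lam k\<close> come from one and the same
    basis.\<close>
  have "\<forall>\<mu>. \<exists>v. 0 < \<mu> \<longrightarrow> P \<mu> v"
    unfolding P_def using eigenspace_orthonormal_basis[OF dim fin] by blast
  then obtain v where v: "\<And>\<mu>. 0 < \<mu> \<Longrightarrow> P \<mu> (v \<mu>)"
    by metis
  have v1: "v (lam k) k \<in> eigenspace C (lam k)" if "0 < lam k" for k
    using v[OF that] by (simp add: P_def)
  have v2: "L2_scalar unit_leb (v (lam k) j) (v (lam k) k) = (if j = k then 1 else 0)"
    if "0 < lam k" "lam j = lam k" for j k
    using v[OF that(1)] that(2) by (simp add: P_def)
  have v3: "L2_scalar unit_leb g g = 0"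
    if "0 < \<mu>" "g \<in> eigenspace C \<mu>" "\<And>k. lam k = \<mu> \<Longrightarrow> L2_scalar unit_leb g (v \<mu> k) = 0" for g \<mu>
    using v[OF that(1)] that(2,3) by (auto simp: P_def)
  define \<phi> where "\<phi> k = (if 0 < lam k then v (lam k) k else (\<lambda>x. 0))" for k
  have nonneg: "0 \<le> lam k" for k using ev by (simp add: eigenvalue_sequence_def)
  have phi: "\<phi> k \<in> eigenspace C (lam k)" for k
  proof (cases "0 < lam k")
    case False
    then have "lam k = 0" using nonneg[of k] by simp
    then show ?thesis by (simp add: \<phi>_def eigenspace_def L2_space_zero)
  qed (simp add: \<phi>_def v1)
  have "eigensystem C lam \<phi>"
  proof unfold_locales
    show "decseq lam" using ev by (simp add: eigenvalue_sequence_def)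
    show "0 \<le> lam k" "\<phi> k \<in> eigenspace C (lam k)" for k by (fact nonneg phi)+
    show "L2_scalar unit_leb (\<phi> j) (\<phi> k) = (if j = k \<and> 0 < lam k then 1 else 0)" for j k
    proof (cases "lam j = lam k")
      case True
      then show ?thesis using v2[of k j] by (auto simp: \<phi>_def)
    next
      case False
      then show ?thesis using eigenspace_orthogonal[OF phi phi False] by auto
    qed
    show "L2_scalar unit_leb g g = 0"
      if "0 < \<mu>" "g \<in> eigenspace C \<mu>" "\<And>k. lam k = \<mu> \<Longrightarrow> L2_scalar unit_leb g (\<phi> k) = 0" for \<mu> g
    proof (rule v3[OF that(1,2)])
      fix k assume "lam k = \<mu>"
      then show "L2_scalar unit_leb g (v \<mu> k) = 0" using that(1) that(3)[of k] by (simp add: \<phi>_def)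
    qed
  qed
  then show ?thesis by blast
qed

section \<open>Variational bounds, decay of the eigenvalues and the trace\<close>

context eigensystem
begin

lemma phi_L2: "\<phi> k \<in> L2_space unit_leb"
  using phi_eigenspace by (rule eigenspace_L2)

lemma phi_orthonormal_or_null: "orthonormal_or_null unit_leb \<phi> A"
  by (auto simp: orthonormal_or_null_def phi_L2 phi_orthonormal)

lemma kform_phi: "kform (\<phi> k) = lam k"
  using eigenspace_scalar[OF phi_eigenspace phi_L2, of k k] lam_nonneg[of k]
  by (auto simp: kform_def phi_orthonormal)

text \<open>Let \<mu> be the supremum of the form over the unit ball of the complement. If positive,
  it is an eigenvalue with an eigenfunction orthogonal to the first m of the
  \<open>\<phi> k\<close>; completeness inside that eigenspace yields k \<ge> m with
  \<open>lam k = \<mu>\<close>, whence \<mu> \<le> \<open>lam m\<close>.\<close>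

lemma kform_le_orthogonal:
  assumes f: "f \<in> L2_space unit_leb" and orth: "\<And>k. k < m \<Longrightarrow> L2_scalar unit_leb f (\<phi> k) = 0"
  shows "kform f \<le> lam m * L2_scalar unit_leb f f"
proof -
  let ?ip = "L2_scalar unit_leb"
  define H where "H = {f \<in> L2_space unit_leb. \<forall>k\<in>{..<m}. ?ip f (\<phi> k) = 0}"
  \<comment> \<open>The ball and not the sphere: it always contains 0, so the supremum exists and is
    nonnegative even if the complement consists of null functions.\<close>
  define S where "S = kform ` {f \<in> H. ?ip f f \<le> 1}"
  define \<mu> where "\<mu> = Sup S"
  obtain B where B: "B > 0" "\<And>f. f \<in> L2_space unit_leb \<Longrightarrow> \<bar>kform f\<bar> \<le> B * ?ip f f"
    using abs_kform_le by metis
  have "y \<le> B" if "y \<in> S" for y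
  proof -
    obtain h where h: "h \<in> L2_space unit_leb" "?ip h h \<le> 1" "y = kform h"
      using \<open>y \<in> S\<close> by (auto simp: S_def H_def)
    have "B * ?ip h h \<le> B * 1" using h(2) B(1) by (intro mult_left_mono) auto
    then show ?thesis using B(2)[OF h(1)] h(3) by linarith
  qed
  then have bdd: "bdd_above S" by (rule bdd_aboveI)
  have kz: "kform (\<lambda>x. 0) = 0" by (simp add: kform_def)
  then have "0 \<in> S" unfolding S_def H_def
    by (intro image_eqI[of _ _ "\<lambda>x. 0"]) (auto simp: L2_space_zero)
  then have mu0: "0 \<le> \<mu>" unfolding \<mu>_def using bdd by (rule cSup_upper)
  have upper: "kform h \<le> \<mu> * ?ip h h" if "h \<in> H" for h
  proof (cases "?ip h h = 0")
    case True
    then show ?thesis using that B(2)[of h] by (simp add: H_def)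
  next
    case False
    define c where "c = 1 / sqrt (?ip h h)"
    have pos: "0 < ?ip h h" using False L2_scalar_self_nonneg[of unit_leb h] by linarith
    have c2: "c * c = 1 / ?ip h h" using pos by (simp add: c_def)
    have hL: "h \<in> L2_space unit_leb" using that by (simp add: H_def)
    have "kform (\<lambda>x. c * h x) \<in> S"
      unfolding S_def
    proof (rule imageI, intro CollectI conjI)
      show "(\<lambda>x. c * h x) \<in> H" using that by (simp add: H_def L2_space_cmult L2_scalar_cmult_left)
      have "?ip (\<lambda>x. c * h x) (\<lambda>x. c * h x) = (c * c) * ?ip h h"
        by (simp add: L2_scalar_cmult_left L2_scalar_cmult_right)
      also have "\<dots> = 1" using pos by (simp add: c2)
      finally show "?ip (\<lambda>x. c * h x) (\<lambda>x. c * h x) \<le> 1" by simp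
    qed
    then have "kform (\<lambda>x. c * h x) \<le> \<mu>" unfolding \<mu>_def using bdd by (rule cSup_upper)
    moreover have "kform (\<lambda>x. c * h x) = (c * c) * kform h"
    proof -
      have "kform (\<lambda>x. c * h x) = ?ip (\<lambda>t. c * kop h t) (\<lambda>x. c * h x)"
        unfolding kform_def by (intro L2_scalar_cong) (auto simp: kop_cmult)
      then show ?thesis by (simp add: kform_def L2_scalar_cmult_left L2_scalar_cmult_right)
    qed
    ultimately show ?thesis using pos by (simp add: c2 field_simps)
  qed
  have fH: "f \<in> H" using assms by (simp add: H_def)
  show ?thesis
  proof (cases "\<mu> = 0")
    case True
    then have "kform f \<le> 0" using upper[OF fH] by simp
    also have "0 \<le> lam m * ?ip f f" by (simp add: lam_nonneg L2_scalar_self_nonneg)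
    finally show ?thesis .
  next
    case False
    then have mu: "0 < \<mu>" using mu0 by simp
    have "\<exists>g\<in>eigenspace C \<mu>. (\<forall>k\<in>{..<m}. ?ip g (\<phi> k) = 0) \<and> ?ip g g \<noteq> 0"
    proof (rule extremal_eigenfunction[OF phi_eigenspace mu])
      fix h assume "h \<in> L2_space unit_leb" "\<And>k. k \<in> {..<m} \<Longrightarrow> ?ip h (\<phi> k) = 0"
      then show "kform h \<le> \<mu> * ?ip h h" by (intro upper) (auto simp: H_def)
    next
      fix e :: real assume "0 < e"
      then have "\<mu> - e < Sup S" by (simp add: \<mu>_def)
      then obtain y where "y \<in> S" "\<mu> - e < y"
        using less_cSup_iff[OF _ bdd] \<open>0 \<in> S\<close> by blast
      then show "\<exists>f\<in>L2_space unit_leb. (\<forall>k\<in>{..<m}. ?ip f (\<phi> k) = 0) \<and> ?ip f f \<le> 1 \<and> \<mu> - e < kform f"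
        by (auto simp: S_def H_def)
    qed
    then obtain g where g: "g \<in> eigenspace C \<mu>" "\<And>k. k < m \<Longrightarrow> ?ip g (\<phi> k) = 0" "?ip g g \<noteq> 0"
      by auto
    then obtain k where k: "lam k = \<mu>" "?ip g (\<phi> k) \<noteq> 0" using phi_total[OF mu g(1)] by blast
    then have "m \<le> k" using g(2) by (meson leI)
    then have "\<mu> \<le> lam m" using k(1) lam_dec by (auto simp: decseq_def)
    then have "\<mu> * ?ip f f \<le> lam m * ?ip f f"
      by (intro mult_right_mono) (auto simp: L2_scalar_self_nonneg)
    then show ?thesis using upper[OF fH] by linarith
  qed
qed

text \<open>f splits into its projection p on the first m eigenfunctions and the residual r; the
  cross terms vanish since \<open>kop p\<close> is orthogonal to r. Pythagoras for r then moves
  \<open>lam m\<close> into the differences \<open>lam k - lam m\<close>. These are nonnegative, so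
  Bessel's inequality can be used on each of them when f runs through an orthonormal family.\<close>

lemma kform_le:
  assumes f: "f \<in> L2_space unit_leb"
  shows "kform f \<le> (\<Sum>k<m. (lam k - lam m) * (L2_scalar unit_leb f (\<phi> k))\<^sup>2)
    + lam m * L2_scalar unit_leb f f"
proof -
  let ?ip = "L2_scalar unit_leb"
  define r where "r = (\<lambda>x. f x - (\<Sum>k<m. ?ip f (\<phi> k) * \<phi> k x))"
  note res = orthonormal_or_null_residual[OF phi_orthonormal_or_null[of "{..<m}"] finite_lessThan f, folded r_def]
  define p where "p = (\<lambda>x. \<Sum>k<m. ?ip f (\<phi> k) * \<phi> k x)"
  have pL: "p \<in> L2_space unit_leb" unfolding p_def by (intro L2_space_sum L2_space_cmult phi_L2)
  have pE: "?ip (kop p) h = (\<Sum>k<m. ?ip f (\<phi> k) * (lam k * ?ip (\<phi> k) h))" if "h \<in> L2_space unit_leb" for h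
  proof -
    have "?ip (kop p) h = ?ip p (kop h)" by (rule kop_self_adjoint[OF pL that])
    also have "\<dots> = (\<Sum>k<m. ?ip f (\<phi> k) * ?ip (\<phi> k) (kop h))"
      unfolding p_def by (intro L2_scalar_comb_left phi_L2 kop_L2 that)
    also have "\<dots> = (\<Sum>k<m. ?ip f (\<phi> k) * (lam k * ?ip (\<phi> k) h))"
      using kop_self_adjoint[OF phi_L2 that] eigenspace_scalar[OF phi_eigenspace that] by simp
    finally show ?thesis .
  qed
  have prz: "?ip (kop p) r = 0" using pE[OF res(1)] res(2) by (simp add: L2_scalar_commute[of _ "\<phi> _" r])
  have ppf: "?ip (kop p) f = (\<Sum>k<m. lam k * (?ip f (\<phi> k))\<^sup>2)"
    unfolding pE[OF f] by (intro sum.cong refl) (simp add: L2_scalar_commute power2_eq_square)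
  have "kform f = ?ip (kop f) f" by (simp add: kform_def)
  also have "\<dots> = ?ip (kop r) r + ?ip (kop p) f"
  proof -
    have fp: "f = (\<lambda>x. r x + p x)" by (auto simp: r_def p_def)
    have "?ip (kop f) f = ?ip f (kop f)" by (simp add: L2_scalar_commute)
    also have "\<dots> = ?ip r (kop f) + ?ip p (kop f)"
      by (subst fp) (use res(1) pL f in \<open>simp add: L2_scalar_add_left kop_L2\<close>)
    also have "?ip p (kop f) = ?ip (kop p) f" using kop_self_adjoint[OF pL f] by simp
    also have "?ip r (kop f) = ?ip (kop r) f" using kop_self_adjoint[OF res(1) f] by simp
    also have "?ip (kop r) f = ?ip (kop r) r + ?ip (kop r) p"
      by (subst fp) (use res(1) pL f in \<open>simp add: L2_scalar_add_right kop_L2\<close>)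
    also have "?ip (kop r) p = 0"
      using kop_self_adjoint[OF res(1) pL] prz by (simp add: L2_scalar_commute)
    finally show ?thesis by simp
  qed
  also have "?ip (kop r) r \<le> lam m * ?ip r r"
    using kform_le_orthogonal[OF res(1), of m] res(2) by (simp add: kform_def)
  also have "lam m * ?ip r r + ?ip (kop p) f
      = (\<Sum>k<m. (lam k - lam m) * (?ip f (\<phi> k))\<^sup>2) + lam m * ?ip f f"
    unfolding ppf res(4)
    by (simp add: algebra_simps sum_distrib_left sum_subtractf)
  finally show ?thesis by simp
qed

text \<open>\<open>kop (\<phi> k) t\<close> is the coefficient of the section \<open>C t\<close>
  along \<open>\<phi> k\<close>, so Bessel's inequality bounds the sum of the squared eigenvalues by
  a square bound for the kernel.\<close>

lemma lam_tendsto_0: "lam \<longlonglongrightarrow> 0"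
proof -
  let ?ip = "L2_scalar unit_leb"
  obtain B where B: "B > 0" "\<And>f t. f \<in> L2_space unit_leb \<Longrightarrow> t \<in> {0..1} \<Longrightarrow> \<bar>kop f t\<bar> \<le> B * sqrt (?ip f f)"
    using kop_bounded by metis
  obtain D where D: "D > 0" "\<forall>t\<in>{0..1}. \<forall>s\<in>{0..1}. \<bar>C t s\<bar> \<le> D"
    using kernel_bounded by auto
  have sum_le: "(\<Sum>k<m. (lam k)\<^sup>2) \<le> D\<^sup>2" for m
  proof -
    have kk: "(lam k)\<^sup>2 = ?ip (kop (\<phi> k)) (kop (\<phi> k))" for k
    proof -
      have "?ip (kop (\<phi> k)) (kop (\<phi> k)) = lam k * ?ip (kop (\<phi> k)) (\<phi> k)"
        using eigenspace_scalar[OF phi_eigenspace kop_L2[OF phi_L2], of k k] by (simp add: L2_scalar_commute)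
      then show ?thesis using kform_phi[of k] by (simp add: kform_def power2_eq_square)
    qed
    have "(\<Sum>k<m. (lam k)\<^sup>2) = (LINT t|unit_leb. (\<Sum>k<m. kop (\<phi> k) t * kop (\<phi> k) t))"
      unfolding kk L2_scalar_def
      by (intro Bochner_Integration.integral_sum[symmetric] L2_space_integrable_mult kop_L2 phi_L2)
    also have "\<dots> \<le> (LINT t|unit_leb. D\<^sup>2)"
    proof (rule integral_mono)
      show "integrable unit_leb (\<lambda>t. \<Sum>k<m. kop (\<phi> k) t * kop (\<phi> k) t)"
        by (intro Bochner_Integration.integrable_sum L2_space_integrable_mult kop_L2 phi_L2)
      fix t assume "t \<in> space unit_leb"
      then have t: "t \<in> {0..1}" by (simp add: space_unit_leb)
      have "(\<Sum>k<m. kop (\<phi> k) t * kop (\<phi> k) t) \<le> ?ip (C t) (C t)"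
        using Bessel_inequality[OF phi_orthonormal_or_null finite_lessThan kernel_section_L2[OF t], of m]
        by (simp add: kop_eq_scalar power2_eq_square)
      also have "\<dots> \<le> D\<^sup>2" using D(2) t by (intro unit_scalar_self_le kernel_section_L2) auto
      finally show "(\<Sum>k<m. kop (\<phi> k) t * kop (\<phi> k) t) \<le> D\<^sup>2" .
    qed simp
    also have "\<dots> = D\<^sup>2" using unit.prob_space by (simp add: space_unit_leb)
    finally show ?thesis .
  qed
  have "summable (\<lambda>k. (lam k)\<^sup>2)"
    by (rule summableI_nonneg_bounded[OF _ sum_le]) simp
  then have "(\<lambda>k. sqrt ((lam k)\<^sup>2)) \<longlonglongrightarrow> sqrt 0"
    by (intro tendsto_real_sqrt summable_LIMSEQ_zero)
  then show ?thesis using lam_nonneg by simp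
qed

text \<open>For t and s in the same cell \<open>C t s\<close> differs from the diagonal value
  \<open>C t t\<close> by less than \<eta>, and the step function has unit norm; its form therefore
  nearly reproduces the integral of the diagonal over that cell.\<close>

lemma kform_step_ge:
  fixes N j :: nat
  assumes N: "0 < N" and "j < N" and "0 < \<eta>"
    and close: "\<And>t s. t \<in> {0..1} \<Longrightarrow> s \<in> {0..1} \<Longrightarrow> \<bar>t - s\<bar> < 1 / N \<Longrightarrow> \<bar>C t t - C t s\<bar> < \<eta>"
  defines "I \<equiv> unit_cell N j"
  shows "(LINT t|unit_leb. (C t t - \<eta>) * indicator I t) \<le> kform (\<lambda>s. sqrt N * indicator I s)"
proof -
  let ?e = "\<lambda>s. sqrt N * indicator I s :: real"
  have I01: "I \<subseteq> {0..1}" and Iset: "I \<in> sets unit_leb" and Imeas: "measure unit_leb I = 1 / N"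
    using unit_cell_subset unit_cell_sets measure_unit_cell \<open>j < N\<close> by (auto simp: I_def)
  have eL: "?e \<in> L2_space unit_leb"
    using Iset by (intro L2_space_cmult unit.L2_space_bounded[of _ 1]) auto
  have IL: "(indicator I :: real \<Rightarrow> real) \<in> L2_space unit_leb"
    using unit_cell_indicator_L2 \<open>j < N\<close> by (simp add: I_def)
  have kop_ge: "(C t t - \<eta>) * (sqrt N / N) \<le> kop ?e t" if "t \<in> I" for t
  proof -
    have t01: "t \<in> {0..1}" using that I01 by auto
    \<comment> \<open>\<open>sqrt N / N\<close> is the integral of \<open>?e\<close>: height
      \<open>sqrt N\<close> on a cell of length 1 / N.\<close>
    have "(C t t - \<eta>) * (sqrt N / N) = (LINT s|unit_leb. (C t t - \<eta>) * (sqrt N * indicator I s))"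
      using Iset Imeas I01 by (simp add: space_unit_leb Int_absorb2)
    also have "\<dots> \<le> kop ?e t"
      unfolding kop_def
    proof (rule integral_mono)
      show "integrable unit_leb (\<lambda>s. (C t t - \<eta>) * (sqrt N * indicator I s))"
        using unit.L2_space_integrable[OF eL] by simp
      show "integrable unit_leb (\<lambda>s. C t s * ?e s)"
        by (rule L2_space_integrable_mult[OF kernel_section_L2[OF t01] eL])
      fix s assume "s \<in> space unit_leb"
      show "(C t t - \<eta>) * (sqrt N * indicator I s) \<le> C t s * ?e s"
      proof (cases "s \<in> I")
        case True
        have "\<bar>t - s\<bar> < 1 / N"
          using True that N by (auto simp: I_def unit_cell_def abs_less_iff add_divide_distrib)
        then have "\<bar>C t t - C t s\<bar> < \<eta>" using close[of t s] t01 True I01 by auto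
        then show ?thesis by (intro mult_right_mono) auto
      qed simp
    qed
    finally show ?thesis .
  qed
  show ?thesis
    unfolding kform_def L2_scalar_def
  proof (rule integral_mono)
    show "integrable unit_leb (\<lambda>t. (C t t - \<eta>) * indicator I t)"
      by (intro L2_space_integrable_mult L2_space_diff kernel_diag_L2 unit.L2_space_const IL)
    show "integrable unit_leb (\<lambda>t. kop ?e t * ?e t)"
      by (intro L2_space_integrable_mult kop_L2 eL)
    fix t assume "t \<in> space unit_leb"
    show "(C t t - \<eta>) * indicator I t \<le> kop ?e t * ?e t"
    proof (cases "t \<in> I")
      case True
      have "(C t t - \<eta>) * (sqrt N / N) * sqrt N \<le> kop ?e t * sqrt N"
        using kop_ge[OF True] by (intro mult_right_mono) auto
      moreover have "sqrt N / N * sqrt N = 1" using N by simp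
      ultimately have "C t t - \<eta> \<le> kop ?e t * sqrt N"
        by (metis mult.assoc mult.right_neutral)
      then show ?thesis using True by simp
    qed simp
  qed
qed

text \<open>The order of choices matters: uniform continuity gives N, for which the N step functions
  capture the trace up to \<eta> / 2; only then is m taken so large that the N remainders
  \<open>lam m\<close> add up to less than \<eta> / 2.\<close>

lemma trace_le_eigenvalue_sum:
  assumes "0 < \<eta>"
  shows "\<exists>m. (LINT t|unit_leb. C t t) - \<eta> \<le> (\<Sum>k<m. lam k)"
proof -
  let ?ip = "L2_scalar unit_leb"
  obtain d where d: "d > 0" "\<And>t s. t \<in> {0..1} \<Longrightarrow> s \<in> {0..1} \<Longrightarrow> \<bar>t - s\<bar> < d
      \<Longrightarrow> \<bar>C t t - C t s\<bar> < \<eta> / 2"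
    using kernel_uniformly_continuous[of "\<eta> / 2"] assms
    by (metis abs_zero cancel_comm_monoid_add_class.diff_cancel half_gt_zero)
  obtain N :: nat where N: "0 < N" "1 / N < d"
    using d(1) by (metis nat_approx_posE zero_less_Suc)
  define I where "I j = unit_cell N j" for j
  define e where "e j = (\<lambda>s. sqrt N * indicator (I j) s :: real)" for j
  have Iset: "I j \<in> sets unit_leb" and Imeas: "measure unit_leb (I j) = 1 / N"
    and IL: "(indicator (I j) :: real \<Rightarrow> real) \<in> L2_space unit_leb" if "j < N" for j
    using unit_cell_sets[OF that] measure_unit_cell[OF that] unit_cell_indicator_L2[OF that]
    by (simp_all add: I_def)
  have eL: "e j \<in> L2_space unit_leb" if "j < N" for j
    unfolding e_def by (intro L2_space_cmult IL that)
  have ee: "?ip (e i) (e j) = (if i = j then 1 else 0)" if "i < N" "j < N" for i j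
  proof (cases "i = j")
    case True
    have "?ip (e i) (e i) = (LINT s|unit_leb. real N * indicator (I i) s)"
      unfolding L2_scalar_def e_def
      by (intro Bochner_Integration.integral_cong) (auto split: split_indicator)
    also have "\<dots> = real N * measure unit_leb (I i)"
      using Iset[OF that(1)] sets.sets_into_space[OF Iset[OF that(1)]] by (simp add: Int_absorb2)
    also have "\<dots> = 1" using Imeas[OF that(1)] N by simp
    finally show ?thesis using True by simp
  next
    case False
    then have "I i \<inter> I j = {}" using unit_cell_disjoint by (simp add: I_def)
    then have "(\<lambda>s. e i s * e j s) = (\<lambda>s. 0)"
      by (auto simp: e_def indicator_def fun_eq_iff)
    then show ?thesis using False by (simp add: L2_scalar_def)
  qed
  have eon: "orthonormal_or_null unit_leb e {..<N}"
    using eL ee by (auto simp: orthonormal_or_null_def)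
  have cover: "(\<Sum>j<N. indicator (I j) t) = (1::real)" if "t \<in> {0..1}" "t \<noteq> 0" for t
    using unit_cell_cover[OF that N(1)] by (simp add: I_def)
  have AE0: "AE t in unit_leb. t \<noteq> (0::real)"
    by (subst AE_restrict_space_iff) (auto intro: eventually_mono[OF AE_lborel_singleton[of 0]])
  have low: "(LINT t|unit_leb. C t t) - \<eta> / 2 \<le> (\<Sum>j<N. kform (e j))"
  proof -
    have int: "integrable unit_leb (\<lambda>t. (C t t - \<eta> / 2) * indicator (I j) t)" if "j < N" for j
      using that by (intro L2_space_integrable_mult L2_space_diff kernel_diag_L2 unit.L2_space_const IL)
    have "(LINT t|unit_leb. C t t) - \<eta> / 2 = (LINT t|unit_leb. C t t - \<eta> / 2)"
      using unit.L2_space_integrable[OF kernel_diag_L2] unit.prob_space by (simp add: space_unit_leb)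
    also have "\<dots> = (LINT t|unit_leb. (\<Sum>j<N. (C t t - \<eta> / 2) * indicator (I j) t))"
    proof (rule integral_cong_AE)
      show "(\<lambda>t. C t t - \<eta> / 2) \<in> borel_measurable unit_leb"
        by (intro L2_space_measurable L2_space_diff kernel_diag_L2 unit.L2_space_const)
      show "(\<lambda>t. \<Sum>j<N. (C t t - \<eta> / 2) * indicator (I j) t) \<in> borel_measurable unit_leb"
        using int by (intro borel_measurable_sum borel_measurable_integrable) auto
      show "AE t in unit_leb. C t t - \<eta> / 2 = (\<Sum>j<N. (C t t - \<eta> / 2) * indicator (I j) t)"
        using AE0 AE_space
        by eventually_elim (simp add: sum_distrib_left[symmetric] cover space_unit_leb)
    qed
    also have "\<dots> = (\<Sum>j<N. LINT t|unit_leb. (C t t - \<eta> / 2) * indicator (I j) t)"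
      using int by (intro Bochner_Integration.integral_sum) auto
    also have "\<dots> \<le> (\<Sum>j<N. kform (e j))"
      unfolding e_def I_def using N d assms
      by (intro sum_mono kform_step_ge) auto
    finally show ?thesis .
  qed
  have "(\<lambda>m. lam m * real N) \<longlonglongrightarrow> 0 * real N"
    by (intro tendsto_intros lam_tendsto_0)
  then have "eventually (\<lambda>m. lam m * real N < \<eta> / 2) sequentially"
    using assms by (intro order_tendstoD) auto
  then obtain m where m: "lam m * real N < \<eta> / 2"
    by (auto simp: eventually_sequentially)
  have "(\<Sum>j<N. kform (e j))
      \<le> (\<Sum>j<N. (\<Sum>k<m. (lam k - lam m) * (?ip (e j) (\<phi> k))\<^sup>2) + lam m * ?ip (e j) (e j))"
    using eL by (intro sum_mono kform_le) auto
  also have "\<dots> = (\<Sum>k<m. (lam k - lam m) * (\<Sum>j<N. (?ip (\<phi> k) (e j))\<^sup>2)) + lam m * N"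
  proof -
    have "(\<Sum>j<N. \<Sum>k<m. (lam k - lam m) * (?ip (e j) (\<phi> k))\<^sup>2)
        = (\<Sum>k<m. (lam k - lam m) * (\<Sum>j<N. (?ip (e j) (\<phi> k))\<^sup>2))"
      by (subst sum.swap) (simp add: sum_distrib_left)
    moreover have "?ip (e j) (\<phi> k) = ?ip (\<phi> k) (e j)" for j k by (rule L2_scalar_commute)
    moreover have "(\<Sum>j<N. lam m * ?ip (e j) (e j)) = lam m * N" using ee by simp
    ultimately show ?thesis by (simp add: sum.distrib)
  qed
  also have "\<dots> \<le> (\<Sum>k<m. lam k) + lam m * N"
  proof -
    \<comment> \<open>Bessel's inequality with the roles exchanged: here \<open>\<phi> k\<close> is
      expanded along the step functions.\<close>
    have "(lam k - lam m) * (\<Sum>j<N. (?ip (\<phi> k) (e j))\<^sup>2) \<le> lam k" if "k < m" for k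
    proof -
      have "(\<Sum>j<N. (?ip (\<phi> k) (e j))\<^sup>2) \<le> 1"
        using Bessel_inequality[OF eon finite_lessThan phi_L2[of k]] phi_orthonormal[of k k]
        by (auto split: if_splits)
      moreover have "0 \<le> lam k - lam m" using lam_dec that by (simp add: decseq_def)
      ultimately have "(lam k - lam m) * (\<Sum>j<N. (?ip (\<phi> k) (e j))\<^sup>2) \<le> (lam k - lam m) * 1"
        by (intro mult_left_mono)
      then show ?thesis using lam_nonneg[of m] by simp
    qed
    then show ?thesis by (intro add_right_mono sum_mono) auto
  qed
  finally have "(LINT t|unit_leb. C t t) - \<eta> \<le> (\<Sum>k<m. lam k)" using low m by linarith
  then show ?thesis by blast
qed

end

section \<open>Second order processes\<close>

locale uncorrelated_processes = prob_space M for M :: "'a measure" +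
  fixes X :: "nat \<Rightarrow> real \<Rightarrow> 'a \<Rightarrow> real" and K :: "real \<Rightarrow> real \<Rightarrow> real"
  assumes joint_meas: "\<And>j. (\<lambda>(t, \<omega>). X j t \<omega>) \<in> borel_measurable (unit_leb \<Otimes>\<^sub>M M)"
    and paths: "\<And>j \<omega>. \<omega> \<in> space M \<Longrightarrow> (\<lambda>t. X j t \<omega>) \<in> L2_space unit_leb"
    and second_moment: "\<And>j t. t \<in> {0..1} \<Longrightarrow> integrable M (\<lambda>\<omega>. (X j t \<omega>)\<^sup>2)"
    and covariance: "\<And>j t s. t \<in> {0..1} \<Longrightarrow> s \<in> {0..1} \<Longrightarrow> (LINT \<omega>|M. X j t \<omega> * X j s \<omega>) = K t s"
    and cov_cont: "continuous_on ({0..1} \<times> {0..1}) (\<lambda>(t, s). K t s)"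
    and uncorrelated: "\<And>j k t s. j \<noteq> k \<Longrightarrow> t \<in> {0..1} \<Longrightarrow> s \<in> {0..1} \<Longrightarrow>
      (LINT \<omega>|M. X j t \<omega> * X k s \<omega>) = 0"
begin

sublocale pair: pair_sigma_finite unit_leb M
  by standard

sublocale K: continuous_kernel K
proof
  show "continuous_on ({0..1} \<times> {0..1}) (\<lambda>(t, s). K t s)" by (rule cov_cont)
  fix t s :: real assume "t \<in> {0..1}" "s \<in> {0..1}"
  then show "K t s = K s t"
    using covariance[of t s 0] covariance[of s t 0] by (simp add: mult.commute)
qed

lemma X_measurable: "t \<in> {0..1} \<Longrightarrow> X j t \<in> borel_measurable M"
  using measurable_compose[OF measurable_Pair1' joint_meas, of t j] by (simp add: space_unit_leb)

lemma X_L2: "t \<in> {0..1} \<Longrightarrow> X j t \<in> L2_space M"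
  using X_measurable[of t j] second_moment[of t j] by (simp add: L2_space_def)

text \<open>The second moments \<open>K t t\<close> are integrable in t, so the process is itself a
  square integrable kernel, and the kernel lemmas may exchange expectations with time
  integrals.\<close>

lemma X_joint_L2: "(\<lambda>(t, \<omega>). X j t \<omega>) \<in> L2_space (unit_leb \<Otimes>\<^sub>M M)"
proof -
  have "integrable (unit_leb \<Otimes>\<^sub>M M) (\<lambda>(t, \<omega>). (X j t \<omega>)\<^sup>2)"
  proof (rule pair.Fubini_integrable)
    show "(\<lambda>(t, \<omega>). (X j t \<omega>)\<^sup>2) \<in> borel_measurable (unit_leb \<Otimes>\<^sub>M M)"
      using borel_measurable_power[OF joint_meas[of j], of 2] by (simp add: split_beta')
    have "integrable unit_leb (\<lambda>t. K t t)"
      by (rule unit.L2_space_integrable[OF K.kernel_diag_L2])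
    also have "?this \<longleftrightarrow> integrable unit_leb (\<lambda>t. LINT \<omega>|M. norm (case (t, \<omega>) of (t, \<omega>) \<Rightarrow> (X j t \<omega>)\<^sup>2))"
      using covariance[of _ _ j]
      by (intro Bochner_Integration.integrable_cong) (auto simp: space_unit_leb power2_eq_square)
    finally show "integrable unit_leb (\<lambda>t. LINT \<omega>|M. norm (case (t, \<omega>) of (t, \<omega>) \<Rightarrow> (X j t \<omega>)\<^sup>2))" .
    show "AE t in unit_leb. integrable M (\<lambda>\<omega>. case (t, \<omega>) of (t, \<omega>) \<Rightarrow> (X j t \<omega>)\<^sup>2)"
      using AE_space by eventually_elim (use second_moment in \<open>auto simp: space_unit_leb\<close>)
  qed
  then show ?thesis using joint_meas by (simp add: L2_space_def split_beta')
qed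

section \<open>Second moments of the coefficients of the processes\<close>

definition coef :: "nat \<Rightarrow> (real \<Rightarrow> real) \<Rightarrow> 'a \<Rightarrow> real" where
  "coef j f \<omega> = L2_scalar unit_leb (\<lambda>t. X j t \<omega>) f"

lemma coef_L2: "f \<in> L2_space unit_leb \<Longrightarrow> coef j f \<in> L2_space M"
  unfolding coef_def L2_scalar_def by (rule pair.L2_kernel_integral(1)[OF X_joint_L2])

lemma path_mean_eq_coef: "path_mean (X j) \<omega> = coef j (\<lambda>t. 1) \<omega>"
  by (simp add: path_mean_def coef_def L2_scalar_def)

lemma scalar_X_coef:
  assumes f: "f \<in> L2_space unit_leb" and t: "t \<in> {0..1}"
  shows "L2_scalar M (X j t) (coef k f) = (if j = k then K.kop f t else 0)"
proof -
  have "L2_scalar M (X j t) (coef k f) = (LINT \<omega>|M. (LINT s|unit_leb. X k s \<omega> * f s) * X j t \<omega>)"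
    by (simp add: L2_scalar_def coef_def mult.commute)
  also have "\<dots> = (LINT s|unit_leb. f s * (LINT \<omega>|M. X k s \<omega> * X j t \<omega>))"
    by (rule pair.L2_kernel_Fubini[OF X_joint_L2 f X_L2[OF t]])
  also have "\<dots> = (LINT s|unit_leb. (if j = k then K t s else 0) * f s)"
  proof (rule Bochner_Integration.integral_cong[OF refl])
    fix s assume "s \<in> space unit_leb"
    then show "f s * (LINT \<omega>|M. X k s \<omega> * X j t \<omega>) = (if j = k then K t s else 0) * f s"
      using t covariance[of s t k] uncorrelated[of k j s t] K.sym[of s t] by (simp add: space_unit_leb)
  qed
  finally show ?thesis by (simp add: K.kop_def)
qed

text \<open>For j = k and f = g this is the second moment of a coefficient, namely
  \<open>K.kform f\<close>; for f = g = 1 it is that of the path mean.\<close>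

lemma scalar_coef_coef:
  assumes f: "f \<in> L2_space unit_leb" and g: "g \<in> L2_space unit_leb"
  shows "L2_scalar M (coef j f) (coef k g) = (if j = k then L2_scalar unit_leb (K.kop g) f else 0)"
proof -
  have "L2_scalar M (coef j f) (coef k g)
      = (LINT \<omega>|M. (LINT t|unit_leb. X j t \<omega> * f t) * coef k g \<omega>)"
    by (simp add: L2_scalar_def coef_def)
  also have "\<dots> = (LINT t|unit_leb. f t * L2_scalar M (X j t) (coef k g))"
    unfolding L2_scalar_def by (rule pair.L2_kernel_Fubini[OF X_joint_L2 f coef_L2[OF g]])
  also have "\<dots> = (LINT t|unit_leb. (if j = k then K.kop g t else 0) * f t)"
    using scalar_X_coef[OF g] by (intro Bochner_Integration.integral_cong) (auto simp: space_unit_leb)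
  finally show ?thesis by (auto simp: L2_scalar_def)
qed

lemma integral_path_norm:
  shows "integrable M (\<lambda>\<omega>. L2_scalar unit_leb (\<lambda>t. X j t \<omega>) (\<lambda>t. X j t \<omega>))"
    and "(LINT \<omega>|M. L2_scalar unit_leb (\<lambda>t. X j t \<omega>) (\<lambda>t. X j t \<omega>)) = trace_const K"
proof -
  have int: "integrable (unit_leb \<Otimes>\<^sub>M M) (\<lambda>(t, \<omega>). X j t \<omega> * X j t \<omega>)"
    using L2_space_integrable_sq[OF X_joint_L2[of j]] by (simp add: power2_eq_square split_beta')
  show "integrable M (\<lambda>\<omega>. L2_scalar unit_leb (\<lambda>t. X j t \<omega>) (\<lambda>t. X j t \<omega>))"
    using pair.integrable_snd[OF int] by (simp add: L2_scalar_def)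
  have "(LINT \<omega>|M. L2_scalar unit_leb (\<lambda>t. X j t \<omega>) (\<lambda>t. X j t \<omega>))
      = (LINT t|unit_leb. LINT \<omega>|M. X j t \<omega> * X j t \<omega>)"
    unfolding L2_scalar_def by (rule pair.Fubini_integral[OF int])
  also have "\<dots> = trace_const K"
    unfolding trace_const_def
    by (intro Bochner_Integration.integral_cong) (auto simp: space_unit_leb covariance)
  finally show "(LINT \<omega>|M. L2_scalar unit_leb (\<lambda>t. X j t \<omega>) (\<lambda>t. X j t \<omega>)) = trace_const K" .
qed

section \<open>The centred covariance kernel\<close>

lemma one_L2: "(\<lambda>t. 1) \<in> L2_space unit_leb"
  by (rule unit.L2_space_const)

lemma mean_const_eq: "mean_const K = L2_scalar unit_leb (K.kop (\<lambda>t. 1)) (\<lambda>t. 1)"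
  by (simp add: mean_const_def L2_scalar_def K.kop_def)

text \<open>Expanding the product, the mixed moment of X_j(t) and the path mean is
  \<open>K.kop\<close> of 1 at t, and the second moment of the path mean is
  \<open>mean_const K\<close>. Independence of j and continuity on the unit square become visible in
  this form.\<close>

lemma centred_cov_eq:
  assumes t: "t \<in> {0..1}" and s: "s \<in> {0..1}"
  shows "centred_cov M (X j) t s = K t s - K.kop (\<lambda>t. 1) t - K.kop (\<lambda>t. 1) s + mean_const K"
proof -
  note L = X_L2[OF t] X_L2[OF s] coef_L2[OF one_L2]
  have "centred_cov M (X j) t s
      = L2_scalar M (\<lambda>\<omega>. X j t \<omega> - coef j (\<lambda>t. 1) \<omega>) (\<lambda>\<omega>. X j s \<omega> - coef j (\<lambda>t. 1) \<omega>)"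
    by (simp add: centred_cov_def L2_scalar_def path_mean_eq_coef)
  also have "\<dots> = L2_scalar M (X j t) (X j s) - L2_scalar M (X j t) (coef j (\<lambda>t. 1))
      - L2_scalar M (X j s) (coef j (\<lambda>t. 1)) + L2_scalar M (coef j (\<lambda>t. 1)) (coef j (\<lambda>t. 1))"
    using L by (simp add: L2_scalar_diff_left L2_scalar_diff_right L2_space_diff
        L2_scalar_commute[of M "coef j (\<lambda>t. 1)" "X j s"])
  also have "L2_scalar M (X j t) (X j s) = K t s"
    using covariance[OF t s, of j] by (simp add: L2_scalar_def)
  finally show ?thesis
    using scalar_X_coef[OF one_L2 t, of j j] scalar_X_coef[OF one_L2 s, of j j]
      scalar_coef_coef[OF one_L2 one_L2, of j j] by (simp add: mean_const_eq)
qed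

lemma kop_one_continuous: "continuous_on {0..1} (K.kop (\<lambda>t. 1))"
proof -
  have "\<exists>d>0. \<forall>t'\<in>{0..1}. dist t' t < d \<longrightarrow> dist (K.kop (\<lambda>t. 1) t') (K.kop (\<lambda>t. 1) t) < e"
    if "t \<in> {0..1}" "0 < e" for t e :: real
  proof -
    have "L2_scalar unit_leb (\<lambda>t. 1) (\<lambda>t. 1) \<le> 1"
      using unit_scalar_self_le[OF one_L2, of 1] by simp
    moreover obtain d where "d > 0" and d: "\<forall>f\<in>L2_space unit_leb. L2_scalar unit_leb f f \<le> 1 \<longrightarrow>
        (\<forall>t\<in>{0..1}. \<forall>t'\<in>{0..1}. \<bar>t - t'\<bar> < d \<longrightarrow> \<bar>K.kop f t - K.kop f t'\<bar> \<le> e / 2)"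
      using K.kop_equicontinuous[of "e / 2"] \<open>0 < e\<close> by auto
    ultimately have "\<bar>K.kop (\<lambda>t. 1) t' - K.kop (\<lambda>t. 1) t\<bar> < e" if "t' \<in> {0..1}" "\<bar>t' - t\<bar> < d" for t'
      using d[rule_format, OF one_L2 _ that(1) \<open>t \<in> {0..1}\<close> that(2)] \<open>0 < e\<close> by linarith
    then show ?thesis
      using \<open>d > 0\<close> by (intro exI[of _ d]) (simp add: dist_real_def)
  qed
  then show ?thesis unfolding continuous_on_iff by blast
qed

lemma centred_kernel: "continuous_kernel (centred_cov M (X j))"
proof
  have "continuous_on ({0..1} \<times> {0..1})
      (\<lambda>p. K (fst p) (snd p) - K.kop (\<lambda>t. 1) (fst p) - K.kop (\<lambda>t. 1) (snd p) + mean_const K)"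
    using cov_cont
    by (intro continuous_intros continuous_on_compose2[OF kop_one_continuous])
      (auto simp: split_beta')
  then show "continuous_on ({0..1} \<times> {0..1}) (\<lambda>(t, s). centred_cov M (X j) t s)"
    by (rule continuous_on_eq) (auto simp: centred_cov_eq)
  show "centred_cov M (X j) t s = centred_cov M (X j) s t" if "t \<in> {0..1}" "s \<in> {0..1}" for t s
    by (simp add: centred_cov_def mult.commute)
qed

lemma trace_centred_cov: "(LINT t|unit_leb. centred_cov M (X j) t t) = centred_trace K"
proof -
  have int: "integrable unit_leb (\<lambda>t. K t t)" "integrable unit_leb (K.kop (\<lambda>t. 1))"
    by (intro unit.L2_space_integrable K.kernel_diag_L2 K.kop_L2 one_L2)+
  have "(LINT t|unit_leb. centred_cov M (X j) t t)
      = (LINT t|unit_leb. K t t - 2 * K.kop (\<lambda>t. 1) t + mean_const K)"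
    by (intro Bochner_Integration.integral_cong) (auto simp: space_unit_leb centred_cov_eq)
  also have "\<dots> = trace_const K - 2 * mean_const K + mean_const K"
    using int unit.prob_space
    by (simp add: trace_const_def mean_const_eq L2_scalar_def space_unit_leb)
  finally show ?thesis by (simp add: centred_trace_def)
qed

lemma centred_kop:
  assumes f: "f \<in> L2_space unit_leb" and t: "t \<in> {0..1}"
  shows "continuous_kernel.kop (centred_cov M (X j)) f t
    = K.kop f t - K.kop (\<lambda>t. 1) t * L2_scalar unit_leb (\<lambda>t. 1) f
      - L2_scalar unit_leb (K.kop (\<lambda>t. 1)) f + mean_const K * L2_scalar unit_leb (\<lambda>t. 1) f"
proof -
  interpret C: continuous_kernel "centred_cov M (X j)" by (rule centred_kernel)
  have KL: "K t \<in> L2_space unit_leb" "K.kop (\<lambda>t. 1) \<in> L2_space unit_leb"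
    by (intro K.kernel_section_L2 t K.kop_L2 one_L2)+
  \<comment> \<open>The factors 1 exhibit constants as multiples of the constant function, as the
    linearity rules expect.\<close>
  have "C.kop f t = L2_scalar unit_leb (\<lambda>s. K t s - K.kop (\<lambda>t. 1) t * 1 - K.kop (\<lambda>t. 1) s + mean_const K * 1) f"
    unfolding C.kop_eq_scalar
    by (rule L2_scalar_cong) (use t in \<open>auto simp: space_unit_leb centred_cov_eq\<close>)
  also have "\<dots> = L2_scalar unit_leb (K t) f - K.kop (\<lambda>t. 1) t * L2_scalar unit_leb (\<lambda>t. 1) f
      - L2_scalar unit_leb (K.kop (\<lambda>t. 1)) f + mean_const K * L2_scalar unit_leb (\<lambda>t. 1) f"
    using KL f L2_space_cmult[OF one_L2]
    by (simp only: L2_scalar_add_left L2_scalar_diff_left L2_scalar_cmult_left L2_space_add L2_space_diff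
        L2_space_cmult one_L2)
  finally show ?thesis by (simp add: K.kop_eq_scalar)
qed

text \<open>For f of mean zero the images of f under the two operators differ by a constant
  function, which is orthogonal to f.\<close>

lemma kform_eq_centred:
  assumes f: "f \<in> L2_space unit_leb" and mean: "L2_scalar unit_leb f (\<lambda>t. 1) = 0"
  shows "K.kform f = continuous_kernel.kform (centred_cov M (X j)) f"
proof -
  interpret C: continuous_kernel "centred_cov M (X j)" by (rule centred_kernel)
  define c where "c = L2_scalar unit_leb (K.kop (\<lambda>t. 1)) f"
  have m: "L2_scalar unit_leb (\<lambda>t. 1) f = 0" using mean by (simp add: L2_scalar_commute)
  have "C.kform f = L2_scalar unit_leb (\<lambda>t. K.kop f t - c * 1) f"
    unfolding C.kform_def by (rule L2_scalar_cong) (auto simp: space_unit_leb centred_kop f m c_def)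
  also have "\<dots> = K.kform f"
    unfolding K.kform_def using f m
    by (simp only: L2_scalar_diff_left L2_scalar_cmult_left L2_space_cmult one_L2 K.kop_L2)
  finally show ?thesis by simp
qed

text \<open>The centred operator annihilates constants, so self-adjointness gives \<mu> <f, 1> =
  0.\<close>

lemma centred_eigenfunction_mean:
  assumes f: "f \<in> eigenspace (centred_cov M (X j)) \<mu>" and "\<mu> \<noteq> 0"
  shows "L2_scalar unit_leb f (\<lambda>t. 1) = 0"
proof -
  interpret C: continuous_kernel "centred_cov M (X j)" by (rule centred_kernel)
  have fL: "f \<in> L2_space unit_leb" using f by (rule C.eigenspace_L2)
  have one: "L2_scalar unit_leb (\<lambda>t. 1) (\<lambda>t. 1) = 1"
    using unit.prob_space by (simp add: L2_scalar_def space_unit_leb)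
  have "C.kop (\<lambda>t. 1) t = 0" if "t \<in> {0..1}" for t
    using centred_kop[OF one_L2 that, of j] by (simp add: one mean_const_eq)
  then have "L2_scalar unit_leb f (C.kop (\<lambda>t. 1)) = L2_scalar unit_leb f (\<lambda>t. 0)"
    by (intro L2_scalar_cong) (auto simp: space_unit_leb)
  then have "\<mu> * L2_scalar unit_leb f (\<lambda>t. 1) = 0"
    using C.kop_self_adjoint[OF fL one_L2] C.eigenspace_scalar[OF f one_L2] by simp
  then show ?thesis using \<open>\<mu> \<noteq> 0\<close> by simp
qed

end

section \<open>The cube\<close>

lemma prob_space_cube_leb: "prob_space (cube_leb d)"
  by (intro prob_space_PiM prob_space_unit_leb)

interpretation cube: prob_space "cube_leb d" for d
  by (rule prob_space_cube_leb)

interpretation cube_unit: pair_sigma_finite "cube_leb d" unit_leb for d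
  by standard

lemma measurable_cube_update:
  assumes "j < d"
  shows "(\<lambda>(t, s). t(j := s)) \<in> measurable (cube_leb d \<Otimes>\<^sub>M unit_leb) (cube_leb d)"
proof -
  have "(\<lambda>p. (fst p)(j := snd p)) \<in> measurable (cube_leb d \<Otimes>\<^sub>M unit_leb) (cube_leb d)"
    using assms by (intro measurable_fun_upd[where J = "{..<d}"]) auto
  then show ?thesis by (simp add: split_beta')
qed

text \<open>Inserting a coordinate that is already present resamples it: replacing it by an
  independent uniform value leaves the law unchanged. All computations with single coordinates rest
  on this.\<close>

lemma distr_cube_update:
  assumes "j < d"
  shows "distr (cube_leb d \<Otimes>\<^sub>M unit_leb) (cube_leb d) (\<lambda>(t, s). t(j := s)) = cube_leb d"
proof -
  interpret P: pair_sigma_finite unit_leb "cube_leb d" by standard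
  have ins: "insert j {..<d} = {..<d}" using assms by auto
  have m: "(\<lambda>(t, s). t(j := s)) \<in> measurable (cube_leb d \<Otimes>\<^sub>M unit_leb) (cube_leb d)"
    by (rule measurable_cube_update[OF assms])
  have "cube_leb d = distr (unit_leb \<Otimes>\<^sub>M cube_leb d) (cube_leb d) (\<lambda>(s, t). t(j := s))"
    using distr_pair_PiM_eq_PiM[of "{..<d}" "\<lambda>_. unit_leb" j] prob_space_unit_leb by (simp add: ins)
  also have "\<dots> = distr (distr (unit_leb \<Otimes>\<^sub>M cube_leb d) (cube_leb d \<Otimes>\<^sub>M unit_leb) (\<lambda>(s, t). (t, s)))
      (cube_leb d) (\<lambda>(t, s). t(j := s))"
    by (subst distr_distr[OF m]) (auto simp: comp_def split_beta' intro: measurable_pair_swap')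
  also have "distr (unit_leb \<Otimes>\<^sub>M cube_leb d) (cube_leb d \<Otimes>\<^sub>M unit_leb) (\<lambda>(s, t). (t, s))
      = cube_leb d \<Otimes>\<^sub>M unit_leb"
    by (rule cube_unit.distr_pair_swap[symmetric])
  finally show ?thesis by (rule sym)
qed

lemma integral_cube_update:
  fixes h :: "(nat \<Rightarrow> real) \<Rightarrow> real"
  assumes "j < d" "h \<in> borel_measurable (cube_leb d)"
  shows "(LINT t|cube_leb d. h t) = (LINT p|(cube_leb d \<Otimes>\<^sub>M unit_leb). h ((fst p)(j := snd p)))"
    and "integrable (cube_leb d) h \<longleftrightarrow> integrable (cube_leb d \<Otimes>\<^sub>M unit_leb) (\<lambda>p. h ((fst p)(j := snd p)))"
proof -
  note m = measurable_cube_update[OF assms(1)]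
  show "(LINT t|cube_leb d. h t) = (LINT p|(cube_leb d \<Otimes>\<^sub>M unit_leb). h ((fst p)(j := snd p)))"
    using integral_distr[OF m assms(2)] unfolding distr_cube_update[OF assms(1)]
    by (simp add: split_beta')
  show "integrable (cube_leb d) h \<longleftrightarrow> integrable (cube_leb d \<Otimes>\<^sub>M unit_leb) (\<lambda>p. h ((fst p)(j := snd p)))"
    using integrable_distr_eq[OF m assms(2)] unfolding distr_cube_update[OF assms(1)]
    by (simp add: split_beta')
qed

lemma cube_update_L2:
  assumes "j < d" "u \<in> L2_space (cube_leb d)"
  shows "(\<lambda>(t, s). u (t(j := s))) \<in> L2_space (cube_leb d \<Otimes>\<^sub>M unit_leb)"
proof -
  have "u \<in> borel_measurable (cube_leb d)" by (rule L2_space_measurable[OF assms(2)])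
  then show ?thesis
    using measurable_compose[OF measurable_cube_update[OF assms(1)], of u borel]
      integral_cube_update(2)[OF assms(1), of "\<lambda>t. (u t)\<^sup>2"] L2_space_integrable_sq[OF assms(2)]
    by (simp add: L2_space_def split_beta')
qed

lemma coordinate_L2:
  assumes "j < d" "g \<in> L2_space unit_leb"
  shows "(\<lambda>t. g (t j)) \<in> L2_space (cube_leb d)"
proof -
  have meas: "(\<lambda>t. g (t j)) \<in> borel_measurable (cube_leb d)"
    using assms
    by (intro measurable_compose[OF measurable_component_singleton L2_space_measurable]) auto
  have "(\<lambda>(t, s). 1 * g s) \<in> L2_space (cube_leb d \<Otimes>\<^sub>M unit_leb)"
    by (rule cube_unit.L2_space_tensor[OF cube.L2_space_const assms(2)])
  then have "integrable (cube_leb d \<Otimes>\<^sub>M unit_leb) (\<lambda>p. (g (snd p))\<^sup>2)"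
    using L2_space_integrable_sq by (fastforce simp: split_beta')
  then have "integrable (cube_leb d) (\<lambda>t. (g (t j))\<^sup>2)"
    using integral_cube_update(2)[OF assms(1), of "\<lambda>t. (g (t j))\<^sup>2"] meas by simp
  then show ?thesis using meas by (simp add: L2_space_def)
qed

text \<open>The coordinate that is overwritten is integrated out as well; this is harmless since
  \<open>unit_leb\<close> is a probability measure, and it spares the product over the other coordinates.\<close>

definition marginal :: "nat \<Rightarrow> nat \<Rightarrow> ((nat \<Rightarrow> real) \<Rightarrow> real) \<Rightarrow> real \<Rightarrow> real" where
  "marginal d j u s = (LINT t|cube_leb d. u (t(j := s)))"

lemma marginal_L2:
  assumes "j < d" "u \<in> L2_space (cube_leb d)"
  shows "marginal d j u \<in> L2_space unit_leb"
  using cube_unit.L2_kernel_integral(1)[OF cube_update_L2[OF assms] cube.L2_space_const[of 1]]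
  by (simp add: marginal_def[abs_def])

text \<open>After resampling, g depends on the fresh coordinate only, and the other factor
  integrates to the marginal. Thus \<open>marginal d j\<close> is the adjoint of the embedding of
  one-variable functions as functions of coordinate j.\<close>

lemma scalar_coordinate:
  assumes j: "j < d" and u: "u \<in> L2_space (cube_leb d)" and g: "g \<in> L2_space unit_leb"
  shows "L2_scalar (cube_leb d) u (\<lambda>t. g (t j)) = L2_scalar unit_leb (marginal d j u) g"
proof -
  have prod: "integrable (cube_leb d) (\<lambda>t. u t * g (t j))"
    by (rule L2_space_integrable_mult[OF u coordinate_L2[OF j g]])
  then have meas: "(\<lambda>t. u t * g (t j)) \<in> borel_measurable (cube_leb d)" by simp
  have int: "integrable (cube_leb d \<Otimes>\<^sub>M unit_leb) (\<lambda>(t, s). u (t(j := s)) * g s)"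
    using prod integral_cube_update(2)[OF j meas] by (simp add: split_beta')
  have "L2_scalar (cube_leb d) u (\<lambda>t. g (t j))
      = (LINT p|(cube_leb d \<Otimes>\<^sub>M unit_leb). (case p of (t, s) \<Rightarrow> u (t(j := s)) * g s))"
    using integral_cube_update(1)[OF j meas] by (simp add: L2_scalar_def split_beta')
  also have "\<dots> = (LINT s|unit_leb. LINT t|cube_leb d. u (t(j := s)) * g s)"
    by (rule cube_unit.integral_snd[OF int, symmetric])
  finally show ?thesis by (simp add: L2_scalar_def marginal_def)
qed

lemma scalar_same_coordinate:
  assumes "j < d" "f \<in> L2_space unit_leb" "g \<in> L2_space unit_leb"
  shows "L2_scalar (cube_leb d) (\<lambda>t. f (t j)) (\<lambda>t. g (t j)) = L2_scalar unit_leb f g"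
proof -
  have "marginal d j (\<lambda>t. f (t j)) = f"
    by (rule ext) (simp add: marginal_def cube.prob_space)
  then show ?thesis using scalar_coordinate[OF assms(1) coordinate_L2[OF assms(1,2)] assms(3)] by simp
qed

text \<open>The marginal of f(t j) in another coordinate is constant, equal to the mean of
  f.\<close>

lemma scalar_different_coordinates:
  assumes jk: "j < d" "k < d" "j \<noteq> k" and f: "f \<in> L2_space unit_leb" and g: "g \<in> L2_space unit_leb"
  shows "L2_scalar (cube_leb d) (\<lambda>t. f (t j)) (\<lambda>t. g (t k))
    = L2_scalar unit_leb f (\<lambda>t. 1) * L2_scalar unit_leb g (\<lambda>t. 1)"
proof -
  have "L2_scalar unit_leb f (\<lambda>t. 1) = (LINT t|cube_leb d. f (t j))"
    using scalar_same_coordinate[OF jk(1) f unit.L2_space_const[of 1]]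
    by (simp add: L2_scalar_def)
  then have "marginal d k (\<lambda>t. f (t j)) = (\<lambda>s. L2_scalar unit_leb f (\<lambda>t. 1) * 1)"
    using jk(3) by (intro ext) (simp add: marginal_def)
  then have "L2_scalar (cube_leb d) (\<lambda>t. f (t j)) (\<lambda>t. g (t k))
      = L2_scalar unit_leb f (\<lambda>t. 1) * L2_scalar unit_leb (\<lambda>s. 1) g"
    using scalar_coordinate[OF jk(2) coordinate_L2[OF jk(1) f] g] by (simp only: L2_scalar_cmult_left)
  then show ?thesis by (simp add: L2_scalar_commute)
qed

lemma scalar_coordinate_one:
  assumes "j < d" "f \<in> L2_space unit_leb"
  shows "L2_scalar (cube_leb d) (\<lambda>t. f (t j)) (\<lambda>t. 1) = L2_scalar unit_leb f (\<lambda>t. 1)"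
  using scalar_same_coordinate[OF assms unit.L2_space_const[of 1]] by simp

lemma marginal_mean:
  assumes "j < d" "u \<in> L2_space (cube_leb d)"
  shows "L2_scalar unit_leb (marginal d j u) (\<lambda>t. 1) = L2_scalar (cube_leb d) u (\<lambda>t. 1)"
  using scalar_coordinate[OF assms unit.L2_space_const[of 1]] by simp

text \<open>For \<open>u\<close> of mean zero the functions \<open>\<lambda>t. marginal d j u (t j)\<close> are the orthogonal
  projections of \<open>u\<close> to mutually orthogonal subspaces.\<close>

lemma marginal_Bessel:
  assumes u: "u \<in> L2_space (cube_leb d)" and mean: "L2_scalar (cube_leb d) u (\<lambda>t. 1) = 0"
  shows "(\<Sum>j<d. L2_scalar unit_leb (marginal d j u) (marginal d j u)) \<le> L2_scalar (cube_leb d) u u"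
proof -
  let ?ip = "L2_scalar (cube_leb d)"
  define m where "m j = marginal d j u" for j
  define P where "P = (\<lambda>t. \<Sum>j<d. m j (t j))"
  have mL: "m j \<in> L2_space unit_leb" if "j < d" for j
    unfolding m_def by (rule marginal_L2[OF that u])
  have cL: "(\<lambda>t. m j (t j)) \<in> L2_space (cube_leb d)" if "j < d" for j
    by (rule coordinate_L2[OF that mL[OF that]])
  have PL: "P \<in> L2_space (cube_leb d)" unfolding P_def using cL by (intro L2_space_sum) auto
  have uP: "?ip u P = (\<Sum>j<d. L2_scalar unit_leb (m j) (m j))"
  proof -
    have "?ip u P = (\<Sum>j<d. ?ip u (\<lambda>t. m j (t j)))"
      unfolding P_def using cL u by (intro L2_scalar_sum_right) auto
    also have "\<dots> = (\<Sum>j<d. L2_scalar unit_leb (m j) (m j))"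
      using scalar_coordinate[OF _ u mL] by (intro sum.cong) (auto simp: m_def)
    finally show ?thesis .
  qed
  have PP: "?ip P P = (\<Sum>j<d. L2_scalar unit_leb (m j) (m j))"
  proof -
    have "?ip P P = (\<Sum>j<d. ?ip (\<lambda>t. m j (t j)) P)"
      by (subst (1) P_def) (use cL PL in \<open>auto intro!: L2_scalar_sum_left\<close>)
    also have "\<dots> = (\<Sum>j<d. L2_scalar unit_leb (m j) (m j))"
    proof (intro sum.cong refl)
      fix j assume "j \<in> {..<d}"
      then have j: "j < d" by simp
      have "?ip (\<lambda>t. m j (t j)) P = (\<Sum>k<d. ?ip (\<lambda>t. m j (t j)) (\<lambda>t. m k (t k)))"
        unfolding P_def using cL j by (intro L2_scalar_sum_right) auto
      also have "\<dots> = (\<Sum>k<d. if k = j then L2_scalar unit_leb (m j) (m j) else 0)"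
      proof (intro sum.cong refl)
        fix k assume "k \<in> {..<d}"
        then have k: "k < d" by simp
        have "L2_scalar unit_leb (m j) (\<lambda>t. 1) = 0"
          using marginal_mean[OF j u] mean by (simp add: m_def)
        then show "?ip (\<lambda>t. m j (t j)) (\<lambda>t. m k (t k)) = (if k = j then L2_scalar unit_leb (m j) (m j) else 0)"
          using scalar_same_coordinate[OF j mL[OF j] mL[OF j]]
            scalar_different_coordinates[OF j k _ mL[OF j] mL[OF k]] by auto
      qed
      also have "\<dots> = L2_scalar unit_leb (m j) (m j)" using j by simp
      finally show "?ip (\<lambda>t. m j (t j)) P = L2_scalar unit_leb (m j) (m j)" .
    qed
    finally show ?thesis .
  qed
  \<comment> \<open>As <u, P> = <P, P>, this square equals |u|^2 - |P|^2.\<close>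
  have "0 \<le> ?ip (\<lambda>t. u t - P t) (\<lambda>t. u t - P t)" by (rule L2_scalar_self_nonneg)
  also have "\<dots> = ?ip u u - 2 * ?ip u P + ?ip P P"
    using u PL by (simp add: L2_scalar_linear L2_space_intros L2_scalar_commute[of _ P u])
  finally show ?thesis using uP PP by (simp add: m_def)
qed

section \<open>Average case errors of the additive field\<close>

lemma approximation_error_expand:
  fixes \<psi> :: "nat \<Rightarrow> 'b \<Rightarrow> real"
  assumes v: "v \<in> L2_space N" and psi: "\<And>m. m < n \<Longrightarrow> \<psi> m \<in> L2_space N"
  defines "c \<equiv> \<lambda>m. L2_scalar N v (\<psi> m)"
  defines "e \<equiv> \<lambda>x. v x - (\<Sum>m<n. c m * \<psi> m x)"
  shows "L2_scalar N e e = L2_scalar N v v - 2 * (\<Sum>m<n. c m * c m)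
    + (\<Sum>m<n. \<Sum>l<n. (c m * c l) * L2_scalar N (\<psi> m) (\<psi> l))"
proof -
  define p where "p = (\<lambda>x. \<Sum>m<n. c m * \<psi> m x)"
  have pL: "p \<in> L2_space N" unfolding p_def using psi by (intro L2_space_sum L2_space_cmult) auto
  have scal: "L2_scalar N p g = (\<Sum>m<n. c m * L2_scalar N (\<psi> m) g)" if "g \<in> L2_space N" for g
    unfolding p_def using psi that by (intro L2_scalar_comb_left) auto
  have "L2_scalar N p p = (\<Sum>m<n. c m * L2_scalar N (\<psi> m) p)" by (rule scal[OF pL])
  also have "\<dots> = (\<Sum>m<n. \<Sum>l<n. (c m * c l) * L2_scalar N (\<psi> m) (\<psi> l))"
  proof (intro sum.cong refl)
    fix m assume "m \<in> {..<n}"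
    then have "L2_scalar N p (\<psi> m) = (\<Sum>l<n. c l * L2_scalar N (\<psi> l) (\<psi> m))"
      using psi by (intro scal) auto
    then show "c m * L2_scalar N (\<psi> m) p = (\<Sum>l<n. (c m * c l) * L2_scalar N (\<psi> m) (\<psi> l))"
      by (simp add: L2_scalar_commute[of N p] L2_scalar_commute[of N _ "\<psi> m"] sum_distrib_left mult.assoc)
  qed
  finally have pp: "L2_scalar N p p = (\<Sum>m<n. \<Sum>l<n. (c m * c l) * L2_scalar N (\<psi> m) (\<psi> l))" .
  have pv: "L2_scalar N p v = (\<Sum>m<n. c m * c m)"
    unfolding scal[OF v] by (simp add: c_def L2_scalar_commute)
  have "L2_scalar N e e = L2_scalar N v v - 2 * L2_scalar N p v + L2_scalar N p p"
  proof -
    have "e = (\<lambda>x. v x - p x)" by (simp add: e_def p_def)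
    then show ?thesis
      using v pL by (simp add: L2_scalar_linear L2_space_intros L2_scalar_commute[of N v p])
  qed
  then show ?thesis using pp pv by simp
qed

definition sq_error :: "'b measure \<Rightarrow> ('b \<Rightarrow> 'a \<Rightarrow> real) \<Rightarrow> nat \<Rightarrow> (nat \<Rightarrow> 'b \<Rightarrow> real) \<Rightarrow> 'a \<Rightarrow> real" where
  "sq_error N V n \<psi> \<omega> =
     L2_scalar N (\<lambda>t. V t \<omega> - (\<Sum>m<n. L2_scalar N (\<lambda>u. V u \<omega>) (\<psi> m) * \<psi> m t))
       (\<lambda>t. V t \<omega> - (\<Sum>m<n. L2_scalar N (\<lambda>u. V u \<omega>) (\<psi> m) * \<psi> m t))"

lemma avg_error_eq_Inf:
  "n \<noteq> 0 \<Longrightarrow> avg_error M N V n = Inf {sqrt (LINT \<omega>|M. sq_error N V n \<psi> \<omega>) | \<psi>. \<forall>m<n. \<psi> m \<in> L2_space N}"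
  by (simp add: avg_error_def sq_error_def L2_nrm_sq)

lemma avg_error_le:
  assumes "n \<noteq> 0" "\<And>m. m < n \<Longrightarrow> \<psi> m \<in> L2_space N"
  shows "avg_error M N V n \<le> sqrt (LINT \<omega>|M. sq_error N V n \<psi> \<omega>)"
  unfolding avg_error_eq_Inf[OF assms(1)]
proof (rule cInf_lower)
  show "bdd_below {sqrt (LINT \<omega>|M. sq_error N V n \<psi> \<omega>) | \<psi>. \<forall>m<n. \<psi> m \<in> L2_space N}"
    by (rule bdd_belowI[of _ 0])
      (auto simp: sq_error_def L2_scalar_self_nonneg intro!: Bochner_Integration.integral_nonneg)
qed (use assms(2) in blast)

text \<open>\<open>sqrt\<close> is monotone on all reals, negative ones included; this matters
  because the lower bound of \<open>sq_error_ge\<close> can be negative.\<close>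

lemma avg_error_ge:
  assumes "n \<noteq> 0"
    and "\<And>\<psi>. (\<And>m. m < n \<Longrightarrow> \<psi> m \<in> L2_space N) \<Longrightarrow> b \<le> (LINT \<omega>|M. sq_error N V n \<psi> \<omega>)"
  shows "sqrt b \<le> avg_error M N V n"
  unfolding avg_error_eq_Inf[OF assms(1)]
proof (rule cInf_greatest)
  show "{sqrt (LINT \<omega>|M. sq_error N V n \<psi> \<omega>) | \<psi>. \<forall>m<n. \<psi> m \<in> L2_space N} \<noteq> {}"
    using L2_space_zero[of N] by (auto intro!: exI[of _ "\<lambda>m x. 0"])
qed (use assms(2) in auto)

section \<open>Second moments of the additive field\<close>

context uncorrelated_processes
begin

lemma field_L2: "\<omega> \<in> space M \<Longrightarrow> (\<lambda>t. additive_field X d t \<omega>) \<in> L2_space (cube_leb d)"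
  unfolding additive_field_def by (intro L2_space_sum coordinate_L2 paths) auto

lemma field_scalar:
  assumes "\<omega> \<in> space M" "u \<in> L2_space (cube_leb d)"
  shows "L2_scalar (cube_leb d) (\<lambda>t. additive_field X d t \<omega>) u = (\<Sum>j<d. coef j (marginal d j u) \<omega>)"
proof -
  have "L2_scalar (cube_leb d) (\<lambda>t. additive_field X d t \<omega>) u
      = (\<Sum>j<d. L2_scalar (cube_leb d) (\<lambda>t. X j (t j) \<omega>) u)"
    unfolding additive_field_def using assms
    by (intro L2_scalar_sum_left coordinate_L2[where g = "\<lambda>s. X _ s \<omega>"] paths) auto
  also have "\<dots> = (\<Sum>j<d. coef j (marginal d j u) \<omega>)"
  proof (intro sum.cong refl)
    fix j assume "j \<in> {..<d}"
    then have "L2_scalar (cube_leb d) u (\<lambda>t. X j (t j) \<omega>)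
        = L2_scalar unit_leb (marginal d j u) (\<lambda>s. X j s \<omega>)"
      using assms paths by (intro scalar_coordinate) auto
    then show "L2_scalar (cube_leb d) (\<lambda>t. X j (t j) \<omega>) u = coef j (marginal d j u) \<omega>"
      by (simp add: coef_def L2_scalar_commute)
  qed
  finally show ?thesis .
qed

lemma field_scalar_L2:
  assumes "u \<in> L2_space (cube_leb d)"
  shows "(\<lambda>\<omega>. L2_scalar (cube_leb d) (\<lambda>t. additive_field X d t \<omega>) u) \<in> L2_space M"
proof -
  have "(\<lambda>\<omega>. \<Sum>j<d. coef j (marginal d j u) \<omega>) \<in> L2_space M"
    using assms by (intro L2_space_sum coef_L2 marginal_L2) auto
  then show ?thesis
    using L2_space_cong[of M] field_scalar[OF _ assms] by (metis (no_types, lifting))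
qed

text \<open>Coefficients of different processes are uncorrelated, so the double sum reduces to its
  diagonal.\<close>

lemma integral_field_scalar_sq:
  assumes u: "u \<in> L2_space (cube_leb d)"
  shows "(LINT \<omega>|M. (L2_scalar (cube_leb d) (\<lambda>t. additive_field X d t \<omega>) u)\<^sup>2)
    = (\<Sum>j<d. K.kform (marginal d j u))"
proof -
  define c where "c j = coef j (marginal d j u)" for j
  have cL: "c j \<in> L2_space M" if "j < d" for j
    unfolding c_def by (intro coef_L2 marginal_L2 that u)
  have "(LINT \<omega>|M. (L2_scalar (cube_leb d) (\<lambda>t. additive_field X d t \<omega>) u)\<^sup>2)
      = L2_scalar M (\<lambda>\<omega>. \<Sum>j<d. c j \<omega>) (\<lambda>\<omega>. \<Sum>j<d. c j \<omega>)"
    unfolding L2_scalar_def[of M]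
    by (intro Bochner_Integration.integral_cong) (auto simp: field_scalar[OF _ u] c_def power2_eq_square)
  also have "\<dots> = (\<Sum>j<d. L2_scalar M (c j) (\<lambda>\<omega>. \<Sum>k<d. c k \<omega>))"
    using cL by (intro L2_scalar_sum_left L2_space_sum) auto
  also have "\<dots> = (\<Sum>j<d. \<Sum>k<d. L2_scalar M (c j) (c k))"
    using cL by (intro sum.cong refl L2_scalar_sum_right) auto
  also have "\<dots> = (\<Sum>j<d. \<Sum>k<d. if j = k then K.kform (marginal d j u) else 0)"
    using scalar_coef_coef marginal_L2 u
    by (intro sum.cong refl) (auto simp: c_def K.kform_def)
  finally show ?thesis by simp
qed

lemma field_norm:
  shows "integrable M (\<lambda>\<omega>. L2_scalar (cube_leb d) (\<lambda>t. additive_field X d t \<omega>) (\<lambda>t. additive_field X d t \<omega>))"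
    and "(LINT \<omega>|M. L2_scalar (cube_leb d) (\<lambda>t. additive_field X d t \<omega>) (\<lambda>t. additive_field X d t \<omega>))
      = real d * trace_const K"
proof -
  \<comment> \<open>Off the diagonal the scalar product on the cube is a product of two path means,
    whose expectation vanishes.\<close>
  define h where "h j k \<omega> = (if j = k then L2_scalar unit_leb (\<lambda>t. X j t \<omega>) (\<lambda>t. X j t \<omega>)
    else coef j (\<lambda>t. 1) \<omega> * coef k (\<lambda>t. 1) \<omega>)" for j k \<omega>
  have eq: "L2_scalar (cube_leb d) (\<lambda>t. additive_field X d t \<omega>) (\<lambda>t. additive_field X d t \<omega>)
      = (\<Sum>j<d. \<Sum>k<d. h j k \<omega>)" if \<omega>: "\<omega> \<in> space M" for \<omega>
  proof -
    have cL: "(\<lambda>t. X j (t j) \<omega>) \<in> L2_space (cube_leb d)" if "j < d" for j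
      by (rule coordinate_L2[OF that paths[OF \<omega>]])
    have "L2_scalar (cube_leb d) (\<lambda>t. additive_field X d t \<omega>) (\<lambda>t. additive_field X d t \<omega>)
        = (\<Sum>j<d. L2_scalar (cube_leb d) (\<lambda>t. X j (t j) \<omega>) (\<lambda>t. \<Sum>k<d. X k (t k) \<omega>))"
      unfolding additive_field_def using cL by (intro L2_scalar_sum_left L2_space_sum) auto
    also have "\<dots> = (\<Sum>j<d. \<Sum>k<d. L2_scalar (cube_leb d) (\<lambda>t. X j (t j) \<omega>) (\<lambda>t. X k (t k) \<omega>))"
      using cL by (intro sum.cong refl L2_scalar_sum_right) auto
    also have "\<dots> = (\<Sum>j<d. \<Sum>k<d. h j k \<omega>)"
      using scalar_same_coordinate[OF _ paths[OF \<omega>] paths[OF \<omega>]]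
        scalar_different_coordinates[OF _ _ _ paths[OF \<omega>] paths[OF \<omega>]]
      by (intro sum.cong refl) (auto simp: h_def coef_def)
    finally show ?thesis .
  qed
  have hint: "integrable M (h j k)" for j k
    unfolding h_def using integral_path_norm(1)[of j] L2_space_integrable_mult[OF coef_L2 coef_L2, OF one_L2 one_L2]
    by (cases "j = k") auto
  have hval: "(LINT \<omega>|M. h j k \<omega>) = (if j = k then trace_const K else 0)" for j k
    unfolding h_def using integral_path_norm(2)[of j] scalar_coef_coef[OF one_L2 one_L2, of j k]
    by (auto simp: L2_scalar_def)
  show "integrable M (\<lambda>\<omega>. L2_scalar (cube_leb d) (\<lambda>t. additive_field X d t \<omega>) (\<lambda>t. additive_field X d t \<omega>))"
    using hint by (subst Bochner_Integration.integrable_cong[OF refl eq]) (auto intro!: Bochner_Integration.integrable_sum)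
  have "(LINT \<omega>|M. L2_scalar (cube_leb d) (\<lambda>t. additive_field X d t \<omega>) (\<lambda>t. additive_field X d t \<omega>))
      = (LINT \<omega>|M. (\<Sum>j<d. \<Sum>k<d. h j k \<omega>))"
    by (rule Bochner_Integration.integral_cong[OF refl eq])
  also have "\<dots> = (\<Sum>j<d. \<Sum>k<d. if j = k then trace_const K else 0)"
    using hint by (simp add: Bochner_Integration.integral_sum hval)
  finally show "(LINT \<omega>|M. L2_scalar (cube_leb d) (\<lambda>t. additive_field X d t \<omega>) (\<lambda>t. additive_field X d t \<omega>))
      = real d * trace_const K"
    by simp
qed

lemma avg_error_0: "avg_error M (cube_leb d) (additive_field X d) 0 = sqrt (real d * trace_const K)"
  by (simp add: avg_error_def L2_nrm_sq field_norm(2))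

lemma sq_error_integrable:
  assumes psi: "\<And>m. m < n \<Longrightarrow> \<psi> m \<in> L2_space (cube_leb d)"
  shows "integrable M (sq_error (cube_leb d) (additive_field X d) n \<psi>)"
proof -
  define c where "c m \<omega> = L2_scalar (cube_leb d) (\<lambda>t. additive_field X d t \<omega>) (\<psi> m)" for m \<omega>
  have cL: "c m \<in> L2_space M" if "m < n" for m
    using field_scalar_L2[OF psi[OF that]] by (simp add: c_def[abs_def])
  have eq: "sq_error (cube_leb d) (additive_field X d) n \<psi> \<omega>
      = L2_scalar (cube_leb d) (\<lambda>t. additive_field X d t \<omega>) (\<lambda>t. additive_field X d t \<omega>)
        - 2 * (\<Sum>m<n. c m \<omega> * c m \<omega>)
        + (\<Sum>m<n. \<Sum>l<n. (c m \<omega> * c l \<omega>) * L2_scalar (cube_leb d) (\<psi> m) (\<psi> l))"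
    if "\<omega> \<in> space M" for \<omega>
    unfolding sq_error_def c_def by (rule approximation_error_expand[OF field_L2[OF that] psi])
  have cc: "integrable M (\<lambda>\<omega>. c m \<omega> * c l \<omega>)" if "m < n" "l < n" for m l
    using that by (intro L2_space_integrable_mult cL)
  show ?thesis
    by (subst Bochner_Integration.integrable_cong[OF refl eq])
      (use cc field_norm(1) in \<open>auto intro!: Bochner_Integration.integrable_add
        Bochner_Integration.integrable_diff integrable_mult_right integrable_mult_left
        Bochner_Integration.integrable_sum\<close>)
qed

end

text \<open>The spectrum is read off from one fixed process \<open>X i\<close>; it serves every
  coordinate, because \<open>kform_eq_centred\<close> holds with any index.\<close>

locale additive_spectrum =
  uncorrelated_processes M X K + eig: eigensystem "centred_cov M (X i)" lam \<phi>
  for M :: "'a measure" and X K and i :: nat and lam \<phi>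
begin

lemma integral_field_mean_sq:
  "(LINT \<omega>|M. (L2_scalar (cube_leb d) (\<lambda>t. additive_field X d t \<omega>) (\<lambda>t. 1))\<^sup>2) = real d * mean_const K"
proof -
  have "marginal d j (\<lambda>t. 1) = (\<lambda>t. 1)" for j
    by (rule ext) (simp add: marginal_def cube.prob_space)
  then show ?thesis
    using integral_field_scalar_sq[OF cube.L2_space_const[of 1 d]]
    by (simp add: mean_const_eq K.kform_def)
qed

lemma phi_mean: "0 < lam k \<Longrightarrow> L2_scalar unit_leb (\<phi> k) (\<lambda>t. 1) = 0"
  using centred_eigenfunction_mean[OF eig.phi_eigenspace, of k] by simp

text \<open>The error is compared with projection on the span of 1 and the \<psi>. The constant
  captures d * \<open>mean_const K\<close>, turning the trace into the centred one. The remaining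
  functions \<open>u l\<close> have mean zero, so \<open>kform_le\<close> applies to their
  marginals, and two budgets limit the gain: each eigenfunction of each coordinate has at most unit
  mass along the \<open>u l\<close>, and each \<open>u l\<close> spreads at most unit mass over its
  marginals.\<close>

lemma sq_error_ge:
  assumes psi: "\<And>l. l < n \<Longrightarrow> \<psi> l \<in> L2_space (cube_leb d)"
  shows "real d * centred_trace K - real d * (\<Sum>k<m. lam k - lam m) - real n * lam m
    \<le> (LINT \<omega>|M. sq_error (cube_leb d) (additive_field X d) n \<psi> \<omega>)"
proof -
  let ?N = "cube_leb d"
  let ?ip = "L2_scalar ?N"
  let ?V = "\<lambda>\<omega> t. additive_field X d t \<omega>"
  have one: "(\<lambda>t. 1) \<in> L2_space ?N" by (rule cube.L2_space_const)
  have one1: "?ip (\<lambda>t. 1) (\<lambda>t. 1) = 1" by (simp add: L2_scalar_def cube.prob_space)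
  \<comment> \<open>Means are subtracted before orthonormalising, so that every \<open>u l\<close>
    is orthogonal to the constants.\<close>
  define f where "f l = (\<lambda>t. \<psi> l t - ?ip (\<psi> l) (\<lambda>t. 1) * 1)" for l
  have fL: "f l \<in> L2_space ?N" if "l < n" for l
    unfolding f_def by (intro L2_space_diff psi[OF that] L2_space_cmult one)
  have scal_f: "?ip h (f l) = ?ip h (\<psi> l) - ?ip (\<psi> l) (\<lambda>t. 1) * ?ip h (\<lambda>t. 1)"
    if "h \<in> L2_space ?N" "l < n" for h l
    unfolding f_def using that psi[OF that(2)] one
    by (simp only: L2_scalar_diff_right L2_scalar_cmult_right L2_space_cmult)
  obtain u where u: "orthonormal_or_null ?N u {..<n}"
    and comb: "\<And>l. l < n \<Longrightarrow> \<exists>b. b l \<noteq> 0 \<and> u l = (\<lambda>x. \<Sum>j\<le>l. b j * f j x)"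
    using Gram_Schmidt[of n f ?N, OF fL] by blast
  note tri = triangular_comb_orthogonal[of n f ?N _ u, OF fL _ comb]
  have "?ip (\<lambda>t. 1) (f l) = 0" if "l < n" for l
    using scal_f[OF one that] one1 by (simp add: L2_scalar_commute)
  then have u_mean: "?ip (\<lambda>t. 1) (u l) = 0" if "l < n" for l
    using tri[OF _ one] that by blast
  then have u_mean': "?ip (u l) (\<lambda>t. 1) = 0" if "l < n" for l
    using that by (simp add: L2_scalar_commute)
  have uL: "u l \<in> L2_space ?N" if "l < n" for l
    using orthonormal_or_null_L2[OF u] that by simp
  define w where "w l = (case l of 0 \<Rightarrow> (\<lambda>t. 1) | Suc l \<Rightarrow> u l)" for l
  have w: "orthonormal_or_null ?N w {..<Suc n}"
    using u one one1 u_mean u_mean'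
    by (auto simp: orthonormal_or_null_def w_def split: nat.split)
  have span: "?ip h (\<psi> l) = 0"
    if h: "h \<in> L2_space ?N" "\<And>l. l \<in> {..<Suc n} \<Longrightarrow> ?ip h (w l) = 0" and l: "l < n" for h l
  proof -
    have "?ip h (u l) = 0" if "l < n" for l using h(2)[of "Suc l"] that by (simp add: w_def)
    then have "?ip h (f l) = 0" using tri[OF _ h(1)] l by blast
    moreover have "?ip h (\<lambda>t. 1) = 0" using h(2)[of 0] by (simp add: w_def)
    ultimately show ?thesis using scal_f[OF h(1) l] by simp
  qed
  have pointwise: "?ip (?V \<omega>) (?V \<omega>) - (\<Sum>l<Suc n. (?ip (?V \<omega>) (w l))\<^sup>2) \<le> sq_error ?N (additive_field X d) n \<psi> \<omega>"
    if "\<omega> \<in> space M" for \<omega>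
    unfolding sq_error_def
    by (rule approximation_error_ge[OF w finite_lessThan field_L2[OF that] psi span])
  have wL: "w l \<in> L2_space ?N" if "l < Suc n" for l
    using orthonormal_or_null_L2[OF w] that by simp
  have sqint: "integrable M (\<lambda>\<omega>. (?ip (?V \<omega>) (w l))\<^sup>2)" if "l < Suc n" for l
    by (rule L2_space_integrable_sq[OF field_scalar_L2[OF wL[OF that]]])
  define c where "c l j k = L2_scalar unit_leb (marginal d j (u l)) (\<phi> k)" for l j k
  define a where "a l j = L2_scalar unit_leb (marginal d j (u l)) (marginal d j (u l))" for l j
  have "(LINT \<omega>|M. (?ip (?V \<omega>) (u l))\<^sup>2)
      \<le> (\<Sum>j<d. (\<Sum>k<m. (lam k - lam m) * (c l j k)\<^sup>2) + lam m * a l j)" if "l < n" for l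
    unfolding integral_field_scalar_sq[OF uL[OF that]]
  proof (rule sum_mono)
    fix j assume "j \<in> {..<d}"
    then have j: "j < d" by simp
    have mL: "marginal d j (u l) \<in> L2_space unit_leb" by (rule marginal_L2[OF j uL[OF that]])
    have "L2_scalar unit_leb (marginal d j (u l)) (\<lambda>t. 1) = 0"
      using marginal_mean[OF j uL[OF that]] u_mean'[OF that] by simp
    then have "K.kform (marginal d j (u l)) = eig.kform (marginal d j (u l))"
      by (rule kform_eq_centred[OF mL])
    also have "\<dots> \<le> (\<Sum>k<m. (lam k - lam m) * (c l j k)\<^sup>2) + lam m * a l j"
      unfolding c_def a_def by (rule eig.kform_le[OF mL])
    finally show "K.kform (marginal d j (u l)) \<le> (\<Sum>k<m. (lam k - lam m) * (c l j k)\<^sup>2) + lam m * a l j" .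
  qed
  then have "(\<Sum>l<n. LINT \<omega>|M. (?ip (?V \<omega>) (u l))\<^sup>2)
      \<le> (\<Sum>l<n. \<Sum>j<d. (\<Sum>k<m. (lam k - lam m) * (c l j k)\<^sup>2) + lam m * a l j)"
    by (intro sum_mono) auto
  also have "\<dots> = (\<Sum>k<m. (lam k - lam m) * (\<Sum>j<d. \<Sum>l<n. (c l j k)\<^sup>2)) + lam m * (\<Sum>l<n. \<Sum>j<d. a l j)"
  proof -
    have "(\<Sum>l<n. \<Sum>j<d. \<Sum>k<m. (lam k - lam m) * (c l j k)\<^sup>2)
        = (\<Sum>l<n. \<Sum>k<m. \<Sum>j<d. (lam k - lam m) * (c l j k)\<^sup>2)"
      by (intro sum.cong refl sum.swap)
    also have "\<dots> = (\<Sum>k<m. \<Sum>l<n. \<Sum>j<d. (lam k - lam m) * (c l j k)\<^sup>2)"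
      by (rule sum.swap)
    also have "\<dots> = (\<Sum>k<m. \<Sum>j<d. \<Sum>l<n. (lam k - lam m) * (c l j k)\<^sup>2)"
      by (intro sum.cong refl sum.swap)
    finally show ?thesis by (simp add: sum.distrib sum_distrib_left)
  qed
  also have "\<dots> \<le> (\<Sum>k<m. (lam k - lam m) * real d) + lam m * real n"
  proof (intro add_mono sum_mono mult_left_mono)
    fix k assume "k \<in> {..<m}"
    then show "0 \<le> lam k - lam m" using eig.lam_dec by (simp add: decseq_def)
    have "(\<Sum>l<n. (c l j k)\<^sup>2) \<le> 1" if "j < d" for j
    proof -
      have cL: "(\<lambda>t. \<phi> k (t j)) \<in> L2_space ?N" by (rule coordinate_L2[OF that eig.phi_L2])
      have "c l j k = ?ip (\<lambda>t. \<phi> k (t j)) (u l)" if "l < n" for l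
        using scalar_coordinate[OF \<open>j < d\<close> uL[OF that] eig.phi_L2] by (simp add: c_def L2_scalar_commute)
      then have "(\<Sum>l<n. (c l j k)\<^sup>2) \<le> ?ip (\<lambda>t. \<phi> k (t j)) (\<lambda>t. \<phi> k (t j))"
        using Bessel_inequality[OF u finite_lessThan cL] by simp
      also have "\<dots> \<le> 1"
        using scalar_same_coordinate[OF that eig.phi_L2 eig.phi_L2] by (simp add: eig.phi_orthonormal)
      finally show ?thesis .
    qed
    then have "(\<Sum>j<d. \<Sum>l<n. (c l j k)\<^sup>2) \<le> (\<Sum>j<d. 1)" by (intro sum_mono) auto
    then show "(\<Sum>j<d. \<Sum>l<n. (c l j k)\<^sup>2) \<le> real d" by simp
  next
    have "(\<Sum>j<d. a l j) \<le> 1" if "l < n" for l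
    proof -
      have "(\<Sum>j<d. a l j) \<le> ?ip (u l) (u l)"
        unfolding a_def by (rule marginal_Bessel[OF uL[OF that] u_mean'[OF that]])
      also have "\<dots> \<le> 1"
      proof -
        have "?ip (u l) (u l) \<in> {0, 1}" using u that unfolding orthonormal_or_null_def by blast
        then show ?thesis by auto
      qed
      finally show ?thesis .
    qed
    then have "(\<Sum>l<n. \<Sum>j<d. a l j) \<le> (\<Sum>l<n. 1)" by (intro sum_mono) auto
    then show "(\<Sum>l<n. \<Sum>j<d. a l j) \<le> real n" by simp
  qed (rule eig.lam_nonneg)
  finally have captured: "(\<Sum>l<n. LINT \<omega>|M. (?ip (?V \<omega>) (u l))\<^sup>2)
      \<le> real d * (\<Sum>k<m. lam k - lam m) + real n * lam m"
    by (simp add: sum_distrib_left mult.commute)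
  have "(\<Sum>l<Suc n. LINT \<omega>|M. (?ip (?V \<omega>) (w l))\<^sup>2)
      = real d * mean_const K + (\<Sum>l<n. LINT \<omega>|M. (?ip (?V \<omega>) (u l))\<^sup>2)"
    unfolding sum.lessThan_Suc_shift by (simp add: w_def integral_field_mean_sq)
  then have "real d * centred_trace K - real d * (\<Sum>k<m. lam k - lam m) - real n * lam m
      \<le> real d * trace_const K - (\<Sum>l<Suc n. LINT \<omega>|M. (?ip (?V \<omega>) (w l))\<^sup>2)"
    using captured by (simp add: centred_trace_def algebra_simps)
  also have "\<dots> = (LINT \<omega>|M. ?ip (?V \<omega>) (?V \<omega>) - (\<Sum>l<Suc n. (?ip (?V \<omega>) (w l))\<^sup>2))"
  proof -
    have "(LINT \<omega>|M. (\<Sum>l<Suc n. (?ip (?V \<omega>) (w l))\<^sup>2)) = (\<Sum>l<Suc n. LINT \<omega>|M. (?ip (?V \<omega>) (w l))\<^sup>2)"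
      using sqint by (intro Bochner_Integration.integral_sum) auto
    moreover have "integrable M (\<lambda>\<omega>. \<Sum>l<Suc n. (?ip (?V \<omega>) (w l))\<^sup>2)"
      using sqint by (intro Bochner_Integration.integrable_sum) auto
    ultimately show ?thesis using field_norm by (simp only: Bochner_Integration.integral_diff)
  qed
  also have "\<dots> \<le> (LINT \<omega>|M. sq_error ?N (additive_field X d) n \<psi> \<omega>)"
  proof (rule integral_mono)
    show "integrable M (\<lambda>\<omega>. ?ip (?V \<omega>) (?V \<omega>) - (\<Sum>l<Suc n. (?ip (?V \<omega>) (w l))\<^sup>2))"
      using sqint by (intro Bochner_Integration.integrable_diff field_norm Bochner_Integration.integrable_sum) auto
    show "integrable M (sq_error ?N (additive_field X d) n \<psi>)"
      by (rule sq_error_integrable[OF psi])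
  qed (rule pointwise)
  finally show ?thesis .
qed

text \<open>The constant function absorbs the variance of the means, and the functions
  \<open>\<lambda>t. \<phi> k (t j)\<close>, ordered by \<open>k\<close> first, capture \<open>lam k\<close> each.\<close>

lemma sq_error_attained:
  assumes d: "0 < d" and pos: "\<And>r. r < N \<Longrightarrow> 0 < lam (r div d)"
  defines "\<psi> \<equiv> \<lambda>l. case l of 0 \<Rightarrow> (\<lambda>t. 1) | Suc r \<Rightarrow> (\<lambda>t. \<phi> (r div d) (t (r mod d)))"
  shows "\<And>l. \<psi> l \<in> L2_space (cube_leb d)"
    and "(LINT \<omega>|M. sq_error (cube_leb d) (additive_field X d) (Suc N) \<psi> \<omega>)
      = real d * centred_trace K - (\<Sum>r<N. lam (r div d))"
proof -
  let ?N = "cube_leb d"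
  let ?ip = "L2_scalar ?N"
  let ?V = "\<lambda>\<omega> t. additive_field X d t \<omega>"
  have md: "r mod d < d" for r using d by simp
  have one1: "?ip (\<lambda>t. 1) (\<lambda>t. 1) = 1" by (simp add: L2_scalar_def cube.prob_space)
  show psiL: "\<psi> l \<in> L2_space ?N" for l
    unfolding \<psi>_def using coordinate_L2[OF md eig.phi_L2] cube.L2_space_const
    by (auto split: nat.split)
  have mean: "?ip (\<psi> (Suc r)) (\<lambda>t. 1) = 0" if "r < N" for r
    using scalar_coordinate_one[OF md eig.phi_L2] phi_mean[OF pos[OF that]] by (simp add: \<psi>_def)
  have orth: "?ip (\<psi> (Suc r)) (\<psi> (Suc s)) = (if r = s then 1 else 0)" if "r < N" "s < N" for r s
  proof (cases "r mod d = s mod d")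
    case True
    then have "?ip (\<psi> (Suc r)) (\<psi> (Suc s)) = L2_scalar unit_leb (\<phi> (r div d)) (\<phi> (s div d))"
      using scalar_same_coordinate[OF md eig.phi_L2[of "r div d"] eig.phi_L2[of "s div d"], of s]
      by (simp add: \<psi>_def)
    \<comment> \<open>Quotient and remainder determine r, so distinct functions in the same
      coordinate carry distinct eigenfunctions.\<close>
    moreover have "r div d = s div d \<longleftrightarrow> r = s" using True by (metis div_mult_mod_eq)
    ultimately show ?thesis using pos[OF that(2)] by (simp add: eig.phi_orthonormal)
  next
    case False
    then show ?thesis
      using scalar_different_coordinates[OF md md False eig.phi_L2 eig.phi_L2] phi_mean[OF pos[OF that(1)]]
      by (auto simp: \<psi>_def)
  qed
  have psi_on: "orthonormal_or_null ?N \<psi> {..<Suc N}"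
    unfolding orthonormal_or_null_def
  proof (intro conjI ballI impI psiL)
    fix a assume "a \<in> {..<Suc N}"
    then show "?ip (\<psi> a) (\<psi> a) \<in> {0, 1}"
      using orth one1 by (cases a) (auto simp: \<psi>_def)
  next
    fix a b assume "a \<in> {..<Suc N}" "b \<in> {..<Suc N}" "a \<noteq> b"
    moreover have "\<psi> 0 = (\<lambda>t. 1)" by (simp add: \<psi>_def)
    ultimately show "?ip (\<psi> a) (\<psi> b) = 0"
      using orth mean by (cases a; cases b) (auto simp: L2_scalar_commute[of ?N "\<lambda>t. 1"])
  qed
  have captured: "(LINT \<omega>|M. (?ip (?V \<omega>) (\<psi> (Suc r)))\<^sup>2) = lam (r div d)" if "r < N" for r
  proof -
    \<comment> \<open>In any other coordinate the marginal is the mean of an eigenfunction, which is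
      zero; a single summand of the second moment survives.\<close>
    have "K.kform (marginal d j (\<psi> (Suc r))) = (if j = r mod d then lam (r div d) else 0)" if j: "j < d" for j
    proof (cases "j = r mod d")
      case True
      then have "marginal d j (\<psi> (Suc r)) = \<phi> (r div d)"
        by (intro ext) (simp add: marginal_def \<psi>_def cube.prob_space)
      then show ?thesis
        using True kform_eq_centred[OF eig.phi_L2 phi_mean[OF pos[OF \<open>r < N\<close>]], of i] eig.kform_phi by simp
    next
      case False
      have "(LINT t|?N. \<phi> (r div d) (t (r mod d))) = 0"
        using mean[OF \<open>r < N\<close>] by (simp add: \<psi>_def L2_scalar_def)
      then have "marginal d j (\<psi> (Suc r)) = (\<lambda>s. 0)"
        using False by (intro ext) (simp add: marginal_def \<psi>_def)
      then show ?thesis using False by (simp add: K.kform_def)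
    qed
    then have "(\<Sum>j<d. K.kform (marginal d j (\<psi> (Suc r)))) = (\<Sum>j<d. if j = r mod d then lam (r div d) else 0)"
      by (intro sum.cong) auto
    also have "\<dots> = lam (r div d)" using md by simp
    finally show ?thesis unfolding integral_field_scalar_sq[OF psiL] .
  qed
  have sqint: "integrable M (\<lambda>\<omega>. (?ip (?V \<omega>) (\<psi> l))\<^sup>2)" for l
    by (rule L2_space_integrable_sq[OF field_scalar_L2[OF psiL]])
  have "(LINT \<omega>|M. sq_error ?N (additive_field X d) (Suc N) \<psi> \<omega>)
      = (LINT \<omega>|M. ?ip (?V \<omega>) (?V \<omega>) - (\<Sum>l<Suc N. (?ip (?V \<omega>) (\<psi> l))\<^sup>2))"
    unfolding sq_error_def
    using orthonormal_or_null_residual(4)[OF psi_on finite_lessThan field_L2]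
    by (intro Bochner_Integration.integral_cong) auto
  also have "\<dots> = real d * trace_const K - (\<Sum>l<Suc N. LINT \<omega>|M. (?ip (?V \<omega>) (\<psi> l))\<^sup>2)"
  proof -
    have "(LINT \<omega>|M. (\<Sum>l<Suc N. (?ip (?V \<omega>) (\<psi> l))\<^sup>2)) = (\<Sum>l<Suc N. LINT \<omega>|M. (?ip (?V \<omega>) (\<psi> l))\<^sup>2)"
      using sqint by (intro Bochner_Integration.integral_sum) auto
    moreover have "integrable M (\<lambda>\<omega>. \<Sum>l<Suc N. (?ip (?V \<omega>) (\<psi> l))\<^sup>2)"
      using sqint by (intro Bochner_Integration.integrable_sum) auto
    ultimately show ?thesis using field_norm by (simp only: Bochner_Integration.integral_diff)
  qed
  also have "(\<Sum>l<Suc N. LINT \<omega>|M. (?ip (?V \<omega>) (\<psi> l))\<^sup>2) = real d * mean_const K + (\<Sum>r<N. lam (r div d))"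
    unfolding sum.lessThan_Suc_shift using captured integral_field_mean_sq[of d]
    by (simp add: \<psi>_def)
  finally show "(LINT \<omega>|M. sq_error ?N (additive_field X d) (Suc N) \<psi> \<omega>)
      = real d * centred_trace K - (\<Sum>r<N. lam (r div d))"
    by (simp add: centred_trace_def algebra_simps)
qed

end

section \<open>The quantile integral\<close>

text \<open>L times the distribution function at z is the sum of the eigenvalues \<ge> exp(-z). It
  reaches L * y exactly when \<open>lam k\<close> is among them; ties only enter together with it.
  The level set is therefore a closed half-line starting at \<open>- ln (lam k)\<close>.\<close>

lemma exp_generalized_inverse_spectral_cdf:
  fixes lam :: "nat \<Rightarrow> real"
  assumes dec: "decseq lam" and nonneg: "\<And>k. 0 \<le> lam k" and lim: "lam \<longlonglongrightarrow> 0" and L: "0 < L"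
    and y: "(\<Sum>j<k. lam j) < L * y" "L * y \<le> (\<Sum>j<Suc k. lam j)"
  shows "exp (generalized_inverse (spectral_cdf L lam) y) = 1 / lam k"
proof -
  have pos: "0 < lam k" using y by simp
  have iff: "y \<le> spectral_cdf L lam z \<longleftrightarrow> - ln (lam k) \<le> z" for z
  proof -
    define A where "A = {j. exp (- z) \<le> lam j}"
    \<comment> \<open>Since the eigenvalues tend to 0, only finitely many reach exp(-z), and the
      series is a finite sum.\<close>
    have "eventually (\<lambda>j. lam j < exp (- z)) sequentially"
      using lim by (rule order_tendstoD) simp
    then obtain j0 where j0: "\<And>j. j0 \<le> j \<Longrightarrow> lam j < exp (- z)" by (auto simp: eventually_sequentially)
    then have "A \<subseteq> {..<j0}" unfolding A_def by (auto simp: not_le[symmetric] intro: leI)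
    then have fin: "finite A" by (rule finite_subset) simp
    have "(\<Sum>j. lam j * (if lam j \<ge> exp (- z) then 1 else 0)) = (\<Sum>j\<in>A. lam j * (if lam j \<ge> exp (- z) then 1 else 0))"
      by (rule suminf_finite[OF fin]) (simp add: A_def)
    also have "\<dots> = (\<Sum>j\<in>A. lam j)" by (intro sum.cong) (auto simp: A_def)
    finally have F: "spectral_cdf L lam z = (\<Sum>j\<in>A. lam j) / L" by (simp add: spectral_cdf_def)
    show ?thesis
    proof (cases "exp (- z) \<le> lam k")
      case True
      have "{..<Suc k} \<subseteq> A"
      proof
        fix j assume "j \<in> {..<Suc k}"
        then have "lam k \<le> lam j" using dec by (simp add: decseq_def)
        then show "j \<in> A" using True by (simp add: A_def)
      qed
      then have "(\<Sum>j<Suc k. lam j) \<le> (\<Sum>j\<in>A. lam j)"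
        using fin nonneg by (intro sum_mono2) auto
      then have "y \<le> spectral_cdf L lam z" using y(2) L by (simp add: F field_simps)
      moreover have "- z \<le> ln (lam k)" using True pos by (simp add: ln_ge_iff)
      ultimately show ?thesis by simp
    next
      case False
      have "A \<subseteq> {..<k}"
      proof
        fix j assume "j \<in> A"
        then have "lam k < lam j" using False by (simp add: A_def)
        then show "j \<in> {..<k}" using dec by (metis decseqD lessThan_iff linorder_not_less)
      qed
      then have "(\<Sum>j\<in>A. lam j) \<le> (\<Sum>j<k. lam j)"
        using nonneg by (intro sum_mono2) auto
      then have "\<not> y \<le> spectral_cdf L lam z" using y(1) L by (simp add: F field_simps)
      moreover have "\<not> - z \<le> ln (lam k)" using False pos by (simp add: ln_ge_iff)
      ultimately show ?thesis by auto
    qed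
  qed
  have "{z. y \<le> spectral_cdf L lam z} = {- ln (lam k)..}"
    using iff by auto
  then have "generalized_inverse (spectral_cdf L lam) y = - ln (lam k)"
    by (simp add: generalized_inverse_def)
  then show ?thesis using pos by (simp add: exp_minus field_simps)
qed

text \<open>The integrand equals \<open>1 / lam k\<close> on an interval of length
  \<open>lam k / L\<close>. After multiplication by L each full block contributes 1, so the integral
  counts eigenvalues; the last block is cut off at x.\<close>

lemma quantile_integral:
  fixes lam :: "nat \<Rightarrow> real"
  assumes dec: "decseq lam" and nonneg: "\<And>k. 0 \<le> lam k" and lim: "lam \<longlonglongrightarrow> 0" and L: "0 < L"
    and x: "(\<Sum>j<m. lam j) < L * x" "L * x \<le> (\<Sum>j<Suc m. lam j)"
  shows "L * (LINT y:{0<..<x}|lborel. exp (generalized_inverse (spectral_cdf L lam) y))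
    = real m + (L * x - (\<Sum>j<m. lam j)) / lam m"
proof -
  define S where "S k = (\<Sum>j<k. lam j)" for k
  have S0: "S 0 = 0" and SSuc: "S (Suc k) = S k + lam k" for k by (simp_all add: S_def)
  have Smono: "S j \<le> S k" if "j \<le> k" for j k
    unfolding S_def using that nonneg by (intro sum_mono2) auto
  have xS: "S m < L * x" "L * x \<le> S (Suc m)" using x by (simp_all add: S_def)
  have posm: "0 < lam m" using xS by (simp add: SSuc)
  have pos: "0 < lam k" if "k \<le> m" for k
    using decseqD[OF dec that] posm by linarith
  define b where "b k = min (S (Suc k) / L) x" for k
  define I where "I k = {S k / L<..b k}" for k
  have le: "S k / L \<le> b k" if "k \<le> m" for k
  proof -
    have "S k \<le> L * x" using Smono[OF that] xS(1) by linarith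
    then show ?thesis using Smono[of k "Suc k"] L by (simp add: b_def divide_right_mono field_simps)
  qed
  \<comment> \<open>At y = x the two sides differ: \<open>I m\<close> contains x, the open interval
    does not.\<close>
  have step: "indicator {0<..<x} y *\<^sub>R exp (generalized_inverse (spectral_cdf L lam) y)
      = (\<Sum>k\<le>m. 1 / lam k * indicator (I k) y)" if "y \<noteq> x" for y
  proof (cases "0 < y \<and> y < x")
    case True
    define k where "k = (LEAST k. L * y \<le> S (Suc k))"
    have "L * y \<le> S (Suc m)" using True xS(2) L mult_strict_left_mono[of y x L] by linarith
    then have k: "L * y \<le> S (Suc k)" "k \<le> m" unfolding k_def by (rule LeastI, rule Least_le)
    have kS: "S k < L * y"
    proof (cases k)
      case 0
      then show ?thesis using True L by (simp add: S0)
    next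
      case (Suc l)
      then have "\<not> L * y \<le> S (Suc l)" using not_less_Least[of l "\<lambda>k. L * y \<le> S (Suc k)"] by (simp add: k_def)
      then show ?thesis using Suc by simp
    qed
    have "y \<in> I k" using k kS True L by (simp add: I_def b_def field_simps)
    moreover have "y \<notin> I j" if "j \<noteq> k" for j
    proof (cases "j < k")
      case True
      then have "S (Suc j) < L * y" using Smono[of "Suc j" k] kS by simp
      then show ?thesis using L by (simp add: I_def b_def field_simps)
    next
      case False
      then have "L * y \<le> S j" using that k(1) Smono[of "Suc k" j] by simp
      then show ?thesis using L by (simp add: I_def field_simps)
    qed
    ultimately have "(\<Sum>j\<le>m. 1 / lam j * indicator (I j) y) = (\<Sum>j\<le>m. if j = k then 1 / lam k else 0)"
      by (intro sum.cong) auto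
    also have "\<dots> = 1 / lam k" using k(2) by simp
    finally show ?thesis
      using exp_generalized_inverse_spectral_cdf[OF dec nonneg lim L, of k y] k kS True
      by (simp add: S_def)
  next
    case False
    have "y \<notin> I k" for k
    proof -
      have "0 \<le> S k / L" using Smono[of 0 k] L by (simp add: S0)
      then show ?thesis using False that by (auto simp: I_def b_def)
    qed
    then show ?thesis using False by auto
  qed
  have Iint: "integrable lborel (\<lambda>y. 1 / lam k * indicator (I k) y :: real)" if "k \<le> m" for k
    using le[OF that] by (intro integrable_mult_right) (simp add: I_def)
  have Sint: "integrable lborel (\<lambda>y. \<Sum>k\<le>m. 1 / lam k * indicator (I k) y :: real)"
    using Iint by (intro Bochner_Integration.integrable_sum) auto
  have AEs: "AE y in lborel. (\<Sum>k\<le>m. 1 / lam k * indicator (I k) y)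
      = indicator {0<..<x} y *\<^sub>R exp (generalized_inverse (spectral_cdf L lam) y)"
    using AE_lborel_singleton[of x] by eventually_elim (rule step[symmetric])
  have "(LINT y:{0<..<x}|lborel. exp (generalized_inverse (spectral_cdf L lam) y))
      = (LINT y|lborel. (\<Sum>k\<le>m. 1 / lam k * indicator (I k) y))"
    unfolding set_lebesgue_integral_def
  proof (rule integral_cong_AE[symmetric])
    show "(\<lambda>y. \<Sum>k\<le>m. 1 / lam k * indicator (I k) y) \<in> borel_measurable lborel"
      using Sint by simp
    \<comment> \<open>Measurability of the integrand is inherited from the step function, corrected
      at the one point x.\<close>
    have m: "(\<lambda>y. if y = x then 0 else \<Sum>k\<le>m. 1 / lam k * indicator (I k) y) \<in> borel_measurable lborel"
      using Sint by (intro measurable_If) auto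
    have "(\<lambda>y. indicator {0<..<x} y *\<^sub>R exp (generalized_inverse (spectral_cdf L lam) y))
        = (\<lambda>y. if y = x then 0 else \<Sum>k\<le>m. 1 / lam k * indicator (I k) y)"
      using step by (intro ext) auto
    then show "(\<lambda>y. indicator {0<..<x} y *\<^sub>R exp (generalized_inverse (spectral_cdf L lam) y)) \<in> borel_measurable lborel"
      using m by simp
  qed (rule AEs)
  also have "\<dots> = (\<Sum>k\<le>m. 1 / lam k * (b k - S k / L))"
  proof -
    have "(LINT y|lborel. 1 / lam k * indicator (I k) y) = 1 / lam k * (b k - S k / L)" if "k \<le> m" for k
      using le[OF that] by (simp add: I_def)
    then have "(\<Sum>k\<le>m. LINT y|lborel. 1 / lam k * indicator (I k) y) = (\<Sum>k\<le>m. 1 / lam k * (b k - S k / L))"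
      by (intro sum.cong refl) auto
    then show ?thesis using Iint by (subst Bochner_Integration.integral_sum) auto
  qed
  also have "\<dots> = (\<Sum>k<m. 1 / L) + 1 / lam m * (x - S m / L)"
  proof -
    have "1 / lam k * (b k - S k / L) = 1 / L" if "k < m" for k
    proof -
      have "S (Suc k) \<le> L * x" using Smono[of "Suc k" m] that xS(1) by simp
      then have "b k = S (Suc k) / L" using L by (simp add: b_def min_def field_simps)
      then show ?thesis using pos[of k] that L by (simp add: SSuc field_simps)
    qed
    moreover have "b m = x" using xS(2) L by (simp add: b_def min_def field_simps)
    ultimately show ?thesis by (simp add: lessThan_Suc_atMost[symmetric])
  qed
  finally show ?thesis using L posm by (simp add: S_def field_simps)
qed

lemma sum_blocks:
  fixes f :: "nat \<Rightarrow> real"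
  assumes "m * d \<le> N" "N \<le> Suc m * d"
  shows "(\<Sum>r<N. f (r div d)) = real d * (\<Sum>k<m. f k) + (real N - real m * real d) * f m"
proof -
  have block: "r div d = k" if "k * d \<le> r" "r < Suc k * d" for r k
    using that by (intro div_nat_eqI) (auto simp: mult.commute)
  have "(\<Sum>r<N. f (r div d)) = (\<Sum>r<m * d. f (r div d)) + (\<Sum>r = m * d..<N. f (r div d))"
    using assms(1) by (simp add: lessThan_atLeast0 sum.atLeastLessThan_concat)
  also have "(\<Sum>r = m * d..<N. f (r div d)) = (\<Sum>r = m * d..<N. f m)"
    using block[of m] assms(2) by (intro sum.cong) auto
  also have "(\<Sum>r<m * d. f (r div d)) = (\<Sum>k<m. \<Sum>r = k * d..<k * d + d. f (r div d))"
    by (rule sum.nat_group[symmetric])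
  also have "\<dots> = (\<Sum>k<m. \<Sum>r = k * d..<k * d + d. f k)"
    using block by (intro sum.cong) auto
  finally show ?thesis
    using assms(1) by (simp add: sum_distrib_left of_nat_diff)
qed

section \<open>Two-sided bounds for the complexity\<close>

context additive_spectrum
begin

text \<open>All d copies of the first m eigenvalues are used up, and the fraction \<theta> of the d
  copies of \<open>lam m\<close>. The summand 2 consists of one for rounding d * u up and one for
  the constant function.\<close>

lemma complexity_bounds:
  assumes d: "0 < d" and \<epsilon>: "0 < \<epsilon>"
    and target: "(\<Sum>k<m. lam k) < centred_trace K - \<epsilon>\<^sup>2 * trace_const K"
      "centred_trace K - \<epsilon>\<^sup>2 * trace_const K \<le> (\<Sum>k<Suc m. lam k)"
  defines "u \<equiv> real m + (centred_trace K - \<epsilon>\<^sup>2 * trace_const K - (\<Sum>k<m. lam k)) / lam m"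
  shows "real d * u \<le> real (avg_complexity M (cube_leb d) (additive_field X d) \<epsilon>)"
    and "real (avg_complexity M (cube_leb d) (additive_field X d) \<epsilon>) \<le> real d * u + 2"
proof -
  define x where "x = centred_trace K - \<epsilon>\<^sup>2 * trace_const K"
  define \<theta> where "\<theta> = (x - (\<Sum>k<m. lam k)) / lam m"
  have pos: "0 < lam m" using target by simp
  have \<theta>: "0 < \<theta>" "\<theta> \<le> 1" using target pos by (simp_all add: \<theta>_def x_def)
  have \<theta>m: "\<theta> * lam m = x - (\<Sum>k<m. lam k)" using pos by (simp add: \<theta>_def)
  have u: "u = real m + \<theta>" by (simp add: u_def \<theta>_def x_def)
  define P where "P n \<longleftrightarrow> 1 \<le> n \<and> avg_error M (cube_leb d) (additive_field X d) n
      \<le> \<epsilon> * avg_error M (cube_leb d) (additive_field X d) 0" for n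
  have rhs: "\<epsilon> * avg_error M (cube_leb d) (additive_field X d) 0 = sqrt (\<epsilon>\<^sup>2 * (real d * trace_const K))"
    using \<epsilon> by (simp add: avg_error_0 real_sqrt_mult)
  have lower: "real d * u \<le> real n" if "P n" for n
  proof -
    define b where "b = real d * centred_trace K - real d * (\<Sum>k<m. lam k - lam m) - real n * lam m"
    have "sqrt b \<le> avg_error M (cube_leb d) (additive_field X d) n"
      unfolding b_def using \<open>P n\<close> by (intro avg_error_ge sq_error_ge) (auto simp: P_def)
    also have "\<dots> \<le> sqrt (\<epsilon>\<^sup>2 * (real d * trace_const K))" using \<open>P n\<close> by (simp add: P_def rhs)
    finally have "b \<le> \<epsilon>\<^sup>2 * (real d * trace_const K)" by simp
    then have "real d * (\<theta> * lam m) + real d * (real m * lam m) \<le> real n * lam m"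
      by (simp add: b_def \<theta>m x_def sum_subtractf algebra_simps)
    then have "(real d * u) * lam m \<le> real n * lam m" by (simp add: u algebra_simps)
    then show ?thesis using pos by simp
  qed
  define N where "N = nat \<lceil>real d * u\<rceil>"
  have N: "real d * u \<le> real N" "real N \<le> real d * u + 1"
    using \<theta> by (simp_all add: N_def u)
  \<comment> \<open>N stays inside block m because \<theta> is in (0, 1]; hence every eigenvalue
    used is at least \<open>lam m\<close>, which is positive.\<close>
  have Nm: "m * d \<le> N" "N \<le> Suc m * d"
  proof -
    have "real (m * d) \<le> real d * u" using \<theta> by (simp add: u algebra_simps)
    then show "m * d \<le> N" using N(1) by (metis of_nat_le_iff order_trans)
    have "real d * u \<le> real d * real (Suc m)" using \<theta> by (intro mult_left_mono) (auto simp: u)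
    then have "\<lceil>real d * u\<rceil> \<le> int (Suc m * d)" by (simp add: ceiling_le_iff algebra_simps)
    then show "N \<le> Suc m * d" by (simp only: N_def nat_le_iff)
  qed
  have "P (Suc N)"
  proof -
    define \<psi> where "\<psi> = (\<lambda>l. case l of 0 \<Rightarrow> (\<lambda>t. 1) | Suc r \<Rightarrow> (\<lambda>t. \<phi> (r div d) (t (r mod d))))"
    have lampos: "0 < lam (r div d)" if "r < N" for r
    proof -
      have "r div d < Suc m" using that Nm(2) d by (simp add: less_mult_imp_div_less)
      then have "lam m \<le> lam (r div d)" using eig.lam_dec by (simp add: decseq_def)
      then show ?thesis using pos by simp
    qed
    have psi: "\<psi> l \<in> L2_space (cube_leb d)" for l
      unfolding \<psi>_def by (rule sq_error_attained(1)[OF d lampos])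
    have err: "(LINT \<omega>|M. sq_error (cube_leb d) (additive_field X d) (Suc N) \<psi> \<omega>)
        = real d * centred_trace K - (\<Sum>r<N. lam (r div d))"
      unfolding \<psi>_def by (rule sq_error_attained(2)[OF d lampos])
    have "avg_error M (cube_leb d) (additive_field X d) (Suc N)
        \<le> sqrt (LINT \<omega>|M. sq_error (cube_leb d) (additive_field X d) (Suc N) \<psi> \<omega>)"
      by (rule avg_error_le) (use psi in auto)
    also have "\<dots> \<le> sqrt (\<epsilon>\<^sup>2 * (real d * trace_const K))"
    proof (rule real_sqrt_le_mono)
      have "(real N - real m * real d) * lam m \<ge> (real d * \<theta>) * lam m"
        using N(1) pos by (intro mult_right_mono) (auto simp: u algebra_simps)
      moreover have "(real d * \<theta>) * lam m = real d * x - real d * (\<Sum>k<m. lam k)"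
        by (simp add: mult.assoc \<theta>m right_diff_distrib)
      ultimately have "real d * x \<le> real d * (\<Sum>k<m. lam k) + (real N - real m * real d) * lam m"
        by linarith
      also have "\<dots> = (\<Sum>r<N. lam (r div d))" by (rule sum_blocks[OF Nm, symmetric])
      finally show "(LINT \<omega>|M. sq_error (cube_leb d) (additive_field X d) (Suc N) \<psi> \<omega>)
          \<le> \<epsilon>\<^sup>2 * (real d * trace_const K)"
        unfolding err by (simp add: x_def algebra_simps)
    qed
    finally show ?thesis by (simp add: P_def rhs)
  qed
  have n: "avg_complexity M (cube_leb d) (additive_field X d) \<epsilon> = (LEAST n. P n)"
    by (simp add: avg_complexity_def P_def)
  show "real d * u \<le> real (avg_complexity M (cube_leb d) (additive_field X d) \<epsilon>)"
    unfolding n using \<open>P (Suc N)\<close> by (intro lower LeastI)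
  have "(LEAST n. P n) \<le> Suc N" using \<open>P (Suc N)\<close> by (rule Least_le)
  then show "real (avg_complexity M (cube_leb d) (additive_field X d) \<epsilon>) \<le> real d * u + 2"
    unfolding n using N(2) by linarith
qed

end

theorem theorem2:
  fixes M :: "'a measure"
    and X :: "nat \<Rightarrow> real \<Rightarrow> 'a \<Rightarrow> real"
    and K :: "real \<Rightarrow> real \<Rightarrow> real"
    and lam :: "nat \<Rightarrow> real"
    and \<epsilon> :: real
    and i :: nat
  assumes "prob_space M"
    and joint_meas: "\<And>j. (\<lambda>(t, \<omega>). X j t \<omega>) \<in> borel_measurable (unit_leb \<Otimes>\<^sub>M M)"
    and paths: "\<And>j \<omega>. \<omega> \<in> space M \<Longrightarrow> (\<lambda>t. X j t \<omega>) \<in> L2_space unit_leb"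
    and second_moment: "\<And>j t. t \<in> {0..1} \<Longrightarrow> integrable M (\<lambda>\<omega>. (X j t \<omega>)\<^sup>2)"
    and zero_mean: "\<And>j t. t \<in> {0..1} \<Longrightarrow> (LINT \<omega>|M. X j t \<omega>) = 0"
    and covariance: "\<And>j t s. t \<in> {0..1} \<Longrightarrow> s \<in> {0..1} \<Longrightarrow> (LINT \<omega>|M. X j t \<omega> * X j s \<omega>) = K t s"
    and cov_cont: "continuous_on ({0..1} \<times> {0..1}) (\<lambda>(t, s). K t s)"
    and uncorrelated: "\<And>j k t s. j \<noteq> k \<Longrightarrow> t \<in> {0..1} \<Longrightarrow> s \<in> {0..1} \<Longrightarrow>
            (LINT \<omega>|M. X j t \<omega> * X k s \<omega>) = 0"
    and eigenvalues: "eigenvalue_sequence (centred_cov M (X i)) lam"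
    and nondegenerate: "centred_trace K \<noteq> 0"
    and eps: "0 < \<epsilon>" "\<epsilon> < eps0 K"
  shows "(\<lambda>d. real (avg_complexity M (cube_leb d) (additive_field X d) \<epsilon>)
              / (real d * q_const K lam \<epsilon>)) \<longlonglongrightarrow> 1"
proof -
  interpret prob_space M by fact
  interpret uncorrelated_processes M X K
    by unfold_locales (fact joint_meas paths second_moment covariance cov_cont uncorrelated)+
  interpret C: continuous_kernel "centred_cov M (X i)" by (rule centred_kernel)
  obtain \<phi> where "eigensystem (centred_cov M (X i)) lam \<phi>"
    using C.eigensystem_exists[OF eigenvalues] by blast
  then interpret eig: eigensystem "centred_cov M (X i)" lam \<phi> .
  interpret additive_spectrum M X K i lam \<phi> by unfold_locales
  \<comment> \<open>The centred trace is an integral of second moments; being nonzero, it is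
    positive.\<close>
  have "0 \<le> (LINT t|unit_leb. centred_cov M (X i) t t)"
    by (intro Bochner_Integration.integral_nonneg) (simp add: centred_cov_def)
  then have L: "0 < centred_trace K" using nondegenerate by (simp add: trace_centred_cov)
  have "0 \<le> mean_const K"
    using scalar_coef_coef[OF one_L2 one_L2, of 0 0] L2_scalar_self_nonneg[of M "coef 0 (\<lambda>t. 1)"]
    by (simp add: mean_const_eq)
  then have T: "0 < trace_const K" using L by (simp add: centred_trace_def)
  have e0: "0 < eps0 K" "(eps0 K)\<^sup>2 = centred_trace K / trace_const K"
    using L T by (simp_all add: eps0_def)
  define y where "y = 1 - (\<epsilon> / eps0 K)\<^sup>2"
  have Ly: "centred_trace K * y = centred_trace K - \<epsilon>\<^sup>2 * trace_const K"
    using L T by (simp add: y_def power_divide e0 field_simps)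
  have "(\<epsilon> / eps0 K)\<^sup>2 < 1"
    using eps e0(1) by (simp add: power_less_one_iff abs_square_less_1)
  then have y: "0 < y" by (simp add: y_def)
  \<comment> \<open>y < 1 leaves a gap below the centred trace, and some partial sum of
    \<open>lam\<close> falls within it.\<close>
  have "0 < (\<epsilon> / eps0 K)\<^sup>2" using eps(1) e0(1) by simp
  then have "0 < centred_trace K - centred_trace K * y"
    using L by (simp add: y_def algebra_simps)
  then obtain m' where "centred_trace K * y \<le> (\<Sum>k<m'. lam k)"
    using eig.trace_le_eigenvalue_sum[of "centred_trace K - centred_trace K * y"] trace_centred_cov[of i] by auto
  moreover have "(\<Sum>k<m'. lam k) \<le> (\<Sum>k<Suc m'. lam k)" using eig.lam_nonneg by simp
  ultimately have ex: "centred_trace K * y \<le> (\<Sum>k<Suc m'. lam k)" by linarith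
  \<comment> \<open>Minimality makes the lower inequality strict, and the two inequalities together
    force \<open>lam m\<close> to be positive.\<close>
  define m where "m = (LEAST m. centred_trace K * y \<le> (\<Sum>k<Suc m. lam k))"
  have upper: "centred_trace K * y \<le> (\<Sum>k<Suc m. lam k)" unfolding m_def using ex by (rule LeastI)
  have lower: "(\<Sum>k<m. lam k) < centred_trace K * y"
  proof (cases m)
    case 0
    then show ?thesis using L y by simp
  next
    case (Suc l)
    then show ?thesis
      using not_less_Least[of l "\<lambda>m. centred_trace K * y \<le> (\<Sum>k<Suc m. lam k)"] by (simp add: m_def)
  qed
  define u where "u = real m + (centred_trace K * y - (\<Sum>k<m. lam k)) / lam m"
  have q: "q_const K lam \<epsilon> = u"
    unfolding q_const_def y_def[symmetric] u_def
    by (rule quantile_integral[OF eig.lam_dec eig.lam_nonneg eig.lam_tendsto_0 L lower upper])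
  have "0 < lam m" using lower upper by simp
  then have upos: "0 < u" using lower by (auto simp: u_def intro!: add_nonneg_pos)
  have bounds: "real d * u \<le> real (avg_complexity M (cube_leb d) (additive_field X d) \<epsilon>)"
    "real (avg_complexity M (cube_leb d) (additive_field X d) \<epsilon>) \<le> real d * u + 2" if "0 < d" for d
    using complexity_bounds[OF that eps(1), of m] lower upper by (simp_all add: Ly u_def)
  show ?thesis
    unfolding q
  proof (rule tendsto_sandwich)
    show "\<forall>\<^sub>F d in sequentially. 1 \<le> real (avg_complexity M (cube_leb d) (additive_field X d) \<epsilon>) / (real d * u)"
      using eventually_gt_at_top[of 0] by eventually_elim (use bounds(1) upos in simp)
    show "\<forall>\<^sub>F d in sequentially. real (avg_complexity M (cube_leb d) (additive_field X d) \<epsilon>) / (real d * u)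
        \<le> 1 + 2 / u * (1 / real d)"
      using eventually_gt_at_top[of 0]
    proof eventually_elim
      case (elim d)
      then show ?case using bounds(2)[of d] upos by (simp add: field_simps)
    qed
    have "(\<lambda>d. 1 + 2 / u * (1 / real d)) \<longlonglongrightarrow> 1 + 2 / u * 0"
      by (intro tendsto_intros lim_1_over_n)
    then show "(\<lambda>d. 1 + 2 / u * (1 / real d)) \<longlonglongrightarrow> 1" by simp
  qed simp
qed

end
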